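(* Let $\hat\lambda$ be an eigenvalue of $A\in\mathbb{C}^{n\times n}$ with multiplicity support $m\times k$, let $S=[s_{ij}]\in\mathbb{C}^{k\times k}$ be a fixed matrix with $s_{ij}=0$ for $i\ge j$ and $s_{12}s_{23}\cdots s_{k-1,k}\neq0$, and define $$\mathbf{f}:\mathbb{C}\times\mathbb{C}^{n\times k}\times\mathbb{C}^{n\times n}\to\mathbb{C}^{n\times k},\qquad(\lambda,X,G)\mapsto G\,X-\lambda X-X\,S .$$ Let $r=1+(n-m)k$, and consider the solution set $$\big\{(\hat\lambda,\hat X)\;\big|\;\hat X=X_0^*+Y_0Z,\ Z\in\mathbb{C}^{m\times k}\big\}$$ of $A X-\lambda X-XS=O$, where $X_0^*\in\mathbb{C}^{n\times k}$ and $Y_0\in\mathbb{C}^{n\times m}$ with $\mathrm{Range}(Y_0)=\mathrm{Kernel}(A-\hat\lambda I)$. Then, for any $\tilde A\in\mathbb{C}^{n\times n}$ sufficiently close to $A$, the rank-$r$ Newton's iteration $$(\lambda_{j+1},X_{j+1})=(\lambda_j,X_j)-\mathbf{f}_{\lambda X}(\lambda_j,X_j,\tilde A)_{\text{rank-}r}^{\dagger}\,\mathbf{f}(\lambda_j,X_j,\tilde A),\qquad j=0,1,\ldots$$ from any initial iterate $(\lambda_0,X_0)$ close to a solution in this solution set converges to a point $(\tilde\lambda,\tilde X)\in\mathbb{C}\times\mathbb{C}^{n\times k}$ with the error bound $$\big\|(\tilde\lambda,\tilde X)-(\hat\lambda,\check X)\big\|\le\alpha\,\big\|\mathbf{f}_{\lambda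 X}(\hat\lambda,\check X,A)_{\text{rank-}r}^{\dagger}\big\|\,\|\check X\|_2\,\|A-\tilde A\|_F+O\big(\|A-\tilde A\|_F^2\big),$$ where $\alpha=O(1)$ is a constant and $(\hat\lambda,\check X)$ is an exact solution in this solution set. The convergence is quadratic if $\tilde A=A$.
   Context: An eigenvalue $\hat\lambda$ of $A\in\mathbb{C}^{n\times n}$ has multiplicity support $m\times k$ if its geometric multiplicity is $m$ and the smallest size of its Jordan blocks is $k$. Matrix spaces carry the Frobenius norm $\|\cdot\|_F$; $\|\cdot\|_2$ of a matrix is the spectral norm. A product space carries the norm $\|(\mathbf{v},\mathbf{w})\|=\sqrt{\|\mathbf{v}\|^2+\|\mathbf{w}\|^2}$, and linear maps carry the operator norm. $\mathbf{f}_{\lambda X}$ is the partial Jacobian of $\mathbf{f}$ with respect to $(\lambda,X)$, a linear map from $\mathbb{C}\times\mathbb{C}^{n\times k}$ to $\mathbb{C}^{n\times k}$. For a matrix $B$, the rank-$r$ projection $B_{\text{rank-}r}$ is the rank-$r$ matrix with the smallest Frobenius distance to $B$ (the rank-$r$ truncated SVD), and $B_{\text{rank-}r}^{\dagger}$ is the Moore–Penrose inverse of $B_{\text{rank-}r}$. For linear maps these are defined through the matrix with respect to isometric isomorphisms with Euclidean spaces. "Sufficiently close" and "close" mean: for each solution in the solution set there exist a neighborhood of $A$ and a neighborhood of that solution such that the assertion holds for all data $\tilde A$ and all initial iterates in them, respectively, with $\alpha$ independent of $\tilde A$ and of the initial iterate. The norm $\|\mathbf{f}_{\lambda X}(\hat\lambda,\check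 X,A)_{\text{rank-}r}^{\dagger}\|$ can be defined as the condition number of $\hat\lambda$.
   Formalization: Convergence is claimed only near solutions where the rank-r projection of the Jacobian exists (shown dense in the solution set), since it fails e.g. at X=0; and X_0^* may depend on Z, since a constant X_0^* cannot parametrize the solution set when k≥2. *)

theory Defs
  imports "Jordan_Normal_Form.Jordan_Normal_Form" "HOL-Analysis.Analysis"
begin

hide_type (open) Matrix.vec
hide_const (open) Matrix.mat Matrix.vec Matrix.row Matrix.rows Matrix.col Matrix.cols
no_notation Matrix.vec_index (infixl \<open>$\<close> 100)

section \<open>Multiplicity support\<close>

text \<open>The Jordan structure is taken from the list-indexed \<^const>\<open>jordan_nf\<close>.  The enumeration of
  the index type is irrelevant, since two enumerations give permutation-similar matrices.\<close>

definition has_jordan_blocks :: "complex^'n^'n \<Rightarrow> (nat \<times> complex) list \<Rightarrow> bool" where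
  "has_jordan_blocks A bs \<longleftrightarrow>
     (\<exists>h. bij_betw h {..<CARD('n)} (UNIV :: 'n set) \<and>
          jordan_nf (Matrix.mat CARD('n) CARD('n) (\<lambda>(i, j). A $ h i $ h j)) bs)"

definition multiplicity_support :: "complex^'n^'n \<Rightarrow> complex \<Rightarrow> nat \<Rightarrow> nat \<Rightarrow> bool" where
  "multiplicity_support A lam m k \<longleftrightarrow>
     (\<exists>v. v \<noteq> 0 \<and> A *v v = lam *s v) \<and>
     vec.dim {v. A *v v = lam *s v} = m \<and>
     (\<exists>bs. has_jordan_blocks A bs \<and> Min {s. (s, lam) \<in> set bs} = k)"

section \<open>Rank-\<open>r\<close> projection and Moore--Penrose inverse\<close>

text \<open>The norm of \<^typ>\<open>complex^'b^'a\<close> is the Frobenius norm.\<close>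

definition is_rank_projection :: "nat \<Rightarrow> complex^'b^'a \<Rightarrow> complex^'b^'a \<Rightarrow> bool" where
  "is_rank_projection r B C \<longleftrightarrow> is_arg_min (\<lambda>C. norm (B - C)) (\<lambda>C. rank C = r) C"

text \<open>A nearest matrix of rank exactly \<open>r\<close> need not exist (if \<open>B\<close> has smaller rank) and need not
  be unique (if the singular values number \<open>r\<close> and \<open>r + 1\<close> coincide).\<close>

definition rank_projection_defined :: "nat \<Rightarrow> complex^'b^'a \<Rightarrow> bool" where
  "rank_projection_defined r B \<longleftrightarrow> (\<exists>!C. is_rank_projection r B C)"

definition rank_projection :: "nat \<Rightarrow> complex^'b^'a \<Rightarrow> complex^'b^'a" where
  "rank_projection r B = (THE C. is_rank_projection r B C)"

definition conj_transpose :: "complex^'b^'a \<Rightarrow> complex^'a^'b" where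
  "conj_transpose B = map_matrix cnj (transpose B)"

definition is_pinv :: "complex^'b^'a \<Rightarrow> complex^'a^'b \<Rightarrow> bool" where
  "is_pinv B C \<longleftrightarrow> B ** C ** B = B \<and> C ** B ** C = C \<and>
     conj_transpose (B ** C) = B ** C \<and> conj_transpose (C ** B) = C ** B"

definition pinv :: "complex^'b^'a \<Rightarrow> complex^'a^'b" where
  "pinv B = (THE C. is_pinv B C)"

section \<open>Linear maps from pairs (scalar, matrix) to matrices\<close>

definition flatten :: "complex^'k^'n \<Rightarrow> complex^('n \<times> 'k)" where
  "flatten X = (\<chi> t. X $ fst t $ snd t)"

definition flatten_pair :: "complex \<times> (complex^'k^'n) \<Rightarrow> complex^(unit + 'n \<times> 'k)" where
  "flatten_pair p = (\<chi> t. case t of Inl u \<Rightarrow> fst p | Inr (i, j) \<Rightarrow> snd p $ i $ j)"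

definition unflatten_pair :: "complex^(unit + 'n \<times> 'k) \<Rightarrow> complex \<times> (complex^'k^'n)" where
  "unflatten_pair v = (v $ Inl (), \<chi> i j. v $ Inr (i, j))"

text \<open>Matrix of a complex-linear map with respect to these isometric identifications, and the
  Moore--Penrose inverse of its rank-\<open>r\<close> projection, transported back to a linear map.\<close>

definition map_to_matrix ::
  "(complex \<times> (complex^'k^'n) \<Rightarrow> complex^'k^'n) \<Rightarrow> complex^(unit + 'n \<times> 'k)^('n \<times> 'k)" where
  "map_to_matrix L = matrix (\<lambda>v. flatten (L (unflatten_pair v)))"

definition rank_pinv ::
  "nat \<Rightarrow> (complex \<times> (complex^'k^'n) \<Rightarrow> complex^'k^'n) \<Rightarrow> complex^'k^'n \<Rightarrow> complex \<times> (complex^'k^'n)" where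
  "rank_pinv r L Y = unflatten_pair (pinv (rank_projection r (map_to_matrix L)) *v flatten Y)"

lemma unflatten_flatten_pair: "unflatten_pair (flatten_pair p) = p"
  by (cases p) (simp add: unflatten_pair_def flatten_pair_def vec_eq_iff)

lemma flatten_unflatten_pair: "flatten_pair (unflatten_pair v) = v"
  by (auto simp: unflatten_pair_def flatten_pair_def vec_eq_iff split: sum.split)

lemma norm_flatten: "norm (flatten X) = norm X"
proof -
  have "(\<Sum>t\<in>UNIV. (norm (flatten X $ t))\<^sup>2) = (\<Sum>i\<in>UNIV. \<Sum>j\<in>UNIV. (norm (X $ i $ j))\<^sup>2)"
    unfolding sum.cartesian_product UNIV_Times_UNIV
    by (intro sum.cong) (auto simp: flatten_def)
  then show ?thesis
    by (simp add: norm_vec_def L2_set_def sum_nonneg)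
qed

lemma norm_flatten_pair: "norm (flatten_pair p) = norm p"
proof -
  have "(\<Sum>t\<in>UNIV. (norm (flatten_pair p $ t))\<^sup>2) =
      (\<Sum>t\<in>UNIV. (norm (flatten_pair p $ Inl t))\<^sup>2) + (\<Sum>t\<in>UNIV. (norm (flatten_pair p $ Inr t))\<^sup>2)"
    by (subst UNIV_sum, subst sum.union_disjoint) (auto simp: sum.reindex)
  also have "(\<Sum>t\<in>UNIV. (norm (flatten_pair p $ Inl t))\<^sup>2) = (norm (fst p))\<^sup>2"
    by (simp add: flatten_pair_def UNIV_unit)
  also have "(\<Sum>t\<in>UNIV. (norm (flatten_pair p $ Inr t))\<^sup>2) =
      (\<Sum>t\<in>UNIV. (norm (flatten (snd p) $ t))\<^sup>2)"
    by (intro sum.cong) (auto simp: flatten_pair_def flatten_def)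
  also have "\<dots> = (norm (flatten (snd p)))\<^sup>2"
    by (simp add: norm_vec_def L2_set_def sum_nonneg)
  finally show ?thesis
    by (simp add: norm_flatten norm_vec_def[of "flatten_pair p"] L2_set_def norm_prod_def)
qed

section \<open>The map \<open>f\<close>, its partial Jacobian and the rank-\<open>r\<close> Newton iteration\<close>

definition eig_map ::
  "complex^'k^'k \<Rightarrow> complex \<times> (complex^'k^'n) \<Rightarrow> complex^'n^'n \<Rightarrow> complex^'k^'n" where
  "eig_map S p G = G ** snd p - mat (fst p) ** snd p - snd p ** S"

definition eig_jacobian ::
  "complex^'k^'k \<Rightarrow> complex \<times> (complex^'k^'n) \<Rightarrow> complex^'n^'n \<Rightarrow>
     (complex \<times> (complex^'k^'n) \<Rightarrow> complex^'k^'n)" where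
  "eig_jacobian S p G = frechet_derivative (\<lambda>q. eig_map S q G) (at p)"

text \<open>The Frechet derivative is real-linear by definition; here it is complex-linear, so that
  \<^const>\<open>map_to_matrix\<close> represents it.\<close>

lemma eig_jacobian_eq:
  fixes G :: "complex^'n^'n" and S :: "complex^'k^'k"
  shows "eig_jacobian S p G q =
     G ** snd q - mat (fst p) ** snd q - mat (fst q) ** snd p - snd q ** S"
proof -
  have lin: "linear (\<lambda>q :: complex \<times> (complex^'k^'n). G ** snd q)"
    "linear (\<lambda>q :: complex \<times> (complex^'k^'n). snd q ** S)"
    by (intro linearI; auto simp: matrix_matrix_mult_def vec_eq_iff algebra_simps
        sum.distrib scaleR_sum_right)+
  have scal: "mat l ** X = (\<chi> i j. l * X $ i $ j)" for l :: complex and X :: "complex^'k^'n"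
    by (simp add: matrix_matrix_mult_def mat_def vec_eq_iff if_distrib[of "\<lambda>x. x * _"] cong: if_cong)
  have bil: "bounded_bilinear (\<lambda>(l :: complex) (X :: complex^'k^'n). mat l ** X)"
    by (subst bilinear_conv_bounded_bilinear[symmetric])
      (auto simp: bilinear_def scal vec_eq_iff algebra_simps intro!: linearI)
  have "((\<lambda>q. (G ** snd q - snd q ** S) - mat (fst q) ** snd q) has_derivative
      (\<lambda>q. (G ** snd q - snd q ** S) - (mat (fst p) ** snd q + mat (fst q) ** snd p))) (at p)"
    by (intro has_derivative_diff bounded_linear_imp_has_derivative
        bounded_bilinear.FDERIV[OF bil] has_derivative_fst has_derivative_snd has_derivative_ident)
      (use lin in \<open>simp_all add: linear_conv_bounded_linear bounded_linear_fst bounded_linear_snd\<close>)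
  then have "((\<lambda>q. eig_map S q G) has_derivative
      (\<lambda>q. (G ** snd q - snd q ** S) - (mat (fst p) ** snd q + mat (fst q) ** snd p))) (at p)"
    by (simp add: eig_map_def algebra_simps)
  then show ?thesis
    unfolding eig_jacobian_def
    by (subst frechet_derivative_at[symmetric]) (auto simp: algebra_simps)
qed

text \<open>Whenever the zeros of the map at a fixed eigenvalue are written as \<open>X0 + Y0 ** Z\<close> with
  the columns of \<open>Y0\<close> spanning the eigenspace, \<open>X0\<close> has to vary with \<open>Z\<close> as soon as the
  matrices have two or more columns: adding \<open>Y0 ** Z\<close> to a zero gives a zero only if
  \<open>Y0 ** Z ** S = 0\<close>.  Also, the Jacobian has rank below the generic one at some zeros, such as
  those with vanishing matrix part; no nearest matrix of the generic rank exists there, which the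
  following predicate detects.\<close>

definition jacobian_projection_defined ::
  "nat \<Rightarrow> complex^'k^'k \<Rightarrow> complex \<times> (complex^'k^'n) \<Rightarrow> complex^'n^'n \<Rightarrow> bool" where
  "jacobian_projection_defined r S p G \<longleftrightarrow>
     rank_projection_defined r (map_to_matrix (eig_jacobian S p G))"

primrec rank_newton ::
  "nat \<Rightarrow> complex^'k^'k \<Rightarrow> complex^'n^'n \<Rightarrow> complex \<times> (complex^'k^'n) \<Rightarrow> nat \<Rightarrow>
     complex \<times> (complex^'k^'n)" where
  "rank_newton r S G p 0 = p"
| "rank_newton r S G p (Suc j) =
     rank_newton r S G p j -
       rank_pinv r (eig_jacobian S (rank_newton r S G p j) G) (eig_map S (rank_newton r S G p j) G)"

definition quadratically_tendsto :: "(nat \<Rightarrow> 'a :: real_normed_vector) \<Rightarrow> 'a \<Rightarrow> bool" where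
  "quadratically_tendsto x l \<longleftrightarrow>
     x \<longlonglongrightarrow> l \<and>
     (\<exists>M. \<forall>\<^sub>F j in sequentially. norm (x (Suc j) - l) \<le> M * (norm (x j - l))\<^sup>2)"

end

theory Submission
  imports Defs "Jordan_Normal_Form.Jordan_Normal_Form_Uniqueness"
begin

text \<open>Write \<open>N = A - lam\<close> and \<open>T Y = N Y - Y S\<close>.  Evaluation at a cyclic vector of \<open>S\<close> identifies
  the kernel of \<open>T\<close> with the kernel of \<open>N\<^sup>k\<close>, which has dimension \<open>m k\<close> because all Jordan blocks have
  size at least \<open>k\<close>; a block of size exactly \<open>k\<close> provides a kernel element outside the range of \<open>T\<close>.
  Hence the Jacobian has rank at most \<open>r\<close> on the solution set, with equality on a dense subset, and
  where equality holds its kernel is the direction space of the (affine) solution set.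

  For \<open>J\<close> near a matrix of rank \<open>r\<close>, the truncation of \<open>J\<close> is unique, its pseudoinverse is bounded and
  the projection onto its range is Lipschitz (sine theta theorem).  So if \<open>P\<close>, \<open>P'\<close> are the range
  projections at two consecutive iterates, the next residual is \<open>(1 - P) f\<close> up to second order, and
  \<open>P' (1 - P)\<close> is as small as the step: the step lengths contract and the limit satisfies \<open>P f = 0\<close>.
  Dropping a perpendicular from a point \<open>x\<close> on the solution set gives \<open>x - z\<close> orthogonal to the kernel
  of the Jacobian at \<open>z\<close>, which bounds its length by \<open>P f\<close> at \<open>x\<close> and the perturbation.  This yields
  the error estimate, and for the unperturbed problem makes \<open>(1 - P) f\<close> as small as the step itself,
  so that convergence is quadratic.\<close>

text \<open>Near the solution set the Jacobian may have rank above \<open>r\<close>, and its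
  truncation is given only as a nearest point in the set of matrices of rank exactly
  \<open>r\<close>, which need not be closed. No singular values are used: stationarity of the
  distance at a nearest point makes the discarded part orthogonal to the retained one on both sides,
  and this alone carries uniqueness, the bounds and the angle estimate. For perturbed data the
  residual need not tend to zero, because the part outside the range of the truncated Jacobian is
  invisible to the step. This rules out the usual quadratic argument and leaves a contraction; the
  limit is then compared with a foot point on the solution set, which is the exact solution in the
  error bound and varies with the limit. The condition number and the spectral norm of the matrix
  part enter only at the end: near a solution with nondegenerate Jacobian both are bounded away from
  zero, so a bound linear in the perturbation already has the required form, with no second-order
  term.\<close>

hide_type (open) Matrix.vec
hide_const (open) Coset.flatten VectorSpace.subspace
hide_const (open) Matrix.mat Matrix.vec Matrix.row Matrix.rows Matrix.col Matrix.cols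
no_notation Matrix.vec_index (infixl \<open>$\<close> 100)

section \<open>Rank and kernel dimension\<close>

text \<open>Rank-nullity on a subspace: a basis \<open>B\<close> of the kernel inside
  \<open>U\<close> extends to a basis \<open>C\<close> of \<open>U\<close>, and \<open>f\<close> is
  injective on the span of \<open>C - B\<close>. The restricted form is needed for comparing kernels
  of consecutive powers.\<close>

lemma vec_dim_kernel_image:
  fixes f :: "'a::field^'b \<Rightarrow> 'a^'c"
  assumes f: "Vector_Spaces.linear (*s) (*s) f" and U: "vec.subspace U"
  shows "vec.dim {x \<in> U. f x = 0} + vec.dim (f ` U) = vec.dim U"
proof -
  interpret f: Vector_Spaces.linear "(*s)" "(*s)" f by fact
  let ?K = "{x \<in> U. f x = 0}"
  have K: "vec.subspace ?K"
    using U unfolding vec.subspace_def by (auto simp: f.add f.scale)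
  obtain B where B: "B \<subseteq> ?K" "vec.independent B" "?K \<subseteq> vec.span B"
    by (rule vec.maximal_independent_subset)
  have "B \<subseteq> U" using B(1) by blast
  then obtain C where C: "B \<subseteq> C" "C \<subseteq> U" "vec.independent C" "U \<subseteq> vec.span C"
    by (rule vec.maximal_independent_subset_extend[OF _ B(2)])
  have fin: "finite C" by (rule vec.finiteI_independent[OF C(3)])
  have spanB: "vec.span B = ?K"
    by (rule antisym[OF vec.span_minimal[OF B(1) K] B(3)])
  have spanC: "vec.span C = U"
    by (rule antisym[OF vec.span_minimal[OF C(2) U] C(4)])
  have subU: "vec.span (C - B) \<subseteq> U"
    using vec.span_mono[OF Diff_subset[of C B]] by (simp only: spanC)
  have triv: "x = 0" if x: "x \<in> vec.span (C - B)" "f x = 0" for x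
  proof -
    have "x \<in> vec.span B" using x subU unfolding spanB by blast
    obtain u where u: "x = (\<Sum>v\<in>C - B. u v *s v)"
      using x(1) vec.span_finite[of "C - B"] finite_Diff[OF fin] by blast
    obtain w where w: "x = (\<Sum>v\<in>B. w v *s v)"
      using \<open>x \<in> vec.span B\<close> vec.span_finite[of B] finite_subset[OF C(1) fin] by blast
    \<comment> \<open>\<open>x\<close> lies in the span of \<open>C - B\<close> and in that of
      \<open>B\<close>; subtracting the two expansions gives a vanishing combination of the
      independent set \<open>C\<close>.\<close>
    let ?g = "\<lambda>v. if v \<in> B then - w v else u v"
    have "(\<Sum>v\<in>C. ?g v *s v) = (\<Sum>v\<in>C - B. ?g v *s v) + (\<Sum>v\<in>B. ?g v *s v)"
      using fin C(1) by (rule sum.subset_diff[rotated])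
    also have "\<dots> = x + - x"
    proof -
      have "(\<Sum>v\<in>C - B. ?g v *s v) = x" unfolding u by (intro sum.cong) auto
      moreover have "(\<Sum>v\<in>B. ?g v *s v) = - x"
        unfolding w sum_negf[symmetric] by (intro sum.cong) (auto simp: vector_smult_lneg)
      ultimately show ?thesis by simp
    qed
    finally have "(\<Sum>v\<in>C. ?g v *s v) = 0" by simp
    from C(3)[unfolded vec.independent_explicit_module, rule_format, OF fin order_refl this]
    have z: "\<forall>v\<in>C. ?g v = 0" by blast
    have "x = (\<Sum>v\<in>C - B. 0)" unfolding u
      by (intro sum.cong) (use z in auto)
    then show ?thesis by simp
  qed
  have inj: "inj_on f (vec.span (C - B))"
  proof (rule inj_onI)
    fix x y assume xy: "x \<in> vec.span (C - B)" "y \<in> vec.span (C - B)" "f x = f y"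
    have "x - y = 0"
      using xy by (intro triv vec.span_diff) (simp_all add: f.diff)
    then show "x = y" by simp
  qed
  have "f ` U = f ` vec.span (C - B)"
  proof
    show "f ` U \<subseteq> f ` vec.span (C - B)"
    proof
      fix y assume "y \<in> f ` U"
      then obtain x where x: "x \<in> U" "y = f x" by auto
      have "B \<union> (C - B) = C" using C(1) by blast
      then have "x \<in> vec.span (B \<union> (C - B))" using x by (simp only: spanC)
      then obtain a b where ab: "a \<in> vec.span B" "b \<in> vec.span (C - B)" "x = a + b"
        unfolding vec.span_Un by blast
      then have "f x = f b" using spanB by (auto simp: f.add)
      then show "y \<in> f ` vec.span (C - B)" using ab x by auto
    qed
  qed (rule image_mono[OF subU])
  then have "vec.dim (f ` U) = vec.dim (f ` vec.span (C - B))" by simp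
  also have "\<dots> = vec.dim (vec.span (C - B))"
    by (rule vec.dim_image_eq[OF f]) (unfold vec.span_span, rule inj)
  also have "\<dots> = card (C - B)"
    using vec.independent_mono[OF C(3), of "C - B"]
    by (intro vec.dim_span_eq_card_independent) blast
  also have "\<dots> = card C - card B" by (rule card_Diff_subset[OF finite_subset[OF C(1) fin] C(1)])
  finally have "vec.dim (f ` U) = card C - card B" .
  moreover have "vec.dim ?K = card B"
    using vec.dim_span_eq_card_independent[OF B(2)] by (simp only: spanB)
  moreover have "vec.dim U = card C"
    using vec.dim_span_eq_card_independent[OF C(3)] by (simp only: spanC)
  moreover have "card B \<le> card C" using C fin card_mono by blast
  ultimately show ?thesis by simp
qed

section \<open>Row rank and column rank over a field\<close>

lemma rank_le_dim_range:
  fixes A :: "'a::field^'b^'c"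
  shows "rank A \<le> vec.dim (range ((*v) A))"
proof -
  obtain B where B: "B \<subseteq> range ((*v) A)" "vec.independent B" "range ((*v) A) \<subseteq> vec.span B"
    using vec.maximal_independent_subset[of "range ((*v) A)"] by metis
  have fin: "finite B" using B(2) vec.finiteI_independent by blast
  have "\<exists>u. \<forall>j. A *v axis j 1 = (\<Sum>b\<in>B. u j b *s b)"
  proof -
    have "\<forall>j. \<exists>u. A *v axis j 1 = (\<Sum>b\<in>B. u b *s b)"
      using B(3) vec.span_finite[OF fin] by (auto simp: image_subset_iff image_iff)
    then show ?thesis by metis
  qed
  then obtain u where u: "\<And>j. A *v axis j 1 = (\<Sum>b\<in>B. u j b *s b)" by auto
  have col: "A $ i $ j = (\<Sum>b\<in>B. u j b * b $ i)" for i j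
  proof -
    have "A $ i $ j = (A *v axis j 1) $ i"
      by (simp add: matrix_vector_mult_def axis_def if_distrib[of "\<lambda>x. _ * x"] cong: if_cong)
    then show ?thesis unfolding u by (simp add: sum_component)
  qed
  \<comment> \<open>The expansions of the columns in \<open>B\<close> are now read by rows: row
    \<open>i\<close> is the combination of the vectors \<open>c b\<close> with coefficients
    \<open>b $ i\<close>, so at most \<open>card B\<close> vectors span the rows.\<close>
  define c where "c b = (\<chi> j. u j b)" for b
  have "rows A \<subseteq> vec.span (c ` B)"
  proof
    fix v assume "v \<in> rows A"
    then obtain i where i: "v = row i A" by (auto simp: rows_def)
    have "v = (\<Sum>b\<in>B. b $ i *s c b)"
      by (simp add: i row_def vec_eq_iff col c_def mult.commute)
    then show "v \<in> vec.span (c ` B)"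
      by (simp add: vec.span_sum vec.span_scale vec.span_base)
  qed
  then have "rank A \<le> card (c ` B)"
    unfolding row_rank_def_gen using fin by (intro vec.dim_le_card) auto
  also have "\<dots> \<le> card B" using fin by (rule card_image_le)
  also have "\<dots> = vec.dim (range ((*v) A))"
    using B by (intro vec.basis_card_eq_dim) auto
  finally show ?thesis .
qed

lemma range_transpose_eq_span_rows:
  fixes A :: "'a::field^'b^'c"
  shows "range ((*v) (transpose A)) = vec.span (rows A)"
proof -
  have "range ((*v) (transpose A)) = vec.span (columns (transpose A))"
  proof
    show "range ((*v) (transpose A)) \<subseteq> vec.span (columns (transpose A))"
      by (metis image_subsetI matrix_vector_mult_in_columnspace_gen)
    have "columns (transpose A) \<subseteq> range ((*v) (transpose A))"
    proof
      fix x assume "x \<in> columns (transpose A)"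
      then obtain i where "x = column i (transpose A)" by (auto simp: columns_def)
      also have "\<dots> = transpose A *v axis i 1"
        by (simp add: matrix_vector_mult_def axis_def column_def vec_eq_iff
            if_distrib[of "\<lambda>x. _ * x"] cong: if_cong)
      finally show "x \<in> range ((*v) (transpose A))" by auto
    qed
    moreover have "vec.subspace (range ((*v) (transpose A)))"
      by (intro vec.subspace_image vec.subspace_UNIV)
    ultimately show "vec.span (columns (transpose A)) \<subseteq> range ((*v) (transpose A))"
      by (rule vec.span_minimal)
  qed
  then show ?thesis by (simp add: columns_transpose)
qed

text \<open>The inequality between row rank and column rank, used for the matrix and for its
  transpose, closes up to an equality.\<close>

lemma rank_eq_dim_range:
  fixes A :: "'a::field^'b^'c"
  shows "rank A = vec.dim (range ((*v) A))"
proof (rule antisym[OF rank_le_dim_range])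
  have "vec.dim (range ((*v) A)) = rank (transpose A)"
    using range_transpose_eq_span_rows[of "transpose A"]
    by (simp add: row_rank_def_gen)
  also have "\<dots> \<le> vec.dim (range ((*v) (transpose A)))" by (rule rank_le_dim_range)
  also have "\<dots> = rank A"
    by (simp only: range_transpose_eq_span_rows vec.dim_span row_rank_def_gen)
  finally show "vec.dim (range ((*v) A)) \<le> rank A" .
qed

lemma rank_mult_le_left:
  fixes A :: "'a::field^'b^'c" and B :: "'a^'d^'b"
  shows "rank (A ** B) \<le> rank A"
  unfolding rank_eq_dim_range
  by (rule vec.dim_subset) (auto simp: matrix_vector_mul_assoc[symmetric])

lemma rank_mult_le_right:
  fixes A :: "'a::field^'b^'c" and B :: "'a^'d^'b"
  shows "rank (A ** B) \<le> rank B"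
proof -
  have "range ((*v) (A ** B)) = (*v) A ` range ((*v) B)"
    by (auto simp: matrix_vector_mul_assoc[symmetric] image_image)
  then show ?thesis
    unfolding rank_eq_dim_range by (simp add: vec.dim_image_le)
qed

lemma rank_nullity_field:
  fixes A :: "'a::field^'b^'c"
  shows "vec.dim {x. A *v x = 0} + rank A = CARD('b)"
  using vec_dim_kernel_image[of "(*v) A" UNIV]
  by (simp add: rank_eq_dim_range card_cart_basis)

section \<open>Transfer of kernel dimensions from list-indexed matrices\<close>

lemma kernel_dim_eq_vec_dim:
  fixes M :: "complex^'n^'n"
  assumes h: "bij_betw h {..<CARD('n)} (UNIV :: 'n set)"
  shows "kernel_dim (Matrix.mat CARD('n) CARD('n) (\<lambda>(i, j). M $ h i $ h j)) = vec.dim {v. M *v v = 0}"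
proof -
  let ?n = "CARD('n)"
  let ?A = "Matrix.mat ?n ?n (\<lambda>(i, j). M $ h i $ h j)"
  have A: "?A \<in> carrier_mat ?n ?n" by simp
  interpret kernel ?n ?n ?A by unfold_locales (rule A)
  define g where "g = inv_into {..<?n} h"
  have g: "g x < ?n" "h (g x) = x" for x
    using bij_betwE[OF bij_betw_inv_into[OF h]] bij_betw_inv_into_right[OF h, of x]
    by (simp_all add: g_def)
  have gh: "g (h i) = i" if "i < ?n" for i
    using h that unfolding g_def by (simp add: bij_betw_inv_into_left)
  \<comment> \<open>\<open>F\<close> relabels coordinates along the inverse of \<open>h\<close>; it
    carries a basis of the list-indexed kernel to a basis of the kernel over the finite
    type.\<close>
  define F where "F v = (\<chi> x. Matrix.vec_index v (g x))" for v :: "complex Matrix.vec"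
  have Fker: "F v \<in> {v. M *v v = 0}" if v: "v \<in> mat_kernel ?A" for v
  proof -
    have vc: "v \<in> carrier_vec ?n" and v0: "?A *\<^sub>v v = 0\<^sub>v ?n" using mat_kernelD[OF A v] by auto
    have "(M *v F v) $ x = 0" for x
    proof -
      have "0 = Matrix.vec_index (?A *\<^sub>v v) (g x)" using v0 g by simp
      also have "\<dots> = (\<Sum>j<?n. M $ x $ h j * Matrix.vec_index v j)"
        using g vc by (simp add: scalar_prod_def atLeast0LessThan)
      also have "\<dots> = (\<Sum>y\<in>UNIV. M $ x $ y * Matrix.vec_index v (g y))"
        using sum.reindex_bij_betw[OF h, of "\<lambda>y. M $ x $ y * Matrix.vec_index v (g y)"]
        by (simp add: gh)
      finally show ?thesis by (simp add: matrix_vector_mult_def F_def)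
    qed
    then show ?thesis by (simp add: vec_eq_iff)
  qed
  have Fsur: "\<exists>v\<in>mat_kernel ?A. F v = w" if w: "M *v w = 0" for w
  proof -
    let ?v = "Matrix.vec ?n (\<lambda>i. w $ h i)"
    have "F ?v = w" by (simp add: F_def vec_eq_iff g)
    moreover have "?v \<in> mat_kernel ?A"
    proof (rule mat_kernelI[OF A])
      show "?A *\<^sub>v ?v = 0\<^sub>v ?n"
      proof (rule eq_vecI)
        fix i assume i: "i < dim_vec (0\<^sub>v ?n :: complex Matrix.vec)"
        have "Matrix.vec_index (?A *\<^sub>v ?v) i = (\<Sum>j<?n. M $ h i $ h j * w $ h j)"
          using i by (simp add: scalar_prod_def atLeast0LessThan)
        also have "\<dots> = (M *v w) $ h i"
          by (simp add: matrix_vector_mult_def sum.reindex_bij_betw[OF h, of "\<lambda>y. M $ h i $ y * w $ y"])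
        finally show "Matrix.vec_index (?A *\<^sub>v ?v) i = Matrix.vec_index (0\<^sub>v ?n) i"
          using w i by simp
      qed simp
    qed simp
    ultimately show ?thesis by blast
  qed
  obtain B where B: "finite B" "basis B" using kernel_basis_exists[OF A] by blast
  have BK: "B \<subseteq> mat_kernel ?A" and Bind: "\<not> lin_dep B" and Bgen: "span B = mat_kernel ?A"
    using B(2) unfolding Ker.basis_def by auto
  have dimB: "dim = card B" by (rule Ker.dim_basis[OF B])
  have BC: "B \<subseteq> carrier_vec ?n" using BK mat_kernel_carrier[OF A] by blast
  have injF: "inj_on F (carrier_vec ?n)"
  proof (rule inj_onI)
    fix v w :: "complex Matrix.vec"
    assume v: "v \<in> carrier_vec ?n" and w: "w \<in> carrier_vec ?n" and e: "F v = F w"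
    show "v = w"
    proof (rule eq_vecI)
      fix i assume "i < dim_vec w"
      then have "i < ?n" using w by auto
      then show "Matrix.vec_index v i = Matrix.vec_index w i"
        using arg_cong[OF e, of "\<lambda>z. z $ h i"] by (simp add: F_def gh)
    qed (use v w in auto)
  qed
  have injB: "inj_on F B" using injF BC inj_on_subset by blast
  have Flin: "F (lincomb a U) = (\<Sum>b\<in>U. a b *s F b)" if "U \<subseteq> B" for a U
    using lincomb_index[of _ U a] that BK g
    by (simp add: F_def vec_eq_iff sum_component)
  have lc0: "lincomb a U = 0\<^sub>v ?n" if U: "U \<subseteq> B" and z: "(\<Sum>b\<in>U. a b *s F b) = 0" for a U
  proof -
    have "Matrix.vec_index (lincomb a U) i = 0" if "i < ?n" for i
      using arg_cong[OF Flin[OF U, of a, unfolded z], of "\<lambda>v. v $ h i"] that by (simp add: F_def gh)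
    moreover have "lincomb a U \<in> carrier_vec ?n"
      using Ker.lincomb_closed[of U a] U BK mat_kernel_carrier[OF A] by auto
    ultimately show ?thesis by (intro eq_vecI) auto
  qed
  have ind: "vec.independent (F ` B)"
  proof (rule vec.independent_if_scalars_zero)
    fix f x assume z: "(\<Sum>x\<in>F ` B. f x *s x) = 0" and x: "x \<in> F ` B"
    have "(\<Sum>b\<in>B. f (F b) *s F b) = 0" using z by (simp add: sum.reindex[OF injB])
    from lc0[OF order_refl this] have "lincomb (\<lambda>b. f (F b)) B = 0\<^sub>v ?n" .
    then have "\<forall>b\<in>B. f (F b) = 0"
      using Bind B(1) unfolding Ker.lin_dep_def by (auto simp: class_ring_simps)
    then show "f x = 0" using x by auto
  qed (use B in auto)
  have spn: "{v. M *v v = 0} \<subseteq> vec.span (F ` B)"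
  proof
    fix w assume "w \<in> {v. M *v v = 0}"
    then obtain v where v: "v \<in> mat_kernel ?A" "F v = w" using Fsur by auto
    then have "v \<in> span B" using Bgen by simp
    then obtain a U where U: "finite U" "U \<subseteq> B" "v = lincomb a U" unfolding Ker.span_def by auto
    then have "w = (\<Sum>b\<in>U. a b *s F b)" using v Flin by auto
    then show "w \<in> vec.span (F ` B)"
      using U by (simp add: vec.span_sum vec.span_scale vec.span_base subset_iff)
  qed
  have "card (F ` B) = vec.dim {v. M *v v = 0}"
    using Fker BK by (intro vec.basis_card_eq_dim[OF _ spn ind]) auto
  then show ?thesis using dimB card_image[OF injB] by simp
qed

section \<open>Kernels of powers and the smallest Jordan block\<close>

primrec mat_pow :: "'a::field^'n^'n \<Rightarrow> nat \<Rightarrow> 'a^'n^'n" where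
  "mat_pow N 0 = mat 1"
| "mat_pow N (Suc j) = mat_pow N j ** N"

lemma mat_pow_Suc_left: "mat_pow N (Suc j) = N ** mat_pow N j"
  by (induction j) (simp, metis matrix_mul_assoc mat_pow.simps(2))

lemma mat_vec_mult: "mat c *v v = c *s v" for v :: "'a::field^'n"
  by (simp add: matrix_vector_mult_def mat_def vec_eq_iff if_distrib[of "\<lambda>x. x * _"] cong: if_cong)

lemma mat_pow_Suc_vec: "mat_pow N (Suc j) *v v = N *v (mat_pow N j *v v)"
  by (simp only: mat_pow_Suc_left matrix_vector_mul_assoc)

lemma mat_pow_add: "mat_pow N (i + j) = mat_pow N i ** mat_pow N j"
proof (induction i)
  case (Suc i)
  then show ?case
    by (simp only: add_Suc mat_pow_Suc_left matrix_mul_assoc)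
qed simp

lemma mat_pow_vanish:
  assumes "mat_pow N i *v v = 0" "i \<le> j"
  shows "mat_pow N j *v v = 0"
proof -
  have "mat_pow N j = mat_pow N (j - i) ** mat_pow N i"
    using assms(2) mat_pow_add[of N "j - i" i] by simp
  then show ?thesis using assms(1) by (simp add: matrix_vector_mul_assoc[symmetric])
qed

text \<open>Re-indexing along \<open>h\<close> is multiplicative and sends
  \<open>A - mat lam\<close> to the characteristic matrix of the re-indexed \<open>A\<close>, hence
  powers to powers.\<close>

lemma dim_ker_mat_pow_eq_dim_gen_eigenspace:
  fixes A :: "complex^'n^'n"
  assumes h: "bij_betw h {..<CARD('n)} (UNIV :: 'n set)"
  shows "vec.dim {v. mat_pow (A - mat lam) j *v v = 0} =
    dim_gen_eigenspace (Matrix.mat CARD('n) CARD('n) (\<lambda>(i, j). A $ h i $ h j)) lam j"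
proof -
  let ?n = "CARD('n)"
  define T where "T M = Matrix.mat ?n ?n (\<lambda>(i, j). M $ h i $ h j)" for M :: "complex^'n^'n"
  have T: "T M \<in> carrier_mat ?n ?n" for M by (simp add: T_def)
  have mult: "T (M ** M') = T M * T M'" for M M'
  proof (rule eq_matI)
    fix i j assume "i < dim_row (T M * T M')" "j < dim_col (T M * T M')"
    then have ij: "i < ?n" "j < ?n" by (simp_all add: T_def)
    have "Matrix.index_mat (T M * T M') (i, j) = (\<Sum>l<?n. M $ h i $ h l * M' $ h l $ h j)"
      using ij by (simp add: T_def scalar_prod_def atLeast0LessThan)
    also have "\<dots> = (\<Sum>y\<in>UNIV. M $ h i $ y * M' $ y $ h j)"
      by (rule sum.reindex_bij_betw[OF h])
    finally show "Matrix.index_mat (T (M ** M')) (i, j) = Matrix.index_mat (T M * T M') (i, j)"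
      using ij by (simp add: T_def matrix_matrix_mult_def)
  qed (simp_all add: T_def)
  have inj: "h i = h j \<longleftrightarrow> i = j" if "i < ?n" "j < ?n" for i j
    using bij_betw_imp_inj_on[OF h] that by (auto simp: inj_on_def)
  have cm: "char_matrix (T A) lam = T (A - mat lam)"
    by (rule eq_matI) (auto simp: char_matrix_def T_def mat_def inj)
  have pow: "T (mat_pow (A - mat lam) j) = char_matrix (T A) lam ^\<^sub>m j" for j
  proof (induction j)
    case 0
    then show ?case
      unfolding cm by (intro eq_matI) (auto simp: T_def mat_def inj)
  next
    case (Suc j)
    then show ?case by (simp add: mult cm)
  qed
  show ?thesis
    unfolding dim_gen_eigenspace_def
    unfolding T_def[symmetric] pow[symmetric]
    unfolding T_def kernel_dim_eq_vec_dim[OF h] ..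
qed

lemma sum_list_min_less:
  fixes L :: "nat list"
  assumes "k \<in> set L"
  shows "sum_list (map (min (Suc k)) L) < Suc k * length L"
proof -
  have le: "sum_list (map (min (Suc k)) L) \<le> Suc k * length L" for L :: "nat list"
    by (induction L) auto
  show ?thesis using assms
  proof (induction L)
    case (Cons a L)
    show ?case
    proof (cases "k \<in> set L")
      case True
      then show ?thesis using Cons.IH min.cobounded1[of "Suc k" a] by simp
    next
      case False
      then have "k = a" using Cons.prems by simp
      then show ?thesis using le[of L] by (simp add: min_absorb2)
    qed
  qed simp
qed

text \<open>A Jordan block of size \<open>s\<close> contributes \<open>min j s\<close> to the kernel
  of the \<open>j\<close>-th power. With \<open>m\<close> blocks of smallest size \<open>k\<close>
  the kernels grow by \<open>m\<close> at each step up to \<open>k\<close>; at the next step a block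
  of size \<open>k\<close> contributes nothing new.\<close>

lemma multiplicity_support_dims:
  fixes A :: "complex^'n^'n"
  assumes supp: "multiplicity_support A lam m k"
  shows "m > 0" "k > 0"
    and "\<And>j. j \<le> k \<Longrightarrow> vec.dim {v. mat_pow (A - mat lam) j *v v = 0} = j * m"
    and "vec.dim {v. mat_pow (A - mat lam) (Suc k) *v v = 0} < Suc k * m"
proof -
  obtain v0 bs h where v0: "v0 \<noteq> 0" "A *v v0 = lam *s v0"
    and m: "vec.dim {v. A *v v = lam *s v} = m"
    and h: "bij_betw h {..<CARD('n)} (UNIV :: 'n set)"
    and jnf: "jordan_nf (Matrix.mat CARD('n) CARD('n) (\<lambda>(i, j). A $ h i $ h j)) bs"
    and k: "Min {s. (s, lam) \<in> set bs} = k"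
    using supp unfolding multiplicity_support_def has_jordan_blocks_def by blast
  show m0: "m > 0"
  proof (rule ccontr)
    assume "\<not> m > 0"
    then have "{v. A *v v = lam *s v} \<subseteq> {0}" using m vec.dim_eq_0 by simp
    then show False using v0 by auto
  qed
  define L where "L = map fst [(n, e)\<leftarrow>bs. e = lam]"
  have dim: "vec.dim {v. mat_pow (A - mat lam) j *v v = 0} = sum_list (map (min j) L)" for j
    unfolding dim_ker_mat_pow_eq_dim_gen_eigenspace[OF h] dim_gen_eigenspace[OF jnf] L_def ..
  have setL: "set L = {s. (s, lam) \<in> set bs}"
    by (force simp: L_def)
  have pos: "\<forall>s\<in>set L. s > 0"
  proof
    fix s assume s: "s \<in> set L"
    show "s > 0"
    proof (rule ccontr)
      assume "\<not> s > 0"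
      then have "0 \<in> fst ` set bs" using s setL by force
      then show False using jnf unfolding jordan_nf_def by blast
    qed
  qed
  \<comment> \<open>No block is empty, so each contributes exactly 1 to the eigenspace: the
    geometric multiplicity counts the blocks.\<close>
  have len: "length L = m"
  proof -
    have "{v. A *v v = lam *s v} = {v. mat_pow (A - mat lam) 1 *v v = 0}"
      by (auto simp: matrix_vector_mult_diff_rdistrib mat_vec_mult)
    then have "m = sum_list (map (min 1) L)" using m dim[of 1] by simp
    also have "map (min 1) L = map (\<lambda>_. 1) L" using pos by (auto simp: min_def Suc_le_eq)
    also have "sum_list \<dots> = length L" by (simp add: sum_list_triv)
    finally show ?thesis by simp
  qed
  have kL: "k \<in> set L" "\<forall>s\<in>set L. k \<le> s"
  proof -
    have "set L \<noteq> {}" using len m0 by auto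
    then show "k \<in> set L" "\<forall>s\<in>set L. k \<le> s"
      unfolding k[folded setL, symmetric] by (auto intro: Min_in Min_le)
  qed
  show "k > 0" using kL pos by blast
  show "vec.dim {v. mat_pow (A - mat lam) j *v v = 0} = j * m" if "j \<le> k" for j
  proof -
    have "map (min j) L = map (\<lambda>_. j) L" using kL(2) that by (auto simp: min_def)
    then show ?thesis unfolding dim by (simp only: sum_list_triv len of_nat_id mult.commute)
  qed
  show "vec.dim {v. mat_pow (A - mat lam) (Suc k) *v v = 0} < Suc k * m"
    unfolding dim len[symmetric] by (rule sum_list_min_less[OF kL(1)])
qed

lemma subspace_kernel_vec: "vec.subspace {v. M *v v = (0 :: 'a::field^'n)}"
  by (auto simp: vec.subspace_def matrix_vector_right_distrib vec.scale)

text \<open>A chain of length equal to the smallest block size that is not part of a longer chain: if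
  there were none, the increments of the kernel dimensions would still be maximal one step
  beyond the smallest block size.\<close>

lemma exists_maximal_chain:
  fixes N :: "'a::field^'n^'n"
  assumes dims: "\<And>j. j \<le> Suc k \<Longrightarrow> vec.dim {v. mat_pow N j *v v = 0} = j * m"
    and dim_less: "vec.dim {v. mat_pow N (Suc (Suc k)) *v v = 0} < Suc (Suc k) * m"
  shows "\<exists>w. mat_pow N (Suc k) *v w = 0 \<and> mat_pow N k *v w \<notin> range ((*v) (mat_pow N (Suc k)))"
proof (rule ccontr)
  assume neg: "\<not> ?thesis"
  let ?K = "\<lambda>j. {v. mat_pow N j *v v = 0}"
  have rn: "vec.dim (?K j) + vec.dim ((*v) (mat_pow N j) ` ?K (Suc j)) = vec.dim (?K (Suc j))" for j
  proof -
    have "{x \<in> ?K (Suc j). mat_pow N j *v x = 0} = ?K j"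
      using mat_pow_vanish[of N j _ "Suc j"] by auto
    then show ?thesis
      using vec_dim_kernel_image[where f = "(*v) (mat_pow N j)" and U = "?K (Suc j)",
          OF matrix_vector_mul_linear_gen subspace_kernel_vec] by (simp only:)
  qed
  have "(*v) (mat_pow N k) ` ?K (Suc k) \<subseteq> (*v) (mat_pow N (Suc k)) ` ?K (Suc (Suc k))"
  proof
    fix y assume "y \<in> (*v) (mat_pow N k) ` ?K (Suc k)"
    then obtain w where w: "mat_pow N (Suc k) *v w = 0" "y = mat_pow N k *v w" by blast
    then obtain u where u: "mat_pow N k *v w = mat_pow N (Suc k) *v u" using neg by blast
    have "mat_pow N (Suc (Suc k)) *v u = 0"
      using w(1) by (simp only: mat_pow_Suc_vec[of N "Suc k"] u[symmetric])
        (simp only: mat_pow_Suc_vec[of N k])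
    then show "y \<in> (*v) (mat_pow N (Suc k)) ` ?K (Suc (Suc k))" using w u by auto
  qed
  then have "vec.dim ((*v) (mat_pow N k) ` ?K (Suc k))
      \<le> vec.dim ((*v) (mat_pow N (Suc k)) ` ?K (Suc (Suc k)))"
    by (rule vec.dim_subset)
  \<comment> \<open>The increment up to \<open>Suc k\<close> equals \<open>m\<close>; by the
    inclusion the following one is at least \<open>m\<close>, against the strict bound
    \<open>dim_less\<close>.\<close>
  moreover have "vec.dim (?K k) = k * m" "vec.dim (?K (Suc k)) = Suc k * m"
    by (rule dims, simp)+
  ultimately show False using rn[of k] rn[of "Suc k"] dim_less by simp
qed

section \<open>Cyclic vectors of a strictly upper triangular matrix\<close>

lemma nilpotent_cyclic_vector:
  fixes S :: "'a::field^('k::{finite,linorder})^('k::{finite,linorder})"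
  assumes S_upper: "\<And>i j. j \<le> i \<Longrightarrow> S $ i $ j = 0"
    and S_superdiag: "\<And>i j. i < j \<Longrightarrow> {i<..<j} = {} \<Longrightarrow> S $ i $ j \<noteq> 0"
  shows "\<exists>e. mat_pow S (CARD('k) - 1) *v e \<noteq> 0 \<and> mat_pow S CARD('k) *v e = 0"
proof -
  define rk where "rk a = card {..<a}" for a :: 'k
  have rk_mono: "rk a < rk b" if "a < b" for a b
    unfolding rk_def by (rule psubset_card_mono) (use that in auto)
  then have rk_less_iff: "rk a < rk b \<longleftrightarrow> a < b" for a b
    by (metis linorder_neqE order_less_asym)
  have rk_inj: "rk a = rk b \<longleftrightarrow> a = b" for a b
    by (metis rk_mono linorder_neqE less_irrefl)
  let ?K = "CARD('k) - 1"
  have rk_le: "rk a \<le> ?K" for a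
  proof -
    have "rk a < CARD('k)" unfolding rk_def by (rule psubset_card_mono) auto
    then show ?thesis by simp
  qed
  define e where "e = axis (Max UNIV :: 'k) (1 :: 'a)"
  have rk_Max: "rk (Max UNIV) = ?K"
  proof -
    have "{..<Max UNIV} = UNIV - {Max (UNIV :: 'k set)}"
      by (auto simp: less_le)
    then show ?thesis by (simp add: rk_def card_Diff_singleton)
  qed
  \<comment> \<open>Starting from the last unit vector, each application of \<open>S\<close> lowers
    the last nonzero position by exactly one, the entry there being multiplied by a superdiagonal
    entry. Positions are counted by \<open>rk\<close> from 0, so position 0 is reached after
    \<open>?K\<close> applications.\<close>
  have top: "(\<forall>a. rk a + t > ?K \<longrightarrow> (mat_pow S t *v e) $ a = 0) \<and>
      (\<forall>a. rk a + t = ?K \<longrightarrow> (mat_pow S t *v e) $ a \<noteq> 0)" for t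
  proof (induction t)
    case 0
    have "rk a = ?K \<longleftrightarrow> a = Max UNIV" for a using rk_inj[of a "Max UNIV"] rk_Max by simp
    moreover have "\<not> rk a > ?K" for a using rk_le[of a] by simp
    ultimately show ?case by (auto simp: e_def axis_def)
  next
    case (Suc t)
    let ?v = "mat_pow S t *v e"
    have step: "(mat_pow S (Suc t) *v e) $ a = (\<Sum>b\<in>UNIV. S $ a $ b * ?v $ b)" for a
      unfolding mat_pow_Suc_vec by (simp add: matrix_vector_mult_def)
    have zero: "(mat_pow S (Suc t) *v e) $ a = 0" if a: "rk a + Suc t > ?K" for a
      unfolding step
    proof (rule sum.neutral, rule ballI)
      fix b
      show "S $ a $ b * ?v $ b = 0"
      proof (cases "b \<le> a")
        case False
        then have "rk a < rk b" by (intro rk_mono) simp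
        then show ?thesis using Suc a by simp
      qed (simp add: S_upper)
    qed
    have nonzero: "(mat_pow S (Suc t) *v e) $ a \<noteq> 0" if a: "rk a + Suc t = ?K" for a
    proof -
      have "a < Max UNIV" using a rk_Max by (simp add: rk_less_iff[symmetric])
      then have ne: "{a<..} \<noteq> {}" by blast
      \<comment> \<open>\<open>b\<close> is the successor of \<open>a\<close>. In the sum for entry
        \<open>a\<close> only column \<open>b\<close> survives: columns up to \<open>a\<close>
        vanish by triangularity, those beyond \<open>b\<close> by the induction hypothesis.\<close>
      define b where "b = Min {a<..}"
      have b: "a < b" "\<And>c. a < c \<Longrightarrow> b \<le> c"
        using Min_in[OF _ ne] unfolding b_def by auto
      have gap: "{a<..<b} = {}" using b(2) by force
      have "{..<b} = insert a {..<a}"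
        using b by (auto simp: not_less) (meson leD le_less_linear not_less_iff_gr_or_eq)
      then have rkb: "rk b = Suc (rk a)" by (simp add: rk_def)
      have "(\<Sum>c\<in>UNIV. S $ a $ c * ?v $ c) = (\<Sum>c\<in>{b}. S $ a $ c * ?v $ c)"
      proof (rule sum.mono_neutral_right)
        show "\<forall>c\<in>UNIV - {b}. S $ a $ c * ?v $ c = 0"
        proof
          fix c assume c: "c \<in> UNIV - {b}"
          show "S $ a $ c * ?v $ c = 0"
          proof (cases "c \<le> a")
            case False
            then have "b \<le> c" "b \<noteq> c" using b(2)[of c] c by auto
            then have "b < c" by simp
            then have "rk b < rk c" by (rule rk_mono)
            then show ?thesis using Suc a rkb by simp
          qed (simp add: S_upper)
        qed
      qed auto
      moreover have "S $ a $ b \<noteq> 0" using S_superdiag b(1) gap by blast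
      moreover have "?v $ b \<noteq> 0" using Suc a rkb by simp
      ultimately show ?thesis unfolding step by simp
    qed
    show ?case using zero nonzero by blast
  qed
  have "\<exists>a. rk a = 0"
  proof
    have "{..<Min UNIV} = ({} :: 'k set)" by (auto simp: not_less)
    then show "rk (Min UNIV) = 0" by (simp add: rk_def)
  qed
  then obtain a0 where "rk a0 = 0" by blast
  then have "(mat_pow S ?K *v e) $ a0 \<noteq> 0" using top[of ?K] by simp
  then have "mat_pow S ?K *v e \<noteq> 0" by auto
  moreover have "mat_pow S CARD('k) *v e = 0"
  proof -
    have "rk a + CARD('k) > ?K" for a using zero_less_card_finite[where 'a='k] by linarith
    then show ?thesis using top[of "CARD('k)"] by (simp add: vec_eq_iff del: mat_pow.simps)
  qed
  ultimately show ?thesis by blast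
qed

text \<open>Multiplication by the power \<open>k - i\<close> of \<open>S\<close> kills all terms
  beyond index \<open>i\<close>; those before it vanish by strong induction, so only
  \<open>c i\<close> is left.\<close>

lemma nilpotent_chain_scalars:
  fixes S :: "'a::field^'k^'k"
  assumes e: "mat_pow S k *v e \<noteq> 0" and e0: "mat_pow S (Suc k) *v e = 0"
    and z: "(\<Sum>j\<le>k. c j *s (mat_pow S j *v e)) = 0" and i: "i \<le> k"
  shows "c i = 0"
  using i
proof (induction i rule: less_induct)
  case (less i)
  have "0 = mat_pow S (k - i) *v (\<Sum>j\<le>k. c j *s (mat_pow S j *v e))" by (simp add: z)
  also have "\<dots> = (\<Sum>j\<le>k. c j *s (mat_pow S (k - i + j) *v e))"
    by (simp add: vec.sum vec.scale mat_pow_add matrix_vector_mul_assoc)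
  also have "\<dots> = (\<Sum>j\<in>{i}. c j *s (mat_pow S (k - i + j) *v e))"
  proof (rule sum.mono_neutral_right)
    show "\<forall>j\<in>{..k} - {i}. c j *s (mat_pow S (k - i + j) *v e) = 0"
    proof
      fix j assume j: "j \<in> {..k} - {i}"
      show "c j *s (mat_pow S (k - i + j) *v e) = 0"
      proof (cases "j < i")
        case True
        then show ?thesis using less j by simp
      next
        case False
        then have "Suc k \<le> k - i + j" using j less.prems by auto
        from mat_pow_vanish[OF e0 this] show ?thesis by simp
      qed
    qed
  qed (use less.prems in auto)
  also have "\<dots> = c i *s (mat_pow S k *v e)" using less.prems by simp
  finally show ?case using e by simp
qed

lemma nilpotent_chain_basis:
  fixes S :: "'a::field^'k^'k"
  assumes e: "mat_pow S k *v e \<noteq> 0" and e0: "mat_pow S (Suc k) *v e = 0"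
    and k: "Suc k = CARD('k)"
  shows "inj_on (\<lambda>i. mat_pow S i *v e) {..k}"
    and "vec.independent ((\<lambda>i. mat_pow S i *v e) ` {..k})"
    and "vec.span ((\<lambda>i. mat_pow S i *v e) ` {..k}) = UNIV"
proof -
  let ?g = "\<lambda>i. mat_pow S i *v e"
  note sc = nilpotent_chain_scalars[OF e e0]
  show inj: "inj_on ?g {..k}"
  proof (rule inj_onI, rule ccontr)
    fix i j assume ij: "i \<in> {..k}" "j \<in> {..k}" "?g i = ?g j" "i \<noteq> j"
    let ?c = "\<lambda>l. (if l = i then 1 else 0) - (if l = j then 1 else (0 :: 'a))"
    have "(\<Sum>l\<le>k. ?c l *s ?g l) = ?g i - ?g j"
      using ij by (simp add: vector_sub_rdistrib sum_subtractf if_distrib[of "\<lambda>x. x *s _"] cong: if_cong)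
    then have "?c i = 0" using ij by (intro sc[of ?c]) auto
    then show False using ij by simp
  qed
  show ind: "vec.independent (?g ` {..k})"
  proof (rule vec.independent_if_scalars_zero)
    fix f x assume z: "(\<Sum>x\<in>?g ` {..k}. f x *s x) = 0" and x: "x \<in> ?g ` {..k}"
    have "(\<Sum>j\<le>k. f (?g j) *s ?g j) = 0" using z by (simp add: sum.reindex[OF inj])
    from sc[OF this] show "f x = 0" using x by auto
  qed simp
  have "UNIV \<subseteq> vec.span (?g ` {..k})"
    by (rule vec.card_ge_dim_independent[OF _ ind])
      (simp_all add: card_image[OF inj] card_cart_basis k[symmetric])
  then show "vec.span (?g ` {..k}) = UNIV" by blast
qed

section \<open>The homogeneous Sylvester equation\<close>

lemma intertwine_pow:
  fixes N :: "'a::field^'n^'n" and X :: "'a^'k^'n"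
  assumes "N ** X = X ** S"
  shows "X *v (mat_pow S j *v v) = mat_pow N j *v (X *v v)"
proof (induction j)
  case (Suc j)
  have "X *v (mat_pow S (Suc j) *v v) = (X ** S) *v (mat_pow S j *v v)"
    by (simp only: mat_pow_Suc_vec matrix_vector_mul_assoc matrix_mul_assoc)
  also have "\<dots> = N *v (X *v (mat_pow S j *v v))"
    by (simp only: assms[symmetric] matrix_vector_mul_assoc matrix_mul_assoc)
  finally show ?case by (simp only: Suc mat_pow_Suc_vec)
qed simp

text \<open>On the zero set of the Sylvester operator, evaluation at a cyclic vector of \<open>S\<close> is a linear
  isomorphism onto a generalized eigenspace.\<close>

lemma intertwine_eq_0:
  fixes N :: "'a::field^'n^'n" and X :: "'a^'k^'n"
  assumes X: "N ** X = X ** S" and Xe: "X *v e = 0"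
    and e: "mat_pow S k *v e \<noteq> 0" "mat_pow S (Suc k) *v e = 0" "Suc k = CARD('k)"
  shows "X = 0"
proof -
  have "vec.span ((\<lambda>i. mat_pow S i *v e) ` {..k}) \<subseteq> {v. X *v v = 0}"
    using Xe by (intro vec.span_minimal subspace_kernel_vec) (auto simp: intertwine_pow[OF X])
  then have "\<forall>v. X *v v = 0" using nilpotent_chain_basis(3)[OF e] by auto
  then show ?thesis by (simp add: matrix_eq)
qed

text \<open>\<open>X\<close> is prescribed on the basis of iterates of \<open>e\<close>, the
  \<open>i\<close>-th going to \<open>mat_pow N i *v w\<close>. The relation then holds by
  construction except at the last iterate, where both sides vanish.\<close>

lemma intertwine_exists:
  fixes N :: "'a::field^'n^'n" and S :: "'a^'k^'k"
  assumes w: "mat_pow N (Suc k) *v w = 0"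
    and e: "mat_pow S k *v e \<noteq> 0" "mat_pow S (Suc k) *v e = 0" "Suc k = CARD('k)"
  shows "\<exists>X. N ** X = X ** S \<and> X *v e = w"
proof -
  let ?g = "\<lambda>i. mat_pow S i *v e"
  note B = nilpotent_chain_basis[OF e]
  define f where "f x = mat_pow N (the_inv_into {..k} ?g x) *v w" for x
  obtain F where F: "Vector_Spaces.linear (*s) (*s) F" "\<forall>x\<in>?g ` {..k}. F x = f x"
    using vec.linear_independent_extend[OF B(2), of f] by blast
  define X where "X = matrix F"
  have XF: "X *v v = F v" for v unfolding X_def by (rule matrix_works[OF F(1)])
  have Xg: "X *v ?g i = mat_pow N i *v w" if "i \<le> k" for i
    unfolding XF using F(2) that by (simp add: f_def the_inv_into_f_f[OF B(1)])
  have "vec.span (?g ` {..k}) \<subseteq> {v. (N ** X - X ** S) *v v = 0}"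
  proof (rule vec.span_minimal[OF _ subspace_kernel_vec], rule image_subsetI, rule CollectI)
    fix i assume i: "i \<in> {..k}"
    have N: "N *v (X *v ?g i) = mat_pow N (Suc i) *v w"
      using i Xg[of i] by (simp only: mat_pow_Suc_vec atMost_iff)
    have XS: "X *v (S *v ?g i) = mat_pow N (Suc i) *v w"
    proof (cases "i = k")
      case True
      then show ?thesis using e(2) w by (simp only: mat_pow_Suc_vec[symmetric] matrix_vector_mult_0_right)
    next
      case False
      then have "Suc i \<le> k" using i by simp
      from Xg[OF this] show ?thesis by (simp only: mat_pow_Suc_vec[symmetric])
    qed
    show "(N ** X - X ** S) *v ?g i = 0"
      using N XS by (simp add: matrix_vector_mult_diff_rdistrib matrix_vector_mul_assoc[symmetric] del: mat_pow.simps)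
  qed
  then have "\<forall>v. (N ** X - X ** S) *v v = 0 *v v" using B(3) by auto
  then have "N ** X - X ** S = 0" unfolding matrix_eq .
  moreover have "X *v e = w" using Xg[of 0] by simp
  ultimately show ?thesis by auto
qed

text \<open>A Leibniz rule: in the telescoping expansion of N^(j+1) Y - Y S^(j+1) all terms N^i X
  S^(j-i) equal N^j X because \<open>X\<close> intertwines, whence the factor \<open>Suc j\<close>.
  It converts membership of \<open>X\<close> in the range of the Sylvester operator into a statement
  about ranges of powers of \<open>N\<close>.\<close>

lemma sylvester_range_chain:
  fixes N :: "'a::field^'n^'n" and X Y :: "'a^'k^'n"
  assumes X: "N ** X = X ** S" and Y: "N ** Y - Y ** S = X"
  shows "mat_pow N (Suc j) *v (Y *v v) =
    Y *v (mat_pow S (Suc j) *v v) + of_nat (Suc j) *s (mat_pow N j *v (X *v v))"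
proof -
  have NY: "N *v (Y *v u) = Y *v (S *v u) + X *v u" for u
    unfolding Y[symmetric]
    by (simp add: matrix_vector_mult_diff_rdistrib matrix_vector_mul_assoc)
  show ?thesis
  proof (induction j)
    case 0
    show ?case using NY[of v] by simp
  next
    case (Suc j)
    have "mat_pow N (Suc (Suc j)) *v (Y *v v) = N *v (mat_pow N (Suc j) *v (Y *v v))"
      by (rule mat_pow_Suc_vec)
    also have "\<dots> = N *v (Y *v (mat_pow S (Suc j) *v v)) + of_nat (Suc j) *s (N *v (mat_pow N j *v (X *v v)))"
      unfolding Suc by (simp only: matrix_vector_right_distrib vec.scale)
    also have "\<dots> = Y *v (mat_pow S (Suc (Suc j)) *v v) + mat_pow N (Suc j) *v (X *v v)
        + of_nat (Suc j) *s (mat_pow N (Suc j) *v (X *v v))"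
      by (simp only: NY mat_pow_Suc_vec[symmetric] intertwine_pow[OF X])
    finally show ?case by (simp only: of_nat_Suc[of "Suc j"] vec.scale_left_distrib vec.scale_one add.assoc)
  qed
qed

section \<open>The conjugate transpose and the Frobenius norm\<close>

abbreviation ct :: "complex^'b^'a \<Rightarrow> complex^'a^'b" where
  "ct \<equiv> conj_transpose"

lemma ct_nth [simp]: "ct B $ i $ j = cnj (B $ j $ i)"
  by (simp add: conj_transpose_def map_matrix_def transpose_def)

lemma ct_ct [simp]: "ct (ct B) = B"
  by (simp add: vec_eq_iff)

lemma ct_mult: "ct (A ** B) = ct B ** ct A"
  by (simp add: vec_eq_iff matrix_matrix_mult_def cnj_sum mult.commute)

lemma ct_diff: "ct (A - B) = ct A - ct B"
  by (simp add: vec_eq_iff)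

lemma ct_mat_1 [simp]: "ct (mat 1) = mat 1"
  by (simp add: vec_eq_iff mat_def)

lemma ct_0 [simp]: "ct 0 = 0"
  by (simp add: vec_eq_iff)

lemma inner_mult_complex: "(a * e) \<bullet> d = e \<bullet> (cnj a * d)" for a e d :: complex
  by (simp add: inner_complex_def algebra_simps)

text \<open>The inner product here is real, the real part of the Hermitian form; the conjugate
  transpose is the adjoint for it as well.\<close>

lemma inner_matrix_vector_ct: "(A *v x) \<bullet> y = x \<bullet> (ct A *v y)"
proof -
  have "(A *v x) \<bullet> y = (\<Sum>i\<in>UNIV. \<Sum>j\<in>UNIV. x $ j \<bullet> (cnj (A $ i $ j) * y $ i))"
    by (simp add: inner_vec_def matrix_vector_mult_def inner_sum_left inner_mult_complex)
  also have "\<dots> = x \<bullet> (ct A *v y)"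
    by (subst sum.swap) (simp add: inner_vec_def matrix_vector_mult_def inner_sum_right)
  finally show ?thesis .
qed

lemma inner_ct_ct: "ct A \<bullet> ct B = A \<bullet> B"
proof -
  have "ct A \<bullet> ct B = (\<Sum>i\<in>UNIV. \<Sum>j\<in>UNIV. A $ j $ i \<bullet> B $ j $ i)"
    by (simp add: inner_vec_def inner_complex_def)
  then show ?thesis by (subst (asm) sum.swap) (simp add: inner_vec_def)
qed

lemma norm_ct [simp]: "norm (ct A) = norm A"
  by (simp add: norm_eq_sqrt_inner inner_ct_ct)

lemma inner_mult_left_ct: "(A ** E) \<bullet> D = E \<bullet> (ct A ** D)"
proof -
  have "(A ** E) \<bullet> D = (\<Sum>i\<in>UNIV. \<Sum>j\<in>UNIV. \<Sum>l\<in>UNIV. E $ l $ j \<bullet> (cnj (A $ i $ l) * D $ i $ j))"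
    by (simp add: inner_vec_def matrix_matrix_mult_def inner_sum_left inner_mult_complex)
  also have "\<dots> = (\<Sum>i\<in>UNIV. \<Sum>l\<in>UNIV. \<Sum>j\<in>UNIV. E $ l $ j \<bullet> (cnj (A $ i $ l) * D $ i $ j))"
    by (intro sum.cong refl sum.swap)
  also have "\<dots> = (\<Sum>l\<in>UNIV. \<Sum>i\<in>UNIV. \<Sum>j\<in>UNIV. E $ l $ j \<bullet> (cnj (A $ i $ l) * D $ i $ j))"
    by (rule sum.swap)
  also have "\<dots> = (\<Sum>l\<in>UNIV. \<Sum>j\<in>UNIV. \<Sum>i\<in>UNIV. E $ l $ j \<bullet> (cnj (A $ i $ l) * D $ i $ j))"
    by (intro sum.cong refl sum.swap)
  also have "\<dots> = E \<bullet> (ct A ** D)"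
    by (simp add: inner_vec_def matrix_matrix_mult_def inner_sum_right)
  finally show ?thesis .
qed

lemma norm_matrix_vector_mult_le:
  fixes A :: "complex^'b^'a"
  shows "norm (A *v x) \<le> norm A * norm x"
proof -
  have "norm ((A *v x) $ i) \<le> norm (A $ i) * norm x" for i
  proof -
    have "norm ((A *v x) $ i) \<le> (\<Sum>j\<in>UNIV. norm (A $ i $ j) * norm (x $ j))"
      unfolding matrix_vector_mult_def by (simp, rule norm_sum[THEN order_trans]) (simp add: norm_mult)
    also have "\<dots> \<le> norm (A $ i) * norm x"
      using L2_set_mult_ineq[of "\<lambda>j. norm (A $ i $ j)" "\<lambda>j. norm (x $ j)" UNIV]
      by (simp add: norm_vec_def)
    finally show ?thesis .
  qed
  then have "norm (A *v x) \<le> L2_set (\<lambda>i. norm (A $ i) * norm x) UNIV"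
    unfolding norm_vec_def[of "A *v x"] by (intro L2_set_mono) auto
  also have "\<dots> = norm A * norm x"
    by (simp add: norm_vec_def[of A] L2_set_left_distrib)
  finally show ?thesis .
qed

lemma norm_transpose: "norm (transpose B) = norm B" for B :: "complex^'b^'a"
proof -
  have "transpose B \<bullet> transpose B = B \<bullet> B"
    unfolding inner_vec_def transpose_def by (simp, rule sum.swap)
  then show ?thesis by (simp add: norm_eq_sqrt_inner)
qed

lemma norm_matrix_mult_le:
  fixes A :: "complex^'b^'a" and B :: "complex^'c^'b"
  shows "norm (A ** B) \<le> norm A * norm B"
proof -
  have "(A ** B) $ i = transpose B *v (A $ i)" for i
    by (simp add: vec_eq_iff matrix_matrix_mult_def matrix_vector_mult_def transpose_def mult.commute
        del: transpose_matrix_vector)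
  then have "norm ((A ** B) $ i) \<le> norm (A $ i) * norm B" for i
    using norm_matrix_vector_mult_le[of "transpose B" "A $ i"]
    by (simp add: norm_transpose mult.commute del: transpose_matrix_vector)
  then have "norm (A ** B) \<le> L2_set (\<lambda>i. norm (A $ i) * norm B) UNIV"
    unfolding norm_vec_def[of "A ** B"] by (intro L2_set_mono) auto
  also have "\<dots> = norm A * norm B"
    by (simp add: norm_vec_def[of A] L2_set_left_distrib)
  finally show ?thesis .
qed

lemma matrix_diff_ldistrib: "A ** (B - C) = A ** B - A ** C" for A :: "complex^'b^'a"
  by (simp add: vec_eq_iff matrix_matrix_mult_def algebra_simps sum_subtractf)

lemma matrix_diff_rdistrib: "(B - C) ** A = B ** A - C ** A" for A :: "complex^'b^'a"
  by (simp add: vec_eq_iff matrix_matrix_mult_def algebra_simps sum_subtractf)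

lemma matrix_add_rdistrib: "(B + C) ** A = B ** A + C ** A" for A :: "complex^'b^'a"
  by (simp add: vec_eq_iff matrix_matrix_mult_def algebra_simps sum.distrib)

lemma matrix_mult_0_left [simp]: "0 ** A = 0" for A :: "complex^'b^'a"
  by (simp add: vec_eq_iff matrix_matrix_mult_def)

lemma matrix_mult_0_right [simp]: "A ** 0 = 0" for A :: "complex^'b^'a"
  by (simp add: vec_eq_iff matrix_matrix_mult_def)

lemma matrix_scaleR_right: "A ** (t *\<^sub>R B) = t *\<^sub>R (A ** B)" for A :: "complex^'b^'a"
  by (simp add: vec_eq_iff matrix_matrix_mult_def scaleR_sum_right)

lemma matrix_scaleR_left: "(t *\<^sub>R A) ** B = t *\<^sub>R (A ** B)" for A :: "complex^'b^'a"
  by (simp add: vec_eq_iff matrix_matrix_mult_def scaleR_sum_right)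

section \<open>The Moore--Penrose inverse\<close>

lemma generalized_inverse_exists:
  fixes M :: "'a::field^'b^'c"
  shows "\<exists>G. M ** G ** M = M"
proof -
  obtain g where g: "Vector_Spaces.linear (*s) (*s) g" "\<forall>v\<in>range ((*v) M). M *v g v = v"
    using vec.linear_exists_right_inverse_on[of "(*v) M" UNIV] by auto
  have "(M ** matrix g ** M) *v x = M *v x" for x
    using g(2) by (simp add: matrix_vector_mul_assoc[symmetric] matrix_works[OF g(1)])
  then have "M ** matrix g ** M = M" by (simp add: matrix_eq)
  then show ?thesis by blast
qed

text \<open>For \<open>D = M - N\<close> the squared norm of \<open>A ** D\<close> is the inner
  product of \<open>D\<close> with \<open>ct A ** A ** D\<close>.\<close>

lemma ct_mult_cancel_left:
  assumes "ct A ** A ** M = ct A ** A ** N"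
  shows "A ** M = A ** N"
proof -
  have "(A ** (M - N)) \<bullet> (A ** (M - N)) = (M - N) \<bullet> (ct A ** A ** (M - N))"
    by (simp add: inner_mult_left_ct matrix_mul_assoc)
  also have "\<dots> = 0" using assms by (simp add: matrix_diff_ldistrib)
  finally have "A ** (M - N) = 0" by simp
  then show ?thesis by (simp add: matrix_diff_ldistrib)
qed

lemma ct_mult_cancel_right:
  assumes "M ** A ** ct A = N ** A ** ct A"
  shows "M ** A = N ** A"
proof -
  have "ct (ct A) ** ct A ** ct M = ct (ct A) ** ct A ** ct N"
    using arg_cong[OF assms, of ct] by (simp add: ct_mult matrix_mul_assoc)
  from ct_mult_cancel_left[OF this] have "ct (M ** A) = ct (N ** A)" by (simp add: ct_mult)
  from arg_cong[OF this, of ct] show ?thesis by simp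
qed

text \<open>Zlobec's formula: \<open>A* G A*\<close> is the Moore--Penrose inverse of \<open>A\<close> for every reflexive
  generalized inverse \<open>G\<close> of \<open>A* A A*\<close>.\<close>

lemma pinv_exists: "\<exists>X. is_pinv A X"
proof -
  define M where "M = ct A ** A ** ct A"
  obtain G0 where G0: "M ** G0 ** M = M" using generalized_inverse_exists by blast
  define G where "G = G0 ** M ** G0"
  have MGM: "M ** G ** M = M"
  proof -
    have "M ** G ** M = (M ** G0 ** M) ** G0 ** M" by (simp add: G_def matrix_mul_assoc)
    then show ?thesis by (simp add: G0)
  qed
  have GMG: "G ** M ** G = G"
  proof -
    have "G ** M ** G = G0 ** (M ** G0 ** M) ** G0 ** M ** G0" by (simp add: G_def matrix_mul_assoc)
    also have "\<dots> = G0 ** M ** G0 ** M ** G0" by (simp only: G0)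
    also have "\<dots> = G0 ** (M ** G0 ** M) ** G0" by (simp only: matrix_mul_assoc)
    finally show ?thesis by (simp only: G0 G_def)
  qed
  define X where "X = ct A ** G ** ct A"
  \<comment> \<open>The cancellation laws strip \<open>ct A\<close> from the left and from the right
    of \<open>M ** G ** M = M\<close>, which leaves \<open>A ** X ** A = A\<close>.\<close>
  have "ct A ** A ** (ct A ** G ** M) = ct A ** A ** ct A"
    using MGM unfolding M_def by (simp add: matrix_mul_assoc)
  from ct_mult_cancel_left[OF this]
  have "(A ** ct A ** G ** ct A) ** A ** ct A = mat 1 ** A ** ct A"
    unfolding M_def by (simp add: matrix_mul_assoc)
  from ct_mult_cancel_right[OF this] have 1: "A ** X ** A = A"
    unfolding X_def by (simp add: matrix_mul_assoc)
  have 2: "X ** A ** X = X"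
  proof -
    have "X ** A ** X = ct A ** (G ** M ** G) ** ct A"
      unfolding X_def M_def by (simp add: matrix_mul_assoc)
    then show ?thesis unfolding GMG X_def .
  qed
  have ctA: "ct A = ct A ** ct X ** ct A"
    using arg_cong[OF 1, of ct] by (simp add: ct_mult matrix_mul_assoc)
  \<comment> \<open>Inserting the adjoint of \<open>A ** X ** A = A\<close> exhibits
    \<open>A ** X\<close> as \<open>Z ** ct Z\<close>, hence self-adjoint; \<open>X ** A\<close> is
    treated likewise.\<close>
  have "A ** X = A ** ct A ** G ** (ct A ** ct X ** ct A)"
    by (simp only: ctA[symmetric]) (simp only: X_def matrix_mul_assoc)
  also have "\<dots> = (A ** X) ** ct (A ** X)"
    unfolding ct_mult by (simp add: X_def matrix_mul_assoc)
  finally have AX: "A ** X = (A ** X) ** ct (A ** X)" .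
  have 3: "ct (A ** X) = A ** X"
    by (subst (1 2) AX) (simp only: ct_mult ct_ct)
  have "X ** A = (ct A ** ct X ** ct A) ** G ** ct A ** A"
    by (simp only: ctA[symmetric]) (simp only: X_def matrix_mul_assoc)
  also have "\<dots> = ct (X ** A) ** (X ** A)"
    unfolding ct_mult by (simp add: X_def matrix_mul_assoc)
  finally have XA: "X ** A = ct (X ** A) ** (X ** A)" .
  have 4: "ct (X ** A) = X ** A"
    by (subst (1 2) XA) (simp only: ct_mult ct_ct)
  show ?thesis using 1 2 3 4 unfolding is_pinv_def by blast
qed

lemma pinv_unique:
  assumes "is_pinv A X" "is_pinv A Y"
  shows "X = Y"
proof -
  have X: "A ** X ** A = A" "X ** A ** X = X" "ct (A ** X) = A ** X" "ct (X ** A) = X ** A"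
    and Y: "A ** Y ** A = A" "Y ** A ** Y = Y" "ct (A ** Y) = A ** Y" "ct (Y ** A) = Y ** A"
    using assms unfolding is_pinv_def by auto
  have "A ** X = ct (A ** X)" by (simp only: X)
  also have "\<dots> = ct ((A ** Y ** A) ** X)" by (simp only: Y)
  also have "\<dots> = ct (A ** X) ** ct (A ** Y)" by (simp only: ct_mult matrix_mul_assoc)
  also have "\<dots> = (A ** X ** A) ** Y" by (simp only: X(3) Y(3) matrix_mul_assoc)
  finally have AX: "A ** X = A ** Y" by (simp only: X)
  have "X ** A = ct (X ** A)" by (simp only: X)
  also have "\<dots> = ct (X ** (A ** Y ** A))" by (simp only: Y)
  also have "\<dots> = ct (Y ** A) ** ct (X ** A)" by (simp only: ct_mult matrix_mul_assoc)
  also have "\<dots> = Y ** (A ** X ** A)" by (simp only: X(4) Y(4) matrix_mul_assoc)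
  finally have XA: "X ** A = Y ** A" by (simp only: X)
  have "X = X ** (A ** X)" using X(2) by (simp only: matrix_mul_assoc)
  also have "\<dots> = X ** A ** Y" by (simp only: AX matrix_mul_assoc)
  also have "\<dots> = Y" by (simp only: XA Y(2))
  finally show ?thesis .
qed

lemma is_pinv_pinv: "is_pinv A (pinv A)"
  unfolding pinv_def by (rule theI') (metis pinv_exists pinv_unique)

text \<open>The last two identities factor \<open>X\<close> through \<open>ct A\<close> on either
  side: whatever annihilates \<open>ct A\<close> annihilates the pseudoinverse. This is how the
  discarded part of a truncation is removed later.\<close>

lemma is_pinvD:
  assumes "is_pinv A X"
  shows "A ** X ** A = A" "X ** A ** X = X" "ct (A ** X) = A ** X" "ct (X ** A) = X ** A"
    "(A ** X) ** (A ** X) = A ** X" "(X ** A) ** (X ** A) = X ** A"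
    "ct A ** ct X ** X = X" "X ** ct X ** ct A = X"
proof -
  have 1: "A ** X ** A = A" "X ** A ** X = X" "ct (A ** X) = A ** X" "ct (X ** A) = X ** A"
    using assms unfolding is_pinv_def by auto
  then show "A ** X ** A = A" "X ** A ** X = X" "ct (A ** X) = A ** X" "ct (X ** A) = X ** A" .
  show "(A ** X) ** (A ** X) = A ** X" "(X ** A) ** (X ** A) = X ** A"
    by (simp_all only: matrix_mul_assoc 1(1,2))
  show "ct A ** ct X ** X = X"
    by (simp only: ct_mult[symmetric] 1)
  show "X ** ct X ** ct A = X"
    by (simp only: matrix_mul_assoc[symmetric] ct_mult[symmetric] 1(3)) (simp only: matrix_mul_assoc 1(2))
qed

lemma is_pinv_ct:
  assumes "is_pinv A X"
  shows "is_pinv (ct A) (ct X)"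
  unfolding is_pinv_def
  by (simp only: ct_mult[symmetric]) (simp only: matrix_mul_assoc is_pinvD(1-4)[OF assms] simp_thms)

section \<open>Orthogonal projections\<close>

text \<open>The Frobenius norm of a projection exceeds 1 once its rank does, so these bounds come
  from Pythagoras and not from submultiplicativity.\<close>

lemma norm_projection:
  fixes P :: "complex^'a^'a"
  assumes "ct P = P" "P ** P = P"
  shows "norm (P *v x) \<le> norm x" "norm (x - P *v x) \<le> norm x"
    "norm (P ** M) \<le> norm M" "norm (M - P ** M) \<le> norm M"
proof -
  have pyth: "norm u \<le> norm v" "norm (v - u) \<le> norm v" if "u \<bullet> (v - u) = 0"
    for u v :: "'c::real_inner"
  proof -
    have "v \<bullet> v = u \<bullet> u + (v - u) \<bullet> (v - u)"
      using that by (simp add: algebra_simps inner_commute)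
    then show "norm u \<le> norm v" "norm (v - u) \<le> norm v"
      by (simp_all add: norm_eq_sqrt_inner)
  qed
  have "(P *v x) \<bullet> (x - P *v x) = 0"
    using assms by (simp add: inner_matrix_vector_ct matrix_vector_mult_diff_distrib matrix_vector_mul_assoc)
  from pyth[OF this] show "norm (P *v x) \<le> norm x" "norm (x - P *v x) \<le> norm x" .
  have "(P ** M) \<bullet> (M - P ** M) = 0"
    using assms by (simp add: inner_mult_left_ct matrix_diff_ldistrib matrix_mul_assoc)
  from pyth[OF this] show "norm (P ** M) \<le> norm M" "norm (M - P ** M) \<le> norm M" .
qed

section \<open>Best approximation by matrices of fixed rank\<close>

text \<open>\<open>G ** C\<close> projects onto the row space of \<open>C\<close>. The second
  identity shows that \<open>B\<close> is injective there as soon as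
  \<open>mat 1 + G ** (B - C)\<close> is, and this perturbation of the identity has norm below 1; so
  the rank cannot drop.\<close>

lemma pinv_perturbation:
  fixes B C :: "complex^'b^'a"
  assumes G: "is_pinv C G" and small: "norm G * norm (B - C) < 1"
  shows "\<exists>L. L ** (mat 1 + G ** (B - C)) = mat 1"
    and "G ** B ** (G ** C) = (mat 1 + G ** (B - C)) ** (G ** C)"
    and "rank C \<le> rank (B ** (G ** C))"
proof -
  define E where "E = G ** (B - C)"
  have "norm E \<le> norm G * norm (B - C)" unfolding E_def by (rule norm_matrix_mult_le)
  then have E: "norm E < 1" using small by simp
  have "x = 0" if "(mat 1 + E) *v x = 0" for x
  proof (rule ccontr)
    assume "x \<noteq> 0"
    have "x = - (E *v x)" using that by (simp add: matrix_vector_mult_add_rdistrib eq_neg_iff_add_eq_0)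
    then have "norm x = norm (- (E *v x))" by (rule arg_cong)
    then have "norm x \<le> norm E * norm x"
      using norm_matrix_vector_mult_le[of E x] by (simp only: norm_minus_cancel)
    then show False using E \<open>x \<noteq> 0\<close> by simp
  qed
  then obtain L where L: "L ** (mat 1 + E) = mat 1"
    using matrix_left_invertible_ker[of "mat 1 + E"] by blast
  then show "\<exists>L. L ** (mat 1 + G ** (B - C)) = mat 1" unfolding E_def by blast
  let ?Q = "G ** C"
  have "(mat 1 + E) ** ?Q = ?Q + G ** B ** ?Q - ?Q ** ?Q"
    by (simp add: E_def matrix_add_rdistrib matrix_diff_ldistrib matrix_diff_rdistrib)
  then show *: "G ** B ** ?Q = (mat 1 + G ** (B - C)) ** ?Q"
    by (simp add: is_pinvD[OF G] E_def)
  then have "L ** G ** (B ** ?Q) = (L ** (mat 1 + E)) ** ?Q"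
    unfolding E_def by (simp only: matrix_mul_assoc[symmetric])
  then have "L ** G ** (B ** ?Q) = ?Q" by (simp only: L matrix_mul_lid)
  then have "rank ?Q \<le> rank (B ** ?Q)" using rank_mult_le_right[of "L ** G" "B ** ?Q"] by simp
  moreover have "rank C \<le> rank ?Q"
    using rank_mult_le_right[of C ?Q] is_pinvD(1)[OF G] by (simp add: matrix_mul_assoc)
  ultimately show "rank C \<le> rank (B ** ?Q)" by simp
qed

lemma rank_lower_semicontinuous:
  fixes C :: "complex^'b^'a"
  shows "\<exists>\<epsilon>>0. \<forall>B. norm (B - C) < \<epsilon> \<longrightarrow> rank C \<le> rank B"
proof -
  \<comment> \<open>The summand 1 keeps the radius positive when the pseudoinverse is zero.\<close>
  have "rank C \<le> rank B" if B: "norm (B - C) < 1 / (norm (pinv C) + 1)" for B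
  proof -
    have "norm (pinv C) * norm (B - C) \<le> (norm (pinv C) + 1) * norm (B - C)"
      by (intro mult_right_mono) auto
    also have "\<dots> < 1" using B by (simp add: field_simps add_pos_nonneg)
    finally have "rank C \<le> rank (B ** (pinv C ** C))"
      by (rule pinv_perturbation(3)[OF is_pinv_pinv])
    then show ?thesis using rank_mult_le_left[of B "pinv C ** C"] by simp
  qed
  then show ?thesis by (intro exI[of _ "1 / (norm (pinv C) + 1)"]) (auto simp: add_nonneg_pos)
qed

lemma first_order_minimum:
  fixes D F :: "'a::real_inner"
  assumes e: "\<epsilon> > 0" and le: "\<And>t. \<bar>t\<bar> < \<epsilon> \<Longrightarrow> norm D \<le> norm (D - t *\<^sub>R F)"
  shows "D \<bullet> F = 0"
proof (rule ccontr)
  let ?c = "D \<bullet> F"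
  assume c: "?c \<noteq> 0"
  \<comment> \<open>The test value of \<open>t\<close> is \<open>h * ?c\<close>. The first bound on
    \<open>h\<close> keeps the quadratic term at most half of the linear one, the second keeps
    \<open>t\<close> admissible.\<close>
  define h where "h = min (1 / (F \<bullet> F + 1)) (\<epsilon> / (2 * \<bar>?c\<bar>))"
  have h: "h > 0" using e c by (simp add: h_def add_nonneg_pos)
  have h1: "h * (F \<bullet> F) \<le> 1"
  proof -
    have "h * (F \<bullet> F) \<le> 1 / (F \<bullet> F + 1) * (F \<bullet> F)"
      by (intro mult_right_mono) (auto simp: h_def)
    also have "\<dots> \<le> 1" by (simp add: divide_simps add_nonneg_pos)
    finally show ?thesis .
  qed
  have "h \<le> \<epsilon> / (2 * \<bar>?c\<bar>)" by (simp add: h_def)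
  then have "h * \<bar>?c\<bar> \<le> \<epsilon> / 2" using c by (simp add: field_simps)
  then have "\<bar>h * ?c\<bar> < \<epsilon>" using h e by (simp add: abs_mult)
  from le[OF this] have "D \<bullet> D \<le> (D - (h * ?c) *\<^sub>R F) \<bullet> (D - (h * ?c) *\<^sub>R F)"
    by (simp add: norm_eq_sqrt_inner)
  also have "\<dots> = D \<bullet> D - 2 * h * ?c\<^sup>2 + (h * (F \<bullet> F)) * (h * ?c\<^sup>2)"
    by (simp add: inner_commute algebra_simps power2_eq_square)
  finally have "2 * (h * ?c\<^sup>2) \<le> (h * (F \<bullet> F)) * (h * ?c\<^sup>2)" by simp
  also have "\<dots> \<le> 1 * (h * ?c\<^sup>2)" using h h1 by (intro mult_right_mono) auto
  finally have "h * ?c\<^sup>2 \<le> 0" by simp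
  moreover have "h * ?c\<^sup>2 > 0" using h c by simp
  ultimately show False by simp
qed

lemma rank_projection_rank: "is_rank_projection r J C \<Longrightarrow> rank C = r"
  by (simp add: is_rank_projection_def is_arg_min_def)

lemma rank_projection_le:
  "is_rank_projection r J C \<Longrightarrow> rank B = r \<Longrightarrow> norm (J - C) \<le> norm (J - B)"
  by (auto simp: is_rank_projection_def is_arg_min_def not_less)

text \<open>The nearest point property is exploited along the curves \<open>C (1 + t E)\<close> and \<open>(1 + t E) C\<close>,
  which stay in the set of matrices of rank \<open>r\<close> for small \<open>t\<close>.\<close>

lemma rank_projection_orthogonal:
  assumes "is_rank_projection r J C"
  shows "ct C ** (J - C) = 0" "(J - C) ** ct C = 0"
proof -
  note r = rank_projection_rank[OF assms]
  obtain \<epsilon> where e: "\<epsilon> > 0" "\<And>B. norm (B - C) < \<epsilon> \<Longrightarrow> rank C \<le> rank B"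
    using rank_lower_semicontinuous[of C] by blast
  \<comment> \<open>The rank is at least \<open>r\<close> near \<open>C\<close> by lower
    semicontinuity; a line along which it is at most \<open>r\<close> therefore consists of
    competitors for small \<open>t\<close>.\<close>
  have stat: "(J - C) \<bullet> F = 0" if le: "\<And>t. rank (C + t *\<^sub>R F) \<le> r" for F
  proof (rule first_order_minimum)
    show "\<epsilon> / (norm F + 1) > 0" using e by (simp add: add_nonneg_pos)
    fix t :: real assume t: "\<bar>t\<bar> < \<epsilon> / (norm F + 1)"
    have "norm (t *\<^sub>R F) \<le> \<bar>t\<bar> * (norm F + 1)" by (simp add: mult_left_mono)
    also have "\<dots> < \<epsilon>" using t by (simp add: pos_less_divide_eq add_nonneg_pos)
    finally have "rank C \<le> rank (C + t *\<^sub>R F)" by (intro e) simp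
    then have "rank (C + t *\<^sub>R F) = r" using le[of t] r by simp
    from rank_projection_le[OF assms this]
    show "norm (J - C) \<le> norm (J - C - t *\<^sub>R F)" by (simp add: algebra_simps)
  qed
  have "rank (C + t *\<^sub>R (C ** E)) \<le> r" for t E
  proof -
    have "C + t *\<^sub>R (C ** E) = C ** (mat 1 + t *\<^sub>R E)"
      by (simp add: matrix_add_ldistrib matrix_scaleR_right)
    then show ?thesis using rank_mult_le_left[of C "mat 1 + t *\<^sub>R E"] r by simp
  qed
  \<comment> \<open>For this \<open>E\<close> stationarity says that the squared norm of
    \<open>ct C ** (J - C)\<close> vanishes.\<close>
  from stat[OF this, of "ct C ** (J - C)"]
  have "(ct C ** (J - C)) \<bullet> (ct C ** (J - C)) = 0"
    by (simp only: inner_commute[of "J - C" "C ** (ct C ** (J - C))"] inner_mult_left_ct)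
  then show "ct C ** (J - C) = 0" by (simp only: inner_eq_zero_iff)
  have "rank (C + t *\<^sub>R (E ** C)) \<le> r" for t E
  proof -
    have "C + t *\<^sub>R (E ** C) = (mat 1 + t *\<^sub>R E) ** C"
      by (simp add: matrix_add_rdistrib matrix_scaleR_left)
    then show ?thesis using rank_mult_le_right[of "mat 1 + t *\<^sub>R E" C] r by simp
  qed
  from stat[OF this, of "(J - C) ** ct C"]
  have "0 = ((J - C) ** ct C ** C) \<bullet> (J - C)" by (subst inner_commute) (rule sym)
  also have "\<dots> = ct ((J - C) ** ct C ** C) \<bullet> ct (J - C)" by (rule inner_ct_ct[symmetric])
  also have "\<dots> = (ct C ** ct ((J - C) ** ct C)) \<bullet> ct (J - C)"
    by (simp only: ct_mult[of "(J - C) ** ct C"])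
  also have "\<dots> = ct ((J - C) ** ct C) \<bullet> ct ((J - C) ** ct C)"
    by (simp only: inner_mult_left_ct) (simp only: ct_mult ct_ct)
  also have "\<dots> = ((J - C) ** ct C) \<bullet> ((J - C) ** ct C)" by (rule inner_ct_ct)
  finally have "((J - C) ** ct C) \<bullet> ((J - C) ** ct C) = 0" by (rule sym)
  then show "(J - C) ** ct C = 0" by (simp only: inner_eq_zero_iff)
qed

text \<open>Orthogonality gives \<open>ct C ** C = ct C ** J\<close>, so \<open>C\<close> is a left
  multiple of \<open>J\<close>. Definedness of the truncation thereby becomes a statement about
  rank.\<close>

lemma rank_projection_rank_le:
  assumes "is_rank_projection r J C"
  shows "r \<le> rank J"
proof -
  note G = is_pinvD[OF is_pinv_pinv[of C]]
  have "C = ct (C ** pinv C) ** C" by (simp only: G)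
  also have "\<dots> = ct (pinv C) ** (ct C ** C)" by (simp only: ct_mult matrix_mul_assoc)
  also have "ct C ** C = ct C ** J"
    using rank_projection_orthogonal(1)[OF assms] by (simp add: matrix_diff_ldistrib)
  finally have "rank C = rank (ct (pinv C) ** ct C ** J)" by (simp only: matrix_mul_assoc)
  also have "\<dots> \<le> rank J" by (rule rank_mult_le_right)
  finally show ?thesis using rank_projection_rank[OF assms] by simp
qed

lemma rank_projection_eq_self:
  assumes "rank J = r"
  shows "rank_projection_defined r J" "rank_projection r J = J"
proof -
  have iff: "is_rank_projection r J C \<longleftrightarrow> C = J" for C
  proof
    assume "is_rank_projection r J C"
    from rank_projection_le[OF this assms] show "C = J" by simp
  qed (use assms in \<open>simp add: is_rank_projection_def is_arg_min_def\<close>)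
  show "rank_projection_defined r J" "rank_projection r J = J"
    by (simp_all add: rank_projection_defined_def rank_projection_def iff)
qed

section \<open>Nearest matrices close to a matrix of rank \<open>r\<close>: existence and
  bounds\<close>

lemma closed_rank_le: "closed {C :: complex^'b^'a. rank C \<le> r}"
proof -
  have "open {C :: complex^'b^'a. r < rank C}"
    unfolding open_dist
  proof (intro ballI)
    fix C :: "complex^'b^'a" assume C: "C \<in> {C. r < rank C}"
    obtain \<epsilon> where "\<epsilon> > 0" "\<And>B. norm (B - C) < \<epsilon> \<Longrightarrow> rank C \<le> rank B"
      using rank_lower_semicontinuous[of C] by blast
    then show "\<exists>e>0. \<forall>y. dist y C < e \<longrightarrow> y \<in> {C. r < rank C}"
      using C by (intro exI[of _ \<epsilon>]) (auto simp: dist_norm intro: less_le_trans)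
  qed
  moreover have "{C :: complex^'b^'a. rank C \<le> r} = - {C. r < rank C}" by auto
  ultimately show ?thesis by (simp add: closed_open)
qed

text \<open>Rank at most \<open>r\<close> is a closed condition, rank exactly \<open>r\<close> in
  general is not. A minimiser over the former in a compact ball is within
  \<open>2 * norm (J - B)\<close> of \<open>B\<close>, where the rank cannot be smaller than
  \<open>r\<close>.\<close>

lemma rank_projection_exists_near:
  fixes B :: "complex^'b^'a"
  assumes r: "rank B = r"
  shows "\<exists>\<epsilon>>0. \<forall>J. norm (J - B) < \<epsilon> \<longrightarrow> (\<exists>C. is_rank_projection r J C)"
proof -
  obtain \<epsilon> where e: "\<epsilon> > 0" "\<And>C. norm (C - B) < \<epsilon> \<Longrightarrow> rank B \<le> rank C"
    using rank_lower_semicontinuous[of B] by blast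
  have "\<exists>C. is_rank_projection r J C" if J: "norm (J - B) < \<epsilon> / 2" for J
  proof -
    let ?K = "{C. rank C \<le> r} \<inter> cball J (norm (J - B))"
    have cpt: "compact ?K" by (intro closed_Int_compact closed_rank_le compact_cball)
    have "B \<in> ?K" using r by (simp add: dist_norm)
    then have ne: "?K \<noteq> {}" by blast
    have "continuous_on ?K (\<lambda>C. norm (J - C))" by (intro continuous_intros)
    from continuous_attains_inf[OF cpt ne this]
    obtain C where C: "C \<in> ?K" and min: "\<forall>D\<in>?K. norm (J - C) \<le> norm (J - D)" by blast
    have "norm (C - B) \<le> norm (J - C) + norm (J - B)"
      using norm_triangle_ineq4[of "J - B" "J - C"] by simp
    then have "norm (C - B) < \<epsilon>" using C J by (simp add: dist_norm)
    then have "rank C = r" using e(2)[of C] C r by simp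
    moreover have "norm (J - C) \<le> norm (J - D)" if "rank D = r" for D
    proof (cases "norm (J - D) \<le> norm (J - B)")
      case True
      then show ?thesis using that by (intro min[rule_format]) (simp add: dist_norm)
    next
      case False
      then show ?thesis using C by (simp add: dist_norm)
    qed
    ultimately have "is_rank_projection r J C"
      by (auto simp: is_rank_projection_def is_arg_min_def not_less)
    then show ?thesis by blast
  qed
  moreover have "\<epsilon> / 2 > 0" using e by simp
  ultimately show ?thesis by blast
qed

text \<open>A right inverse \<open>W\<close> of \<open>C\<close> on its range is chosen with values
  in the row space of \<open>B\<close>. There \<open>G ** C\<close> acts as
  \<open>mat 1 + E\<close>, which bounds \<open>W\<close> by \<open>G\<close>; the pseudoinverse
  \<open>H\<close> is the projection of \<open>W\<close> to the row space of \<open>C\<close> and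
  therefore no larger.\<close>

lemma norm_pinv_le_near:
  fixes B C :: "complex^'b^'a"
  assumes rank: "rank C = rank B" and G: "is_pinv B G" and H: "is_pinv C H"
    and small: "norm G * norm (C - B) \<le> 1 / 2"
  shows "norm H \<le> 2 * norm G * norm (mat 1 :: complex^'a^'a)"
proof -
  define E where "E = G ** (C - B)"
  define Q where "Q = G ** B"
  define P where "P = C ** H"
  have "norm E \<le> norm G * norm (C - B)" unfolding E_def by (rule norm_matrix_mult_le)
  then have E: "norm E \<le> 1 / 2" using small by simp
  have "norm G * norm (C - B) < 1" using small by simp
  note pert = pinv_perturbation[OF G this, folded E_def Q_def]
  \<comment> \<open>Equality of the ranks enters here: \<open>C\<close> restricted to the row space
    of \<open>B\<close> still reaches its whole range.\<close>
  have range_eq: "range ((*v) (C ** Q)) = range ((*v) C)"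
  proof (rule vec.subspace_dim_equal)
    show "range ((*v) (C ** Q)) \<subseteq> range ((*v) C)"
      by (auto simp: matrix_vector_mul_assoc[symmetric])
    show "vec.dim (range ((*v) C)) \<le> vec.dim (range ((*v) (C ** Q)))"
      using pert(3) rank by (simp add: rank_eq_dim_range)
  qed (intro vec.subspace_image vec.subspace_UNIV)+
  obtain V where V: "(C ** Q) ** V ** (C ** Q) = C ** Q"
    using generalized_inverse_exists[of "C ** Q"] by blast
  have "(C ** Q ** V ** C) *v x = C *v x" for x
  proof -
    have "C *v x \<in> range ((*v) (C ** Q))" unfolding range_eq by blast
    then obtain u where u: "C *v x = (C ** Q) *v u" by blast
    have "(C ** Q ** V ** C) *v x = (C ** Q ** V) *v (C *v x)"
      by (simp only: matrix_vector_mul_assoc)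
    also have "\<dots> = ((C ** Q) ** V ** (C ** Q)) *v u"
      unfolding u by (simp only: matrix_vector_mul_assoc)
    finally show ?thesis by (simp only: V u)
  qed
  then have CQVC: "C ** Q ** V ** C = C" by (simp add: matrix_eq)
  define W where "W = Q ** V ** P"
  have CW: "C ** W = P"
    unfolding W_def P_def by (simp only: matrix_mul_assoc CQVC)
  have QW: "Q ** W = W"
    unfolding W_def using is_pinvD(6)[OF G] by (simp only: matrix_mul_assoc Q_def)
  have "G ** P = (G ** C ** Q) ** W"
    by (simp only: CW[symmetric] matrix_mul_assoc[symmetric] QW)
  also have "\<dots> = W + E ** W"
    unfolding pert(2) by (simp only: matrix_mul_assoc[symmetric] QW matrix_add_rdistrib matrix_mul_lid)
  finally have "W = G ** P - E ** W" by simp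
  then have "norm W \<le> norm (G ** P) + norm (E ** W)"
    using norm_triangle_ineq4[of "G ** P" "E ** W"] by simp
  also have "\<dots> \<le> norm G * norm P + 1 / 2 * norm W"
    using norm_matrix_mult_le[of G P] norm_matrix_mult_le[of E W] mult_right_mono[OF E, of "norm W"]
    by simp
  finally have W: "norm W \<le> 2 * (norm G * norm P)" by simp
  have "norm P \<le> norm (mat 1 :: complex^'a^'a)"
    using norm_projection(3)[OF is_pinvD(3,5)[OF H], of "mat 1"] by (simp add: P_def)
  then have "2 * (norm G * norm P) \<le> 2 * norm G * norm (mat 1 :: complex^'a^'a)"
    by (simp add: mult_left_mono)
  moreover have "norm H \<le> norm W"
  proof -
    have "H = H ** C ** W"
      using is_pinvD(2)[OF H] CW by (simp add: P_def matrix_mul_assoc[symmetric])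
    then have "norm H = norm (H ** C ** W)" by (rule arg_cong)
    then show ?thesis using norm_projection(3)[OF is_pinvD(4,6)[OF H], of W] by simp
  qed
  ultimately show ?thesis using W by simp
qed

text \<open>\<open>C1 ** G1 = J1 ** G1\<close>, since \<open>R1\<close> vanishes on the row space of
  \<open>C1\<close>, and removing the range of \<open>C0\<close> from \<open>J0\<close> leaves
  \<open>R0\<close>. As \<open>R0\<close> vanishes on the row space of \<open>C0\<close>, it sees
  only the part of the row space of \<open>C1\<close> orthogonal to that, which brings in the second
  sine.\<close>

lemma sin_theta_step:
  assumes G0: "is_pinv C0 G0" and G1: "is_pinv C1 G1"
    and R0: "ct C0 ** R0 = 0" and R1: "R1 ** ct C1 = 0"
    and J0: "J0 = C0 + R0" and J1: "J1 = C1 + R1"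
    and R0': "R0 ** ct C0 = 0"
  shows "norm (C1 ** G1 - C0 ** G0 ** (C1 ** G1))
    \<le> (norm (J1 - J0) + norm R0 * norm (G1 ** C1 - G0 ** C0 ** (G1 ** C1))) * norm G1"
proof -
  define P where "P = C0 ** G0"
  define D where "D = G1 ** C1 - G0 ** C0 ** (G1 ** C1)"
  have "R1 ** G1 = R1 ** ct C1 ** ct G1 ** G1"
    using is_pinvD(7)[OF G1] by (simp only: matrix_mul_assoc[symmetric])
  then have J1G1: "J1 ** G1 = C1 ** G1" by (simp add: J1 R1 matrix_add_rdistrib)
  have "G0 ** R0 = G0 ** ct G0 ** (ct C0 ** R0)"
    using is_pinvD(8)[OF G0] by (simp only: matrix_mul_assoc)
  then have "P ** R0 = 0" by (simp add: R0 P_def matrix_mul_assoc[symmetric])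
  then have J0P: "J0 - P ** J0 = R0"
    by (simp add: J0 matrix_add_ldistrib P_def is_pinvD(1)[OF G0])
  have "ct C0 ** ct G0 = G0 ** C0" using is_pinvD(4)[OF G0] by (simp only: ct_mult)
  then have "R0 ** (G0 ** C0) = R0 ** ct C0 ** ct G0" by (simp only: matrix_mul_assoc[symmetric])
  then have "R0 ** (G0 ** C0) = 0" by (simp add: R0')
  then have "R0 ** D ** G1 = R0 ** (G1 ** C1 ** G1)"
    by (simp add: D_def matrix_diff_ldistrib matrix_mul_assoc)
  then have R0G1: "R0 ** G1 = R0 ** D ** G1" by (simp only: is_pinvD(2)[OF G1])
  define F where "F = J1 - J0"
  have "C1 ** G1 - P ** (C1 ** G1) = (F - P ** F) ** G1 + (J0 - P ** J0) ** G1"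
    by (simp add: F_def J1G1[symmetric] matrix_diff_rdistrib matrix_diff_ldistrib matrix_mul_assoc)
  also have "\<dots> = (F - P ** F) ** G1 + R0 ** D ** G1"
    by (simp only: J0P R0G1)
  finally have "norm (C1 ** G1 - P ** (C1 ** G1)) \<le> norm ((F - P ** F) ** G1) + norm (R0 ** D ** G1)"
    using norm_triangle_ineq[of "(F - P ** F) ** G1" "R0 ** D ** G1"] by simp
  also have "norm ((F - P ** F) ** G1) \<le> norm F * norm G1"
    using norm_matrix_mult_le[of "F - P ** F" G1]
      mult_right_mono[OF norm_projection(4)[OF is_pinvD(3,5)[OF G0], of F], of "norm G1"]
    by (simp add: P_def)
  also have "norm (R0 ** D ** G1) \<le> norm R0 * norm D * norm G1"
    using norm_matrix_mult_le[of "R0 ** D" G1] mult_right_mono[OF norm_matrix_mult_le[of R0 D], of "norm G1"]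
    by simp
  finally show ?thesis by (simp add: P_def D_def F_def algebra_simps)
qed

text \<open>The sine of the angle between the ranges is bounded through the sine of the angle between the
  row spaces, and vice versa, with a small factor in front; hence both are bounded.\<close>

lemma sin_theta:
  assumes G0: "is_pinv C0 G0" and G1: "is_pinv C1 G1"
    and R0: "ct C0 ** R0 = 0" "R0 ** ct C0 = 0" and R1: "ct C1 ** R1 = 0" "R1 ** ct C1 = 0"
    and J0: "J0 = C0 + R0" and J1: "J1 = C1 + R1"
    and small: "norm R0 * norm G1 \<le> 1 / 2"
  shows "norm (C1 ** G1 - C0 ** G0 ** (C1 ** G1)) \<le> 4 * norm G1 * norm (J1 - J0)"
proof -
  define a where "a = norm (C1 ** G1 - C0 ** G0 ** (C1 ** G1))"
  define b where "b = norm (G1 ** C1 - G0 ** C0 ** (G1 ** C1))"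
  have swap: "ct C ** ct G = G ** C" "ct G ** ct C = C ** G" if "is_pinv C G" for C :: "complex^'a^'b" and G
    using is_pinvD(3,4)[OF that] by (simp_all only: ct_mult[symmetric])
  have a: "a \<le> (norm (J1 - J0) + norm R0 * b) * norm G1"
    unfolding a_def b_def by (rule sin_theta_step[OF G0 G1 R0(1) R1(2) J0 J1 R0(2)])
  have ctJ: "ct J0 = ct C0 + ct R0" "ct J1 = ct C1 + ct R1"
    by (simp_all add: J0 J1 vec_eq_iff)
  have ctR: "ct (ct C0) ** ct R0 = 0" "ct R1 ** ct (ct C1) = 0" "ct R0 ** ct (ct C0) = 0"
    using arg_cong[OF R0(1), of ct] arg_cong[OF R0(2), of ct] arg_cong[OF R1(1), of ct]
    by (simp_all add: ct_mult)
  \<comment> \<open>Conjugate transposition exchanges ranges and row spaces, so the same step bounds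
    \<open>b\<close> through \<open>a\<close>.\<close>
  have "norm (ct C1 ** ct G1 - ct C0 ** ct G0 ** (ct C1 ** ct G1))
    \<le> (norm (ct J1 - ct J0) + norm (ct R0) * norm (ct G1 ** ct C1 - ct G0 ** ct C0 ** (ct G1 ** ct C1))) * norm (ct G1)"
    by (rule sin_theta_step[OF is_pinv_ct[OF G0] is_pinv_ct[OF G1] ctR(1,2) ctJ ctR(3)])
  then have b: "b \<le> (norm (J1 - J0) + norm R0 * a) * norm G1"
    by (simp add: swap[OF G0] swap[OF G1] ct_diff[symmetric] a_def b_def)
  have "a + b \<le> 2 * (norm (J1 - J0) * norm G1) + (norm R0 * norm G1) * (a + b)"
    using a b by (simp add: algebra_simps)
  also have "(norm R0 * norm G1) * (a + b) \<le> 1 / 2 * (a + b)"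
    by (rule mult_right_mono[OF small]) (simp add: a_def b_def)
  finally have "a + b \<le> 2 * (norm (J1 - J0) * norm G1) + 1 / 2 * (a + b)" by simp
  moreover have "t \<le> 2 * x + 1 / 2 * t \<Longrightarrow> t \<le> 4 * x" for t x :: real by linarith
  ultimately have "a + b \<le> 4 * (norm (J1 - J0) * norm G1)" by blast
  moreover have "b \<ge> 0" by (simp add: b_def)
  ultimately show ?thesis by (simp add: a_def algebra_simps)
qed

section \<open>Truncated pseudoinverse and range projection\<close>

definition trunc_pinv :: "nat \<Rightarrow> complex^'b^'a \<Rightarrow> complex^'a^'b" where
  "trunc_pinv r J = pinv (rank_projection r J)"

definition trunc_range_proj :: "nat \<Rightarrow> complex^'b^'a \<Rightarrow> complex^'a^'a" where
  "trunc_range_proj r J = rank_projection r J ** trunc_pinv r J"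

lemma trunc_range_proj_norm:
  "norm (trunc_range_proj r J *v x) \<le> norm x" "norm (x - trunc_range_proj r J *v x) \<le> norm x"
  using norm_projection[OF is_pinvD(3,5)[OF is_pinv_pinv[of "rank_projection r J"]]]
  by (simp_all add: trunc_range_proj_def trunc_pinv_def)

lemma trunc_range_proj_idem: "trunc_range_proj r J ** trunc_range_proj r J = trunc_range_proj r J"
  using is_pinvD(5)[OF is_pinv_pinv[of "rank_projection r J"]]
  by (simp add: trunc_range_proj_def trunc_pinv_def)

lemma trunc_range_proj_ct: "ct (trunc_range_proj r J) = trunc_range_proj r J"
  using is_pinvD(3)[OF is_pinv_pinv[of "rank_projection r J"]]
  by (simp add: trunc_range_proj_def trunc_pinv_def)

lemma trunc_pinv_range_proj: "trunc_pinv r J ** trunc_range_proj r J = trunc_pinv r J"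
  using is_pinvD(2)[OF is_pinv_pinv[of "rank_projection r J"]]
  by (simp add: trunc_range_proj_def trunc_pinv_def matrix_mul_assoc)

lemma rank_projection_is:
  "rank_projection_defined r J \<Longrightarrow> is_rank_projection r J (rank_projection r J)"
  unfolding rank_projection_defined_def rank_projection_def by (rule theI')

text \<open>The discarded part of \<open>J\<close> vanishes on the range of the truncated
  pseudoinverse. Hence the step solves the linearised equation with the full \<open>J\<close>, up to
  the residual component outside the truncated range.\<close>

lemma mult_trunc_pinv:
  assumes "rank_projection_defined r J"
  shows "J ** trunc_pinv r J = trunc_range_proj r J"
proof -
  let ?C = "rank_projection r J"
  have "(J - ?C) ** pinv ?C = ((J - ?C) ** ct ?C) ** ct (pinv ?C) ** pinv ?C"
    using is_pinvD(7)[OF is_pinv_pinv[of ?C]] by (simp only: matrix_mul_assoc[symmetric])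
  also have "\<dots> = 0"
    using rank_projection_orthogonal(2)[OF rank_projection_is[OF assms]] by simp
  finally show ?thesis
    by (simp add: trunc_range_proj_def trunc_pinv_def matrix_diff_rdistrib)
qed

lemma rank_projection_near:
  fixes B :: "complex^'b^'a"
  assumes r: "rank B = r"
  shows "\<exists>\<epsilon>>0. \<exists>c>0.
    (\<forall>J. norm (J - B) < \<epsilon> \<longrightarrow> rank_projection_defined r J \<and>
      norm (trunc_pinv r J) \<le> c \<and> norm (rank_projection r J) \<le> c) \<and>
    (\<forall>J0 J1. norm (J0 - B) < \<epsilon> \<longrightarrow> norm (J1 - B) < \<epsilon> \<longrightarrow>
      norm (trunc_range_proj r J1 - trunc_range_proj r J0 ** trunc_range_proj r J1) \<le> c * norm (J1 - J0))"
proof -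
  obtain \<epsilon>0 where e0: "\<epsilon>0 > 0" "\<And>J. norm (J - B) < \<epsilon>0 \<Longrightarrow> \<exists>C. is_rank_projection r J C"
    using rank_projection_exists_near[OF r] by blast
  define G where "G = pinv B"
  have G: "is_pinv B G" unfolding G_def by (rule is_pinv_pinv)
  define c1 where "c1 = 2 * norm G * norm (mat 1 :: complex^'a^'a) + 1"
  have c1: "c1 > 0" by (simp add: c1_def add_nonneg_pos)
  \<comment> \<open>A nearest matrix \<open>C\<close> to such a \<open>J\<close> is within
    \<open>2 * \<epsilon>\<close> of \<open>B\<close>. The entry with \<open>norm G\<close> gives
    the factor 1/2 needed to bound \<open>pinv C\<close>, the one with \<open>c1\<close> the factor
    1/2 in the angle estimate, and the 1 bounds \<open>C\<close> itself.\<close>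
  define \<epsilon> where "\<epsilon> = min \<epsilon>0 (min 1 (min (1 / (4 * (norm G + 1))) (1 / (2 * c1))))"
  have e: "\<epsilon> > 0" using e0 c1 by (simp add: \<epsilon>_def add_nonneg_pos)
  have near: "norm (J - C) < \<epsilon> \<and> norm (C - B) < 2 * \<epsilon> \<and> norm (pinv C) \<le> c1 \<and> norm (J - C) * c1 \<le> 1 / 2"
    if J: "norm (J - B) < \<epsilon>" and C: "is_rank_projection r J C" for J C
  proof -
    have JC: "norm (J - C) < \<epsilon>" using rank_projection_le[OF C r] J by simp
    have CB: "norm (C - B) < 2 * \<epsilon>"
      using norm_triangle_ineq4[of "J - B" "J - C"] J JC by simp
    have gp: "norm G + 1 > 0" by (simp add: add_nonneg_pos)
    have "\<epsilon> \<le> 1 / 4 / (norm G + 1)" by (simp add: \<epsilon>_def)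
    then have "\<epsilon> * (norm G + 1) \<le> 1 / 4" by (simp only: pos_le_divide_eq[OF gp])
    moreover have "norm (C - B) * (norm G + 1) \<le> 2 * \<epsilon> * (norm G + 1)"
      using CB gp by (intro mult_right_mono) auto
    ultimately have "norm (C - B) * (norm G + 1) \<le> 1 / 2" by linarith
    moreover have "norm G * norm (C - B) \<le> norm (C - B) * (norm G + 1)" by (simp add: algebra_simps)
    ultimately have "norm G * norm (C - B) \<le> 1 / 2" by simp
    then have "norm (pinv C) \<le> c1"
      using norm_pinv_le_near[OF _ G is_pinv_pinv, of C] rank_projection_rank[OF C] r
      by (simp add: c1_def)
    moreover have "norm (J - C) * c1 \<le> 1 / 2"
    proof -
      have "\<epsilon> \<le> 1 / (2 * c1)" by (simp add: \<epsilon>_def)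
      then have "norm (J - C) \<le> 1 / (2 * c1)" using JC by simp
      then show ?thesis using c1 by (simp add: field_simps)
    qed
    ultimately show ?thesis using JC CB by blast
  qed
  have sin: "norm (C1 ** pinv C1 - C0 ** pinv C0 ** (C1 ** pinv C1)) \<le> 4 * c1 * norm (J1 - J0)"
    if J: "norm (J0 - B) < \<epsilon>" "norm (J1 - B) < \<epsilon>"
      and C0: "is_rank_projection r J0 C0" and C1: "is_rank_projection r J1 C1" for J0 J1 C0 C1
  proof -
    note n0 = near[OF J(1) C0] and n1 = near[OF J(2) C1]
    have "norm (J0 - C0) * norm (pinv C1) \<le> norm (J0 - C0) * c1"
      using n1 by (intro mult_left_mono) auto
    then have "norm (J0 - C0) * norm (pinv C1) \<le> 1 / 2" using n0 by simp
    from sin_theta[OF is_pinv_pinv is_pinv_pinv rank_projection_orthogonal[OF C0]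
        rank_projection_orthogonal[OF C1] _ _ this, of J0 J1]
    have "norm (C1 ** pinv C1 - C0 ** pinv C0 ** (C1 ** pinv C1)) \<le> 4 * norm (pinv C1) * norm (J1 - J0)"
      by simp
    also have "\<dots> \<le> 4 * c1 * norm (J1 - J0)" using n1 by (intro mult_right_mono) auto
    finally show ?thesis .
  qed
  \<comment> \<open>For \<open>J0 = J1\<close> the angle bound is zero, so two nearest matrices
    share their range projection, and each is recovered as that projection times
    \<open>J\<close>.\<close>
  have uniq: "C0 = C1" if J: "norm (J - B) < \<epsilon>"
      and C0: "is_rank_projection r J C0" and C1: "is_rank_projection r J C1" for J C0 C1
  proof -
    define P0 where "P0 = C0 ** pinv C0"
    define P1 where "P1 = C1 ** pinv C1"
    have P1: "P1 = P0 ** P1" using sin[OF J J C0 C1] by (simp add: P0_def P1_def)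
    have P0: "P0 = P1 ** P0" using sin[OF J J C1 C0] by (simp add: P0_def P1_def)
    have herm: "ct P0 = P0" "ct P1 = P1"
      unfolding P0_def P1_def by (rule is_pinvD(3)[OF is_pinv_pinv])+
    have "P0 = ct P0" by (rule herm(1)[symmetric])
    also have "\<dots> = ct (P1 ** P0)" by (rule arg_cong[OF P0])
    also have "\<dots> = P0 ** P1" by (simp only: ct_mult herm)
    also have "\<dots> = P1" by (rule P1[symmetric])
    finally have PP: "P0 = P1" .
    have PJ: "C ** pinv C ** J = C" if "is_rank_projection r J C" for C
    proof -
      have "pinv C ** (J - C) = pinv C ** ct (pinv C) ** (ct C ** (J - C))"
        using is_pinvD(8)[OF is_pinv_pinv[of C]] by (simp only: matrix_mul_assoc)
      then have "pinv C ** (J - C) = 0"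
        by (simp only: rank_projection_orthogonal(1)[OF that] matrix_mult_0_right)
      then have "pinv C ** J = pinv C ** C" by (simp add: matrix_diff_ldistrib)
      then have "C ** (pinv C ** J) = C ** (pinv C ** C)" by simp
      then show ?thesis by (simp only: matrix_mul_assoc is_pinvD(1)[OF is_pinv_pinv])
    qed
    have "C0 = P0 ** J" unfolding P0_def by (rule PJ[OF C0, symmetric])
    also have "\<dots> = C1" unfolding PP P1_def by (rule PJ[OF C1])
    finally show ?thesis .
  qed
  have defd: "rank_projection_defined r J" if "norm (J - B) < \<epsilon>" for J
  proof -
    have "norm (J - B) < \<epsilon>0" using that by (simp add: \<epsilon>_def)
    then show ?thesis
      unfolding rank_projection_defined_def using e0(2)[of J] uniq[OF that] by blast
  qed
  define c where "c = 4 * c1 + norm B + 2"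
  have c: "c > 0" "c1 \<le> c" "norm B + 2 \<le> c" "4 * c1 \<le> c" using c1 by (simp_all add: c_def add_pos_nonneg)
  have "norm (trunc_pinv r J) \<le> c \<and> norm (rank_projection r J) \<le> c" if J: "norm (J - B) < \<epsilon>" for J
  proof -
    note n = near[OF J rank_projection_is[OF defd[OF J]]]
    have "\<epsilon> \<le> 1" by (simp add: \<epsilon>_def)
    then have "norm (rank_projection r J - B) < 2" using n by linarith
    then have "norm (rank_projection r J) \<le> norm B + 2"
      using norm_triangle_ineq2[of "rank_projection r J" B] by linarith
    then show ?thesis using n c by (simp add: trunc_pinv_def)
  qed
  moreover have "norm (trunc_range_proj r J1 - trunc_range_proj r J0 ** trunc_range_proj r J1) \<le> c * norm (J1 - J0)"
    if J: "norm (J0 - B) < \<epsilon>" "norm (J1 - B) < \<epsilon>" for J0 J1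
  proof -
    have "4 * c1 * norm (J1 - J0) \<le> c * norm (J1 - J0)" using c by (intro mult_right_mono) auto
    then show ?thesis
      using sin[OF J rank_projection_is[OF defd[OF J(1)]] rank_projection_is[OF defd[OF J(2)]]]
      unfolding trunc_range_proj_def trunc_pinv_def by linarith
  qed
  ultimately show ?thesis using e c(1) defd by blast
qed

section \<open>Newton iteration with rank projection\<close>

primrec trunc_newton ::
  "nat \<Rightarrow> (complex^'b \<Rightarrow> complex^'a) \<Rightarrow> (complex^'b \<Rightarrow> complex^'b^'a) \<Rightarrow> complex^'b \<Rightarrow> nat \<Rightarrow> complex^'b" where
  "trunc_newton r f J x 0 = x"
| "trunc_newton r f J x (Suc j) = trunc_newton r f J x j -
     trunc_pinv r (J (trunc_newton r f J x j)) *v f (trunc_newton r f J x j)"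

lemma halving_steps_converge:
  fixes x :: "nat \<Rightarrow> 'a::banach"
  assumes half: "\<And>j. norm (x (Suc (Suc j)) - x (Suc j)) \<le> norm (x (Suc j) - x j) / 2"
  shows "\<exists>l. x \<longlonglongrightarrow> l \<and> (\<forall>j. norm (l - x j) \<le> 2 * norm (x (Suc j) - x j))"
proof -
  define s where "s j = norm (x (Suc j) - x j)" for j
  have s: "s (j + n) \<le> s j * (1 / 2) ^ n" for j n
  proof (induction n)
    case (Suc n)
    then show ?case using half[of "j + n"] by (simp add: s_def)
  qed simp
  \<comment> \<open>The exact partial sum of the geometric series is carried along, as the bound
    \<open>2 * s j\<close> alone is not inductive.\<close>
  have dist: "norm (x (j + n) - x j) \<le> 2 * (1 - (1 / 2) ^ n) * s j" for j n
  proof (induction n)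
    case (Suc n)
    have "norm (x (j + Suc n) - x j) \<le> s (j + n) + norm (x (j + n) - x j)"
      using norm_triangle_ineq[of "x (j + Suc n) - x (j + n)" "x (j + n) - x j"] by (simp add: s_def)
    then show ?case using Suc s[of j n] by (simp add: algebra_simps)
  qed simp
  have dist2: "norm (x (j + n) - x j) \<le> 2 * s j" for j n
  proof -
    have "2 * (1 - (1 / 2) ^ n) * s j \<le> 2 * s j"
      by (intro mult_right_mono) (auto simp: s_def)
    then show ?thesis using dist[of j n] by linarith
  qed
  have "Cauchy x"
    unfolding Cauchy_altdef2
  proof (intro allI impI)
    fix e :: real assume e: "e > 0"
    have "(\<lambda>n. 2 * (s 0 * (1 / 2) ^ n)) \<longlonglongrightarrow> 2 * (s 0 * 0)"
      by (intro tendsto_mult tendsto_const LIMSEQ_realpow_zero) auto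
    then have "\<forall>\<^sub>F n in sequentially. 2 * (s 0 * (1 / 2) ^ n) < e"
      using e by (intro order_tendstoD(2)[where a = e]) auto
    then obtain N where N: "2 * (s 0 * (1 / 2) ^ N) < e"
      by (auto simp: eventually_sequentially)
    have "dist (x n) (x N) < e" if "n \<ge> N" for n
      using dist2[of N "n - N"] s[of 0 N] N that by (simp add: dist_norm)
    then show "\<exists>N. \<forall>n\<ge>N. dist (x n) (x N) < e" by blast
  qed
  then obtain l where l: "x \<longlonglongrightarrow> l" by (metis Cauchy_convergent convergent_def)
  have "norm (l - x j) \<le> 2 * s j" for j
  proof (rule LIMSEQ_le_const2)
    show "(\<lambda>n. norm (x n - x j)) \<longlonglongrightarrow> norm (l - x j)"
      by (intro tendsto_intros l)
    show "\<exists>N. \<forall>n\<ge>N. norm (x n - x j) \<le> 2 * s j"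
    proof (intro exI allI impI)
      fix n assume "j \<le> n"
      then show "norm (x n - x j) \<le> 2 * s j" using dist2[of j "n - j"] by simp
    qed
  qed
  then show ?thesis using l by (auto simp: s_def)
qed

text \<open>The residual component missed by the previous step is kept apart. For perturbed data it
  need not vanish and gives a linear contraction only; for exact data it turns out to be of the
  order of the step, which makes the whole bound quadratic.\<close>

lemma trunc_newton_step:
  assumes def0: "rank_projection_defined r J0"
    and c: "norm (trunc_pinv r J1) \<le> c"
      "norm (trunc_range_proj r J1 - trunc_range_proj r J0 ** trunc_range_proj r J1) \<le> c * norm (J1 - J0)"
    and h: "h = - (trunc_pinv r J0 *v f0)"
    and L: "norm (J1 - J0) \<le> L * norm h" "norm (f1 - f0 - J0 *v h) \<le> L * (norm h)\<^sup>2"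
  shows "norm (trunc_pinv r J1 *v f1)
    \<le> c * (c * L * norm (f0 - trunc_range_proj r J0 *v f0) + L * norm h) * norm h"
proof -
  let ?P0 = "trunc_range_proj r J0" and ?P1 = "trunc_range_proj r J1" and ?G1 = "trunc_pinv r J1"
  define u where "u = f0 - ?P0 *v f0"
  define e where "e = f1 - f0 - J0 *v h"
  have c0: "c \<ge> 0" using c(1) norm_ge_zero order_trans by blast
  have "J0 *v h = - (?P0 *v f0)"
    using mult_trunc_pinv[OF def0] by (simp add: h vec.neg matrix_vector_mul_assoc)
  then have f1: "f1 = u + e" by (simp add: u_def e_def)
  have "?P0 *v u = 0"
    using trunc_range_proj_idem[of r J0]
    by (simp add: u_def matrix_vector_mult_diff_distrib matrix_vector_mul_assoc)
  \<comment> \<open>The angle estimate controls \<open>?P1 - ?P0 ** ?P1\<close>; its conjugate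
    transpose, of the same norm, is what acts on \<open>u\<close>.\<close>
  then have "?P1 *v u = ct (?P1 - ?P0 ** ?P1) *v u"
    by (simp add: ct_diff ct_mult trunc_range_proj_ct matrix_vector_mult_diff_rdistrib
        matrix_vector_mul_assoc[symmetric])
  then have "norm (?P1 *v u) \<le> norm (?P1 - ?P0 ** ?P1) * norm u"
    using norm_matrix_vector_mult_le[of "ct (?P1 - ?P0 ** ?P1)" u] by simp
  also have "\<dots> \<le> c * (L * norm h) * norm u"
    using c(2) mult_left_mono[OF L(1) c0] by (intro mult_right_mono) auto
  finally have P1u: "norm (?P1 *v u) \<le> c * (L * norm h) * norm u" .
  have "?G1 *v f1 = ?G1 *v (?P1 *v u) + ?G1 *v e"
    using trunc_pinv_range_proj[of r J1]
    by (simp add: f1 matrix_vector_right_distrib matrix_vector_mul_assoc)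
  then have "norm (?G1 *v f1) \<le> norm ?G1 * norm (?P1 *v u) + norm ?G1 * norm e"
    using norm_triangle_ineq[of "?G1 *v (?P1 *v u)" "?G1 *v e"]
      norm_matrix_vector_mult_le[of ?G1 "?P1 *v u"] norm_matrix_vector_mult_le[of ?G1 e] by simp
  also have "\<dots> \<le> c * (c * (L * norm h) * norm u) + c * (L * (norm h)\<^sup>2)"
    using c(1) c0 P1u L(2) by (intro add_mono mult_mono) (auto simp: e_def)
  finally show ?thesis by (simp add: u_def algebra_simps power2_eq_square)
qed

lemma trunc_newton_converges:
  fixes f :: "complex^'b \<Rightarrow> complex^'a" and J :: "complex^'b \<Rightarrow> complex^'b^'a"
  assumes pos: "c > 0" "L > 0"
    and near: "\<And>x. norm (x - xs) < \<rho> \<Longrightarrow> rank_projection_defined r (J x) \<and>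
        norm (trunc_pinv r (J x)) \<le> c \<and> norm (rank_projection r (J x)) \<le> c \<and> norm (f x) \<le> \<eta>"
    and sin: "\<And>x y. norm (x - xs) < \<rho> \<Longrightarrow> norm (y - xs) < \<rho> \<Longrightarrow>
        norm (trunc_range_proj r (J y) - trunc_range_proj r (J x) ** trunc_range_proj r (J y))
        \<le> c * norm (J y - J x)"
    and lip: "\<And>x y. norm (J y - J x) \<le> L * norm (y - x)"
    and tay: "\<And>x y. norm (f y - f x - J x *v (y - x)) \<le> L * (norm (y - x))\<^sup>2"
    and small: "4 * c\<^sup>2 * L * \<eta> \<le> 1"
    and start: "norm (x0 - xs) < \<rho> / 2" "4 * c * norm (f x0) < \<rho>"
  defines "x \<equiv> trunc_newton r f J x0"
  shows "\<exists>xt. x \<longlonglongrightarrow> xt \<and> norm (xt - xs) < \<rho> \<and> trunc_range_proj r (J xt) *v f xt = 0 \<and>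
    (\<forall>j. norm (x j - xs) < \<rho> \<and> norm (xt - x j) \<le> 2 * norm (x (Suc j) - x j) \<and>
      norm (trunc_range_proj r (J (x j)) *v f (x j)) \<le> c * norm (x (Suc j) - x j) \<and>
      norm (x (Suc (Suc j)) - x (Suc j)) \<le>
        c * (c * L * norm (f (x j)) + L * norm (x (Suc j) - x j)) * norm (x (Suc j) - x j))"
proof -
  define s where "s j = norm (x (Suc j) - x j)" for j
  have xS: "x (Suc j) = x j - trunc_pinv r (J (x j)) *v f (x j)" for j by (simp add: x_def)
  have h: "x (Suc j) - x j = - (trunc_pinv r (J (x j)) *v f (x j))" for j by (simp add: xS)
  have sG: "s j = norm (trunc_pinv r (J (x j)) *v f (x j))" for j by (simp add: s_def xS)
  have sf: "s j \<le> c * norm (f (x j))" if "norm (x j - xs) < \<rho>" for j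
  proof -
    have "s j \<le> norm (trunc_pinv r (J (x j))) * norm (f (x j))"
      unfolding sG by (rule norm_matrix_vector_mult_le)
    also have "\<dots> \<le> c * norm (f (x j))" using near[OF that] by (intro mult_right_mono) auto
    finally show ?thesis .
  qed
  have quad: "s (Suc j) \<le> c * (c * L * norm (f (x j)) + L * s j) * s j"
    if "norm (x j - xs) < \<rho>" "norm (x (Suc j) - xs) < \<rho>" for j
  proof -
    have "s (Suc j) \<le> c * (c * L * norm (f (x j) - trunc_range_proj r (J (x j)) *v f (x j)) + L * s j) * s j"
      unfolding sG[of "Suc j"] unfolding s_def
      by (rule trunc_newton_step[OF _ _ sin h lip tay]) (use near that in auto)
    also have "\<dots> \<le> c * (c * L * norm (f (x j)) + L * s j) * s j"
      using pos by (intro mult_right_mono mult_left_mono add_right_mono trunc_range_proj_norm)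
        (auto simp: s_def)
    finally show ?thesis .
  qed
  have half: "s (Suc j) \<le> s j / 2"
    if "norm (x j - xs) < \<rho>" "norm (x (Suc j) - xs) < \<rho>" for j
  proof -
    have f: "norm (f (x j)) \<le> \<eta>" using near that by blast
    have "s j \<le> c * \<eta>" using sf[OF that(1)] mult_left_mono[OF f, of c] pos(1) by linarith
    then have "c * L * norm (f (x j)) + L * s j \<le> c * L * \<eta> + L * (c * \<eta>)"
      using f pos by (intro add_mono mult_left_mono) auto
    then have "c * (c * L * norm (f (x j)) + L * s j) \<le> c * (c * L * \<eta> + L * (c * \<eta>))"
      using pos by (intro mult_left_mono) auto
    \<comment> \<open>Both summands equal \<open>c\<^sup>2 * L * \<eta>\<close>, which explains the
      factor 4 in \<open>small\<close>.\<close>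
    also have "\<dots> \<le> 1 / 2" using small by (simp add: power2_eq_square algebra_simps)
    finally have "c * (c * L * norm (f (x j)) + L * s j) * s j \<le> 1 / 2 * s j"
      by (intro mult_right_mono) (auto simp: s_def)
    then show ?thesis using quad[OF that] by simp
  qed
  have \<rho>: "\<rho> > 0" using start(1) norm_ge_zero[of "x0 - xs"] by linarith
  have x0: "x 0 = x0" by (simp add: x_def)
  have s0: "s 0 < \<rho> / 4" using sf[of 0] start \<rho> by (simp add: x0)
  \<comment> \<open>The start is within \<open>\<rho> / 2\<close> of the centre and all steps
    together are at most \<open>2 * s 0\<close>, below \<open>\<rho> / 2\<close>. The position bound
    comes first in each induction step, because halving needs both iterates in the ball.\<close>
  have inv: "norm (x j - xs) \<le> norm (x0 - xs) + 2 * (1 - (1 / 2) ^ j) * s 0 \<and> s j \<le> (1 / 2) ^ j * s 0" for j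
  proof -
    have less: "norm (x0 - xs) + 2 * (1 - (1 / 2) ^ j) * s 0 < \<rho>" for j
    proof -
      have "2 * (1 - (1 / 2) ^ j) * s 0 \<le> 2 * s 0"
        by (intro mult_right_mono) (auto simp: s_def)
      then show ?thesis using s0 start by linarith
    qed
    show ?thesis
    proof (induction j)
      case 0
      show ?case by (simp add: x0)
    next
      case (Suc j)
      have "norm (x (Suc j) - xs) \<le> norm (x j - xs) + s j"
        using norm_triangle_ineq[of "x j - xs" "x (Suc j) - x j"] by (simp add: s_def)
      then have 1: "norm (x (Suc j) - xs) \<le> norm (x0 - xs) + 2 * (1 - (1 / 2) ^ Suc j) * s 0"
        using Suc by (simp add: algebra_simps)
      have "s (Suc j) \<le> s j / 2"
        by (rule half) (use Suc 1 less[of j] less[of "Suc j"] in linarith)+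
      then have "s (Suc j) \<le> (1 / 2) ^ Suc j * s 0" using Suc by simp
      then show ?case using 1 by blast
    qed
  qed
  have in_ball: "norm (x j - xs) < \<rho>" for j
  proof -
    have "2 * (1 - (1 / 2) ^ j) * s 0 \<le> 2 * s 0"
      by (intro mult_right_mono) (auto simp: s_def)
    then show ?thesis using inv[of j] s0 start by linarith
  qed
  have "\<exists>l. x \<longlonglongrightarrow> l \<and> (\<forall>j. norm (l - x j) \<le> 2 * norm (x (Suc j) - x j))"
    by (rule halving_steps_converge) (use half[OF in_ball in_ball] in \<open>simp add: s_def\<close>)
  then obtain xt where xt: "x \<longlonglongrightarrow> xt" "\<And>j. norm (xt - x j) \<le> 2 * s j"
    by (auto simp: s_def)
  have xt_ball: "norm (xt - xs) < \<rho>"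
    using norm_triangle_ineq[of "xt - x 0" "x 0 - xs"] xt(2)[of 0] s0 start x0 by simp
  let ?P = "\<lambda>y. trunc_range_proj r (J y)"
  have Pf: "norm (?P (x j) *v f (x j)) \<le> c * s j" for j
  proof -
    have "?P (x j) *v f (x j) = rank_projection r (J (x j)) *v (trunc_pinv r (J (x j)) *v f (x j))"
      by (simp add: trunc_range_proj_def matrix_vector_mul_assoc)
    then have "norm (?P (x j) *v f (x j)) \<le> norm (rank_projection r (J (x j))) * s j"
      by (simp only: norm_matrix_vector_mult_le sG)
    also have "\<dots> \<le> c * s j" using near[OF in_ball[of j]] by (intro mult_right_mono) (auto simp: s_def)
    finally show ?thesis .
  qed
  \<comment> \<open>The residual at the limit splits into the change of \<open>f\<close>, the part
    missed at the \<open>j\<close>-th step, which \<open>?P xt\<close> nearly annihilates, and the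
    part seen there, of the size of the step. All three bounds tend to zero.\<close>
  have bound: "norm (?P xt *v f xt) \<le> norm (f (x j) - f xt) + c * (L * norm (x j - xt)) * \<eta> + c * s j" for j
  proof -
    let ?u = "f (x j) - ?P (x j) *v f (x j)"
    have "?P (x j) *v ?u = 0"
      using trunc_range_proj_idem[of r "J (x j)"]
      by (simp add: matrix_vector_mult_diff_distrib matrix_vector_mul_assoc)
    then have "?P xt *v ?u = ct (?P xt - ?P (x j) ** ?P xt) *v ?u"
      by (simp add: ct_diff ct_mult trunc_range_proj_ct matrix_vector_mult_diff_rdistrib
          matrix_vector_mul_assoc[symmetric])
    then have "norm (?P xt *v ?u) \<le> norm (?P xt - ?P (x j) ** ?P xt) * norm ?u"
      using norm_matrix_vector_mult_le[of "ct (?P xt - ?P (x j) ** ?P xt)" ?u] by simp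
    also have "\<dots> \<le> c * (L * norm (x j - xt)) * \<eta>"
    proof (rule mult_mono)
      have "c * norm (J xt - J (x j)) \<le> c * (L * norm (xt - x j))"
        using pos lip by (intro mult_left_mono) auto
      then show "norm (?P xt - ?P (x j) ** ?P xt) \<le> c * (L * norm (x j - xt))"
        using sin[OF in_ball xt_ball, of j] by (simp add: norm_minus_commute)
      show "norm ?u \<le> \<eta>"
        using trunc_range_proj_norm(2)[of "f (x j)" r "J (x j)"] near[OF in_ball[of j]] by linarith
    qed (use pos in auto)
    finally have 1: "norm (?P xt *v ?u) \<le> c * (L * norm (x j - xt)) * \<eta>" .
    have 2: "norm (?P xt *v (f xt - f (x j))) \<le> norm (f (x j) - f xt)"
      using trunc_range_proj_norm(1)[of r "J xt" "f xt - f (x j)"] by (simp add: norm_minus_commute)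
    have 3: "norm (?P xt *v (?P (x j) *v f (x j))) \<le> c * s j"
      using trunc_range_proj_norm(1)[of r "J xt" "?P (x j) *v f (x j)"] Pf[of j] by linarith
    have "?P xt *v f xt = ?P xt *v (f xt - f (x j)) + ?P xt *v ?u + ?P xt *v (?P (x j) *v f (x j))"
      by (simp add: matrix_vector_mult_diff_distrib)
    then have "norm (?P xt *v f xt) \<le> norm (?P xt *v (f xt - f (x j))) + norm (?P xt *v ?u)
        + norm (?P xt *v (?P (x j) *v f (x j)))"
      by (simp only:) (rule order_trans[OF norm_triangle_ineq add_right_mono[OF norm_triangle_ineq]])
    then show ?thesis using 1 2 3 by linarith
  qed
  have x_xt: "(\<lambda>j. norm (x j - xt)) \<longlonglongrightarrow> 0"
    using xt(1) by (simp add: LIM_zero_iff tendsto_norm_zero_iff)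
  have lim_f: "(\<lambda>j. norm (f (x j) - f xt)) \<longlonglongrightarrow> 0"
  proof (rule tendsto_sandwich[OF _ _ tendsto_const])
    show "\<forall>\<^sub>F j in sequentially. norm (f (x j) - f xt) \<le> L * (norm (x j - xt))\<^sup>2 + norm (J xt) * norm (x j - xt)"
    proof (intro always_eventually allI)
      fix j
      have "norm (f (x j) - f xt) \<le> norm (f (x j) - f xt - J xt *v (x j - xt)) + norm (J xt *v (x j - xt))"
        using norm_triangle_ineq[of "f (x j) - f xt - J xt *v (x j - xt)" "J xt *v (x j - xt)"] by simp
      then show "norm (f (x j) - f xt) \<le> L * (norm (x j - xt))\<^sup>2 + norm (J xt) * norm (x j - xt)"
        using tay[where x = xt and y = "x j"] norm_matrix_vector_mult_le[of "J xt" "x j - xt"] by linarith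
    qed
    have "(\<lambda>j. L * (norm (x j - xt))\<^sup>2 + norm (J xt) * norm (x j - xt)) \<longlonglongrightarrow> L * 0\<^sup>2 + norm (J xt) * 0"
      by (intro tendsto_intros x_xt)
    then show "(\<lambda>j. L * (norm (x j - xt))\<^sup>2 + norm (J xt) * norm (x j - xt)) \<longlonglongrightarrow> 0" by simp
  qed auto
  have lim_s: "s \<longlonglongrightarrow> 0"
  proof -
    have "(\<lambda>j. norm (x (Suc j) - x j)) \<longlonglongrightarrow> norm (xt - xt)"
      by (intro tendsto_intros xt(1) LIMSEQ_Suc)
    then show ?thesis unfolding s_def by simp
  qed
  have "(\<lambda>j. norm (f (x j) - f xt) + c * (L * norm (x j - xt)) * \<eta> + c * s j) \<longlonglongrightarrow> 0 + c * (L * 0) * \<eta> + c * 0"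
    by (intro tendsto_intros lim_f x_xt lim_s)
  then have "norm (?P xt *v f xt) \<le> 0 + c * (L * 0) * \<eta> + c * 0"
    by (rule LIMSEQ_le_const) (use bound in blast)
  then have "?P xt *v f xt = 0" by simp
  then show ?thesis
    using xt xt_ball in_ball Pf quad[OF in_ball in_ball] unfolding s_def by blast
qed

text \<open>Being orthogonal to the kernel, \<open>d\<close> is recovered from
  \<open>Jz *v d\<close> by the pseudoinverse. The projection at the iterate retains at least half
  of \<open>Jz *v d\<close>, which differs from \<open>fq'\<close> by \<open>\<tau>\<close> and a
  quadratic remainder; smallness of \<open>d\<close> absorbs the remainder.\<close>

lemma distance_to_zero_set:
  assumes rank: "rank Jz = r" and c: "norm (pinv Jz) \<le> c" and c0: "c > 0"
    and orth: "\<And>u. Jz *v u = 0 \<Longrightarrow> d \<bullet> u = 0"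
    and tay: "norm (fq - Jz *v d) \<le> L * (norm d)\<^sup>2"
    and tau: "norm (fq' - fq) \<le> \<tau>"
    and sin: "norm (trunc_range_proj r Jz - trunc_range_proj r J' ** trunc_range_proj r Jz) \<le> 1 / 2"
    and small: "4 * c * L * norm d \<le> 1"
  shows "norm d \<le> 4 * c * (norm (trunc_range_proj r J' *v fq') + \<tau>)"
proof -
  let ?P' = "trunc_range_proj r J'" and ?Q = "pinv Jz ** Jz"
  note Q = is_pinvD[OF is_pinv_pinv[of Jz]]
  define v where "v = Jz *v d"
  have Pz: "trunc_range_proj r Jz = Jz ** pinv Jz"
    using rank_projection_eq_self[OF rank] by (simp add: trunc_range_proj_def trunc_pinv_def)
  have Pzv: "trunc_range_proj r Jz *v v = v"
    by (simp add: Pz v_def matrix_vector_mul_assoc Q)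
  \<comment> \<open>The kernel component of \<open>d\<close> is orthogonal to \<open>d\<close> by
    hypothesis and to \<open>?Q *v d\<close> by self-adjointness, hence to itself.\<close>
  have "d - ?Q *v d = 0"
  proof -
    let ?u = "d - ?Q *v d"
    have "Jz *v ?u = 0"
      using Q(1) by (simp add: matrix_vector_mult_diff_distrib matrix_vector_mul_assoc matrix_mul_assoc)
    then have du: "d \<bullet> ?u = 0" by (rule orth)
    have "?Q *v ?u = 0"
      by (simp add: matrix_vector_mult_diff_distrib matrix_vector_mul_assoc Q(6))
    then have "(?Q *v d) \<bullet> ?u = 0"
      unfolding inner_matrix_vector_ct Q(4) by simp
    then have "?u \<bullet> ?u = 0" using du by (simp add: inner_diff_left)
    then show ?thesis by simp
  qed
  then have "d = pinv Jz *v v" by (simp add: v_def matrix_vector_mul_assoc)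
  then have "norm d = norm (pinv Jz *v v)" by (rule arg_cong)
  also have "\<dots> \<le> norm (pinv Jz) * norm v" by (rule norm_matrix_vector_mult_le)
  also have "\<dots> \<le> c * norm v" using c by (intro mult_right_mono) auto
  finally have dv: "norm d \<le> c * norm v" .
  have "v - ?P' *v v = (trunc_range_proj r Jz - ?P' ** trunc_range_proj r Jz) *v v"
    by (simp add: matrix_vector_mult_diff_rdistrib matrix_vector_mul_assoc[symmetric] Pzv)
  then have "norm (v - ?P' *v v) \<le> norm (trunc_range_proj r Jz - ?P' ** trunc_range_proj r Jz) * norm v"
    by (simp only: norm_matrix_vector_mult_le)
  also have "\<dots> \<le> 1 / 2 * norm v" using sin by (intro mult_right_mono) auto
  finally have half: "norm (v - ?P' *v v) \<le> 1 / 2 * norm v" .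
  have "norm (fq' - v) \<le> \<tau> + L * (norm d)\<^sup>2"
    using norm_triangle_ineq[of "fq' - fq" "fq - v"] tau tay by (simp add: v_def)
  then have "norm (?P' *v (fq' - v)) \<le> \<tau> + L * (norm d)\<^sup>2"
    using trunc_range_proj_norm(1)[of r J' "fq' - v"] by linarith
  moreover have "norm (?P' *v v) \<le> norm (?P' *v fq') + norm (?P' *v (fq' - v))"
    using norm_triangle_ineq4[of "?P' *v fq'" "?P' *v (fq' - v)"]
    by (simp add: matrix_vector_mult_diff_distrib)
  moreover have "norm v \<le> norm (v - ?P' *v v) + norm (?P' *v v)"
    using norm_triangle_ineq[of "v - ?P' *v v" "?P' *v v"] by simp
  ultimately have "norm v \<le> 2 * (norm (?P' *v fq') + \<tau> + L * (norm d)\<^sup>2)"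
    using half by simp
  then have "c * norm v \<le> c * (2 * (norm (?P' *v fq') + \<tau> + L * (norm d)\<^sup>2))"
    using c0 by (intro mult_left_mono) auto
  also have "\<dots> = 2 * c * (norm (?P' *v fq') + \<tau>) + 1 / 2 * (4 * c * L * norm d * norm d)"
    by (simp add: algebra_simps power2_eq_square)
  also have "4 * c * L * norm d * norm d \<le> 1 * norm d"
    by (rule mult_right_mono[OF small]) simp
  finally have "c * norm v \<le> 2 * c * (norm (?P' *v fq') + \<tau>) + 1 / 2 * norm d" by simp
  then show ?thesis using dv by linarith
qed

text \<open>The geometry of the zero set enters only through \<open>foot\<close>, which gives for
  each nearby point a zero from which it is reached orthogonally to the kernel. The error is
  measured from such a zero; \<open>xs\<close> only marks where the iteration starts.\<close>

theorem rank_newton_nonisolated: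
  fixes f :: "'g::real_normed_vector \<Rightarrow> complex^'b \<Rightarrow> complex^'a"
    and J :: "'g \<Rightarrow> complex^'b \<Rightarrow> complex^'b^'a"
  assumes L: "L > 0"
    and lip: "\<And>G H x y. norm (J G x - J H y) \<le> L * (norm (G - H) + norm (x - y))"
    and tay: "\<And>G x y. norm (f G y - f G x - J G x *v (y - x)) \<le> L * (norm (y - x))\<^sup>2"
    and par: "\<And>G H x. norm (f G x - f H x) \<le> L * norm (G - H) * norm x"
    and zero: "f A xs = 0" and rank: "rank (J A xs) = r"
    and \<rho>0: "\<rho>0 > 0"
    and foot: "\<forall>x. norm (x - xs) < \<rho>0 \<longrightarrow> (\<exists>z\<in>T. f A z = 0 \<and> rank (J A z) = r \<and>
        (\<forall>u. J A z *v u = 0 \<longrightarrow> (x - z) \<bullet> u = 0) \<and> norm (z - xs) \<le> 2 * norm (x - xs))"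
    and \<rho>: "\<rho> > 0"
  shows "\<exists>\<delta>>0. \<exists>K. \<forall>H x0. norm (A - H) < \<delta> \<longrightarrow> norm (x0 - xs) < \<delta> \<longrightarrow>
    (\<forall>j. rank_projection_defined r (J H (trunc_newton r (f H) (J H) x0 j))) \<and>
    (\<exists>xt. trunc_newton r (f H) (J H) x0 \<longlonglongrightarrow> xt \<and>
      (\<exists>z\<in>T. norm (z - xs) < \<rho> \<and> norm (xt - z) \<le> K * norm (A - H)) \<and>
      (H = A \<longrightarrow> quadratically_tendsto (trunc_newton r (f H) (J H) x0) xt))"
proof -
  define B where "B = J A xs"
  obtain \<epsilon> c where e: "\<epsilon> > 0" and c: "c > 0"
    and near: "\<And>M. norm (M - B) < \<epsilon> \<Longrightarrow> rank_projection_defined r M \<and>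
      norm (trunc_pinv r M) \<le> c \<and> norm (rank_projection r M) \<le> c"
    and sin: "\<And>M0 M1. norm (M0 - B) < \<epsilon> \<Longrightarrow> norm (M1 - B) < \<epsilon> \<Longrightarrow>
      norm (trunc_range_proj r M1 - trunc_range_proj r M0 ** trunc_range_proj r M1) \<le> c * norm (M1 - M0)"
    using rank_projection_near[OF rank, folded B_def] by metis
  define M where "M = norm B + L + L * (norm xs + 1)"
  have M: "M > 0" using L by (simp add: M_def add_pos_nonneg add_nonneg_pos)
  \<comment> \<open>In turn: foot points exist; norms are bounded; foot points stay within
    \<open>\<rho>\<close>; Jacobians at iterates and at foot points, up to
    \<open>2 * \<rho>1\<close> away, stay in the good neighbourhood of \<open>B\<close>; angle and
    remainder suit the distance estimate; residuals of size \<open>M * \<rho>1\<close> allow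
    halving.\<close>
  define \<rho>1 where "\<rho>1 = min (min \<rho>0 (min 1 (\<rho> / 4))) (min (\<epsilon> / (4 * L)) (min (1 / (12 * c * L)) (1 / (4 * c\<^sup>2 * L * M))))"
  have r1: "\<rho>1 > 0" using \<rho>0 \<rho> e c L M by (simp add: \<rho>1_def)
  have r1_le: "\<rho>1 \<le> \<rho>0" "\<rho>1 \<le> 1" "4 * \<rho>1 \<le> \<rho>"
    by (simp_all add: \<rho>1_def min_le_iff_disj)
  have "\<rho>1 \<le> \<epsilon> / (4 * L)" by (simp add: \<rho>1_def)
  then have r1_e: "4 * (L * \<rho>1) \<le> \<epsilon>" using L by (simp add: field_simps)
  have "\<rho>1 \<le> 1 / (12 * c * L)" by (simp add: \<rho>1_def)
  then have r1_c: "12 * (c * L * \<rho>1) \<le> 1" using L c by (simp add: field_simps)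
  have "\<rho>1 \<le> 1 / (4 * c\<^sup>2 * L * M)" by (simp add: \<rho>1_def)
  then have r1_M: "4 * c\<^sup>2 * L * (M * \<rho>1) \<le> 1" using L c M by (simp add: field_simps)
  \<comment> \<open>The first entry puts the start in the inner half of the ball, the second makes
    \<open>4 * c * norm (f H x0)\<close> less than \<open>\<rho>1\<close>.\<close>
  define \<delta> where "\<delta> = min (\<rho>1 / 2) (\<rho>1 / (8 * c * M))"
  have d: "\<delta> > 0" using r1 c M by (simp add: \<delta>_def)
  have d1: "\<delta> \<le> \<rho>1 / 2" by (simp add: \<delta>_def)
  have "\<delta> \<le> \<rho>1 / (8 * c * M)" by (simp add: \<delta>_def)
  then have d2: "8 * (c * M * \<delta>) \<le> \<rho>1" using c M by (simp add: field_simps)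
  have JB: "norm (J H x - B) \<le> L * (norm (A - H) + norm (x - xs))" for H x
    using lip[of H x A xs] by (simp add: B_def norm_minus_commute)
  have JB_less: "norm (J H x - B) < \<epsilon>" if "norm (A - H) < \<rho>1" "norm (x - xs) \<le> 2 * \<rho>1" for H x
  proof -
    have "L * (norm (A - H) + norm (x - xs)) \<le> L * (3 * \<rho>1)"
      using that L by (intro mult_left_mono) auto
    also have "\<dots> < 4 * (L * \<rho>1)" using L r1 by simp
    finally show ?thesis using JB[of H x] r1_e by linarith
  qed
  have f_bound: "norm (f H x) \<le> M * t"
    if "norm (A - H) \<le> t" "norm (x - xs) \<le> t" "t \<le> 1" for H x t
  proof -
    have t0: "t \<ge> 0" using that norm_ge_zero order_trans by blast
    have "norm (f A x) \<le> norm (f A x - f A xs - J A xs *v (x - xs)) + norm (J A xs *v (x - xs))"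
      using norm_triangle_ineq[of "f A x - f A xs - J A xs *v (x - xs)" "J A xs *v (x - xs)"]
      by (simp add: zero)
    also have "\<dots> \<le> L * (norm (x - xs))\<^sup>2 + norm B * norm (x - xs)"
      using norm_matrix_vector_mult_le[of B "x - xs"] by (intro add_mono tay) (simp add: B_def)
    also have "\<dots> \<le> L * t + norm B * t"
    proof (intro add_mono mult_left_mono that)
      have "(norm (x - xs))\<^sup>2 \<le> t\<^sup>2" using that by (intro power_mono) auto
      also have "\<dots> \<le> t" using that(3) t0 by (simp add: power2_eq_square mult_left_le)
      finally show "(norm (x - xs))\<^sup>2 \<le> t" .
    qed (use L in auto)
    finally have 1: "norm (f A x) \<le> L * t + norm B * t" .
    have "norm x \<le> norm xs + 1" using norm_triangle_ineq[of "x - xs" xs] that by simp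
    then have "L * norm (H - A) * norm x \<le> L * t * (norm xs + 1)"
      using L t0 that by (intro mult_mono) (auto simp: norm_minus_commute)
    then have 2: "norm (f H x - f A x) \<le> L * t * (norm xs + 1)" using par[of H x A] by linarith
    have "norm (f H x) \<le> norm (f H x - f A x) + norm (f A x)"
      using norm_triangle_ineq[of "f H x - f A x" "f A x"] by simp
    also have "\<dots> \<le> L * t * (norm xs + 1) + (L * t + norm B * t)" using 1 2 by linarith
    also have "\<dots> = M * t" by (simp add: M_def algebra_simps)
    finally show ?thesis .
  qed
  have near_ball: "rank_projection_defined r (J H x) \<and> norm (trunc_pinv r (J H x)) \<le> c \<and>
      norm (rank_projection r (J H x)) \<le> c \<and> norm (f H x) \<le> M * \<rho>1"
    if "norm (A - H) < \<rho>1" "norm (x - xs) < \<rho>1" for H x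
    using near[OF JB_less[of H x]] f_bound[of H \<rho>1 x] that r1_le r1 by auto
  have dist: "\<exists>z\<in>T. norm (z - xs) < \<rho> \<and> f A z = 0 \<and> norm (J A z) \<le> norm B + \<epsilon> \<and> norm (x - z) \<le> 3 \<and>
      norm (x - z) \<le> 4 * c * (norm (trunc_range_proj r (J H x) *v f H x) + L * (norm xs + 1) * norm (A - H))"
    if H: "norm (A - H) < \<rho>1" and x: "norm (x - xs) < \<rho>1" for H x
  proof -
    obtain z where zT: "z \<in> T" and fz: "f A z = 0" and rz: "rank (J A z) = r"
      and orth: "\<And>u. J A z *v u = 0 \<Longrightarrow> (x - z) \<bullet> u = 0" and z: "norm (z - xs) \<le> 2 * norm (x - xs)"
      using foot[THEN spec, of x] x r1_le by auto
    have xz: "norm (x - z) \<le> 3 * \<rho>1"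
      using norm_triangle_ineq4[of "x - xs" "z - xs"] x z by simp
    have Jz: "norm (J A z - B) < \<epsilon>" using x z r1 by (intro JB_less) auto
    have Jx: "norm (J H x - B) < \<epsilon>" using H x r1 by (intro JB_less) auto
    have pz: "norm (pinv (J A z)) \<le> c"
      using near[OF Jz] rank_projection_eq_self(2)[OF rz] by (simp add: trunc_pinv_def)
    have sin_half: "norm (trunc_range_proj r (J A z) - trunc_range_proj r (J H x) ** trunc_range_proj r (J A z)) \<le> 1 / 2"
    proof -
      have "norm (J A z - J H x) \<le> L * (norm (A - H) + norm (z - x))" by (rule lip)
      also have "\<dots> \<le> L * (4 * \<rho>1)"
        using xz H L by (intro mult_left_mono) (auto simp: norm_minus_commute)
      finally have "c * norm (J A z - J H x) \<le> c * (L * (4 * \<rho>1))"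
        using c by (intro mult_left_mono) auto
      also have "\<dots> \<le> 1 / 2" using r1_c by simp
      finally show ?thesis using sin[OF Jx Jz] by linarith
    qed
    have tay_z: "norm (f A x - J A z *v (x - z)) \<le> L * (norm (x - z))\<^sup>2"
      using tay[of A x z] by (simp add: fz)
    have "norm x \<le> norm xs + 1" using norm_triangle_ineq[of "x - xs" xs] x r1_le by simp
    then have "L * norm (H - A) * norm x \<le> L * norm (H - A) * (norm xs + 1)"
      using L by (intro mult_left_mono) auto
    then have tau: "norm (f H x - f A x) \<le> L * (norm xs + 1) * norm (A - H)"
      using par[of H x A] by (simp add: norm_minus_commute algebra_simps)
    have "4 * c * L * norm (x - z) \<le> 4 * c * L * (3 * \<rho>1)"
      using xz c L by (intro mult_left_mono) auto
    also have "\<dots> = 12 * (c * L * \<rho>1)" by simp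
    finally have small: "4 * c * L * norm (x - z) \<le> 1" using r1_c by linarith
    have "norm (x - z) \<le> 4 * c * (norm (trunc_range_proj r (J H x) *v f H x) + L * (norm xs + 1) * norm (A - H))"
      by (rule distance_to_zero_set[OF rz pz c orth tay_z tau sin_half small])
    moreover have "norm (z - xs) < \<rho>" using z x r1_le r1 by linarith
    moreover have "norm (J A z) \<le> norm B + \<epsilon>"
      using Jz norm_triangle_ineq2[of "J A z" B] by linarith
    ultimately show ?thesis using zT fz xz r1_le by (intro bexI[of _ z]) auto
  qed
  define K where "K = 4 * c * (L * (norm xs + 1))"
  have "(\<forall>j. rank_projection_defined r (J H (trunc_newton r (f H) (J H) x0 j))) \<and>
    (\<exists>xt. trunc_newton r (f H) (J H) x0 \<longlonglongrightarrow> xt \<and>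
      (\<exists>z\<in>T. norm (z - xs) < \<rho> \<and> norm (xt - z) \<le> K * norm (A - H)) \<and>
      (H = A \<longrightarrow> quadratically_tendsto (trunc_newton r (f H) (J H) x0) xt))"
    if H: "norm (A - H) < \<delta>" and x0: "norm (x0 - xs) < \<delta>" for H x0
  proof -
    define x where "x = trunc_newton r (f H) (J H) x0"
    define s where "s j = norm (x (Suc j) - x j)" for j
    have H1: "norm (A - H) < \<rho>1" using H d1 r1 by linarith
    have "norm (f H x0) \<le> M * \<delta>" using H x0 d1 r1_le r1 by (intro f_bound) auto
    then have "4 * c * norm (f H x0) \<le> 4 * c * (M * \<delta>)" using c by (intro mult_left_mono) auto
    then have start: "4 * c * norm (f H x0) < \<rho>1" using d2 r1 by simp
    have lipH: "norm (J H y - J H x) \<le> L * norm (y - x)" for x y using lip[of H y H x] by simp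
    have sinH: "norm (trunc_range_proj r (J H y) - trunc_range_proj r (J H x) ** trunc_range_proj r (J H y))
        \<le> c * norm (J H y - J H x)" if "norm (x - xs) < \<rho>1" "norm (y - xs) < \<rho>1" for x y
      using that r1 by (intro sin JB_less H1) auto
    have "\<exists>xt. x \<longlonglongrightarrow> xt \<and> norm (xt - xs) < \<rho>1 \<and> trunc_range_proj r (J H xt) *v f H xt = 0 \<and>
      (\<forall>j. norm (x j - xs) < \<rho>1 \<and> norm (xt - x j) \<le> 2 * norm (x (Suc j) - x j) \<and>
        norm (trunc_range_proj r (J H (x j)) *v f H (x j)) \<le> c * norm (x (Suc j) - x j) \<and>
        norm (x (Suc (Suc j)) - x (Suc j)) \<le>
          c * (c * L * norm (f H (x j)) + L * norm (x (Suc j) - x j)) * norm (x (Suc j) - x j))"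
      unfolding x_def
      by (rule trunc_newton_converges[OF c L near_ball[OF H1] sinH lipH tay r1_M _ start])
        (use x0 d1 in auto)
    then obtain xt where xt: "x \<longlonglongrightarrow> xt" "norm (xt - xs) < \<rho>1"
        "trunc_range_proj r (J H xt) *v f H xt = 0"
      and ball: "\<And>j. norm (x j - xs) < \<rho>1"
      and dist_xt: "\<And>j. norm (xt - x j) \<le> 2 * s j"
      and Pf: "\<And>j. norm (trunc_range_proj r (J H (x j)) *v f H (x j)) \<le> c * s j"
      and quad: "\<And>j. s (Suc j) \<le> c * (c * L * norm (f H (x j)) + L * s j) * s j"
      unfolding s_def by blast
    obtain z where z: "z \<in> T" "norm (z - xs) < \<rho>" "norm (xt - z) \<le> K * norm (A - H)" and fz: "f A z = 0"
      using dist[OF H1 xt(2)] unfolding xt(3) K_def by (auto simp: mult.assoc)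
    have "quadratically_tendsto x xt" if HA: "H = A"
    proof -
      \<comment> \<open>Without perturbation the error bound reads
        \<open>norm (xt - z) \<le> 0\<close>, so the limit solves the full equation and not only its
        projection.\<close>
      have ft: "f H xt = 0" using z(3) fz HA by simp
      define C where "C = norm B + \<epsilon> + 3 * L"
      have C: "C \<ge> 0" using e L by (simp add: C_def)
      have f_le: "norm (f H y) \<le> C * norm (y - w)"
        if w: "f H w = 0" "norm (J H w) \<le> norm B + \<epsilon>" "norm (y - w) \<le> 3" for y w
      proof -
        have "norm (f H y) \<le> norm (f H y - f H w - J H w *v (y - w)) + norm (J H w *v (y - w))"
          using norm_triangle_ineq[of "f H y - f H w - J H w *v (y - w)" "J H w *v (y - w)"]
          by (simp add: w)
        also have "\<dots> \<le> L * (norm (y - w))\<^sup>2 + norm (J H w) * norm (y - w)"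
          by (intro add_mono tay norm_matrix_vector_mult_le)
        also have "L * (norm (y - w))\<^sup>2 \<le> L * (3 * norm (y - w))"
          unfolding power2_eq_square using L w by (intro mult_left_mono mult_right_mono) auto
        also have "norm (J H w) * norm (y - w) \<le> (norm B + \<epsilon>) * norm (y - w)"
          using w by (intro mult_right_mono) auto
        finally show ?thesis by (simp add: C_def algebra_simps)
      qed
      \<comment> \<open>The distance estimate at the iterate yields a zero \<open>w\<close> within a
        multiple of \<open>s j\<close>; hence the whole residual, including the part missed by the
        step, is of the order of the step.\<close>
      have f_s: "norm (f H (x j)) \<le> C * (4 * c * (c * s j))" for j
      proof -
        obtain w where w: "f A w = 0" "norm (J A w) \<le> norm B + \<epsilon>" "norm (x j - w) \<le> 3"
          "norm (x j - w) \<le> 4 * c * norm (trunc_range_proj r (J H (x j)) *v f H (x j))"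
          using dist[OF H1 ball[of j]] HA by auto
        have "4 * c * norm (trunc_range_proj r (J H (x j)) *v f H (x j)) \<le> 4 * c * (c * s j)"
          using c by (intro mult_left_mono Pf) auto
        then have "C * norm (x j - w) \<le> C * (4 * c * (c * s j))"
          using w(4) C by (intro mult_left_mono) auto
        then show ?thesis using f_le[of w "x j"] w HA by simp
      qed
      define D where "D = c * (c * L * (C * (4 * c * c)) + L)"
      have D: "D \<ge> 0" using c L C by (simp add: D_def)
      have s_quad: "s (Suc j) \<le> D * (s j)\<^sup>2" for j
      proof -
        have s0: "s j \<ge> 0" by (simp add: s_def)
        have "c * (c * L * norm (f H (x j)) + L * s j) * s j
          \<le> c * (c * L * (C * (4 * c * (c * s j))) + L * s j) * s j"
          using c L s0 by (intro mult_right_mono mult_left_mono add_right_mono f_s) auto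
        also have "\<dots> = D * (s j)\<^sup>2" by (simp add: D_def power2_eq_square algebra_simps)
        finally show ?thesis using quad[of j] by linarith
      qed
      \<comment> \<open>The quadratic recursion is one for steps. To pass to errors,
        \<open>dist_xt\<close> bounds the error by the step, and this converse bounds the step by
        the error.\<close>
      have s_le: "s j \<le> c * (C * norm (x j - xt))" for j
      proof -
        have "s j = norm (trunc_pinv r (J H (x j)) *v f H (x j))" by (simp add: s_def x_def)
        also have "\<dots> \<le> norm (trunc_pinv r (J H (x j))) * norm (f H (x j))"
          by (rule norm_matrix_vector_mult_le)
        also have "\<dots> \<le> c * (C * norm (x j - xt))"
        proof (intro mult_mono)
          show "norm (trunc_pinv r (J H (x j))) \<le> c" using near_ball[OF H1 ball] by blast
          have "norm (J H xt - B) < \<epsilon>" using xt(2) r1 by (intro JB_less H1) auto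
          then have "norm (J H xt) \<le> norm B + \<epsilon>" using norm_triangle_ineq2[of "J H xt" B] by linarith
          moreover have "norm (x j - xt) \<le> 3"
            using norm_triangle_ineq4[of "x j - xs" "xt - xs"] ball[of j] xt(2) r1_le by simp
          ultimately show "norm (f H (x j)) \<le> C * norm (x j - xt)" using ft by (intro f_le) auto
        qed (use c in auto)
        finally show ?thesis .
      qed
      have "norm (x (Suc j) - xt) \<le> (2 * D * (c * C)\<^sup>2) * (norm (x j - xt))\<^sup>2" for j
      proof -
        have "norm (x (Suc j) - xt) \<le> 2 * s (Suc j)"
          using dist_xt[of "Suc j"] by (simp add: norm_minus_commute)
        also have "\<dots> \<le> 2 * (D * (s j)\<^sup>2)" using s_quad[of j] by simp
        also have "\<dots> \<le> 2 * (D * (c * (C * norm (x j - xt)))\<^sup>2)"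
          using D s_le[of j] by (intro mult_left_mono power_mono) (auto simp: s_def)
        finally show ?thesis by (simp add: power_mult_distrib algebra_simps)
      qed
      then have "\<forall>\<^sub>F j in sequentially. norm (x (Suc j) - xt) \<le> (2 * D * (c * C)\<^sup>2) * (norm (x j - xt))\<^sup>2"
        by (intro always_eventually allI)
      then show ?thesis unfolding quadratically_tendsto_def using xt(1) by blast
    qed
    then show ?thesis using near_ball[OF H1 ball] xt(1) z unfolding x_def by blast
  qed
  then show ?thesis using d by blast
qed

section \<open>The eigenvalue problem in coordinates\<close>

definition eig_f :: "complex^'k^'k \<Rightarrow> complex^'n^'n \<Rightarrow> complex^(unit + 'n \<times> 'k) \<Rightarrow> complex^('n \<times> 'k)" where
  "eig_f S G v = flatten (eig_map S (unflatten_pair v) G)"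

definition eig_J :: "complex^'k^'k \<Rightarrow> complex^'n^'n \<Rightarrow> complex^(unit + 'n \<times> 'k) \<Rightarrow> complex^(unit + 'n \<times> 'k)^('n \<times> 'k)" where
  "eig_J S G v = map_to_matrix (eig_jacobian S (unflatten_pair v) G)"

lemma flatten_diff: "flatten (X - Y) = flatten X - flatten Y"
  by (simp add: Defs.flatten_def vec_eq_iff)

lemma flatten_add: "flatten (X + Y) = flatten X + flatten Y"
  by (simp add: Defs.flatten_def vec_eq_iff)

lemma flatten_eq_0_iff: "flatten X = 0 \<longleftrightarrow> X = 0"
  by (metis norm_eq_zero norm_flatten)

lemma flatten_surj: "\<exists>X. flatten X = w"
  by (rule exI[of _ "\<chi> i j. w $ (i, j)"]) (simp add: Defs.flatten_def vec_eq_iff)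

lemma unflatten_pair_diff: "unflatten_pair (v - w) = unflatten_pair v - unflatten_pair w"
  by (simp add: unflatten_pair_def vec_eq_iff)

lemma unflatten_pair_add: "unflatten_pair (v + w) = unflatten_pair v + unflatten_pair w"
  by (simp add: unflatten_pair_def vec_eq_iff)

lemma unflatten_pair_scale:
  "unflatten_pair (c *s v) = (c * fst (unflatten_pair v), mat c ** snd (unflatten_pair v))"
  by (simp add: unflatten_pair_def vec_eq_iff matrix_matrix_mult_def mat_def
      if_distrib[of "\<lambda>x. x * _"] cong: if_cong)

lemma norm_unflatten_pair: "norm (unflatten_pair v) = norm v"
  by (metis flatten_unflatten_pair norm_flatten_pair)

lemma flatten_pair_diff: "flatten_pair (p - q) = flatten_pair p - flatten_pair q"
  by (metis unflatten_pair_diff flatten_unflatten_pair unflatten_flatten_pair)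

lemma mat_mult_eq: "mat c ** X = (\<chi> i. c *s X $ i)" for X :: "complex^'k^'n"
  by (simp add: vec_eq_iff matrix_matrix_mult_def mat_def if_distrib[of "\<lambda>x. x * _"] cong: if_cong)

lemma mat_mult_commute: "N ** (mat c ** X) = mat c ** (N ** X)" for X :: "complex^'k^'n"
  unfolding mat_mult_eq by (simp add: vec_eq_iff matrix_matrix_mult_def sum_distrib_left algebra_simps)

lemma mat_add: "mat (a + b) = mat a + (mat b :: complex^'n^'n)"
  by (simp add: mat_def vec_eq_iff)

lemma mat_diff: "mat (a - b) = mat a - (mat b :: complex^'n^'n)"
  by (simp add: mat_def vec_eq_iff)

lemma mat_0 [simp]: "mat 0 = (0 :: complex^'n^'n)"
  by (simp add: mat_def vec_eq_iff)

lemma mat_mult_mat: "mat (a * b) ** X = mat a ** (mat b ** X)" for X :: "complex^'k^'n"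
  by (simp add: mat_mult_eq vec_eq_iff mult.assoc)

lemma flatten_scale: "flatten (mat c ** X) = c *s flatten X"
  by (simp add: Defs.flatten_def vec_eq_iff mat_mult_eq)

lemma norm_vector_smult: "norm (c *s x) = norm c * norm x" for x :: "complex^'n"
  by (simp add: norm_vec_def norm_mult L2_set_right_distrib)

lemma norm_mat_mult: "norm (mat c ** X) = norm c * norm X" for X :: "complex^'k^'n"
  by (simp add: mat_mult_eq norm_vec_def[of X] norm_vec_def[of "\<chi> i. c *s X $ i"]
      norm_vector_smult L2_set_right_distrib)

text \<open>On unit vectors the bound controls the columns; adding their norms is crude, but any
  finite constant suffices.\<close>

lemma norm_le_of_operator_bound:
  fixes M :: "complex^'b^'a"
  assumes "\<And>u. norm (M *v u) \<le> K * norm u"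
  shows "norm M \<le> real CARD('b) * K"
proof -
  have "norm (transpose M $ j) \<le> K" for j
  proof -
    have "transpose M $ j = M *v axis j 1"
      by (simp add: vec_eq_iff transpose_def matrix_vector_mult_def axis_def
          if_distrib[of "\<lambda>x. _ * x"] cong: if_cong)
    moreover have "norm (axis j (1 :: complex) :: complex^'b) = 1"
      by (simp add: norm_vec_def L2_set_def axis_def if_distrib[of norm] if_distrib[of "\<lambda>x. x\<^sup>2"] cong: if_cong)
    ultimately show ?thesis using assms[of "axis j 1"] by simp
  qed
  then have "L2_set (\<lambda>j. norm (transpose M $ j)) UNIV \<le> real CARD('b) * K"
    using L2_set_le_sum[of UNIV "\<lambda>j. norm (transpose M $ j)"]
      sum_bounded_above[of UNIV "\<lambda>j. norm (transpose M $ j)" K] by simp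
  then show ?thesis unfolding norm_transpose[of M, symmetric] norm_vec_def[of "transpose M"] .
qed

lemma eig_J_mult:
  fixes S :: "complex^'k^'k" and G :: "complex^'n^'n"
  shows "eig_J S G v *v u = flatten (eig_jacobian S (unflatten_pair v) G (unflatten_pair u))"
proof -
  have "Vector_Spaces.linear (*s) (*s) (\<lambda>u. flatten (eig_jacobian S (unflatten_pair v) G (unflatten_pair u)))"
  proof (intro Vector_Spaces.linear_iff[THEN iffD2] conjI vec.vector_space_axioms allI)
    let ?p = "unflatten_pair v"
    fix x y :: "complex^(unit + 'n \<times> 'k)" and c
    show "flatten (eig_jacobian S ?p G (unflatten_pair (x + y))) =
        flatten (eig_jacobian S ?p G (unflatten_pair x)) + flatten (eig_jacobian S ?p G (unflatten_pair y))"
      unfolding flatten_add[symmetric]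
      by (rule arg_cong[of _ _ flatten])
        (simp add: eig_jacobian_eq unflatten_pair_add matrix_add_ldistrib matrix_add_rdistrib mat_add)
    show "flatten (eig_jacobian S ?p G (unflatten_pair (c *s x))) =
        c *s flatten (eig_jacobian S ?p G (unflatten_pair x))"
      unfolding flatten_scale[symmetric]
      by (simp add: eig_jacobian_eq unflatten_pair_scale matrix_diff_ldistrib mat_mult_mat
          mat_mult_commute[of G] mat_mult_commute[of "mat (fst ?p)" c] matrix_mul_assoc[symmetric])
  qed
  from matrix_works[OF this] show ?thesis
    unfolding eig_J_def map_to_matrix_def .
qed

lemma norm_fst_snd_le: "norm (fst p) \<le> norm p" "norm (snd p) \<le> norm p"
  by (cases p; simp add: norm_Pair real_le_rsqrt)+

lemma eig_J_lipschitz: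
  fixes S :: "complex^'k^'k" and G H :: "complex^'n^'n"
  shows "norm (eig_J S G v - eig_J S H w)
    \<le> 2 * real CARD(unit + 'n \<times> 'k) * (norm (G - H) + norm (v - w))"
proof -
  have "norm ((eig_J S G v - eig_J S H w) *v u) \<le> 2 * (norm (G - H) + norm (v - w)) * norm u" for u
  proof -
    define p where "p = unflatten_pair v - unflatten_pair w"
    define q where "q = unflatten_pair u"
    have p: "norm (fst p) \<le> norm (v - w)" "norm (snd p) \<le> norm (v - w)"
      using norm_fst_snd_le[of p] by (simp_all add: p_def unflatten_pair_diff[symmetric] norm_unflatten_pair)
    have q: "norm (fst q) \<le> norm u" "norm (snd q) \<le> norm u"
      using norm_fst_snd_le[of q] by (simp_all add: q_def norm_unflatten_pair)
    have "(eig_J S G v - eig_J S H w) *v u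
        = flatten ((G - H) ** snd q - mat (fst p) ** snd q - mat (fst q) ** snd p)"
      unfolding matrix_vector_mult_diff_rdistrib eig_J_mult flatten_diff[symmetric] eig_jacobian_eq
      by (rule arg_cong[of _ _ flatten])
        (simp add: p_def q_def matrix_diff_rdistrib matrix_diff_ldistrib mat_diff)
    then have "norm ((eig_J S G v - eig_J S H w) *v u)
        = norm ((G - H) ** snd q - mat (fst p) ** snd q - mat (fst q) ** snd p)"
      by (simp only: norm_flatten)
    also have "\<dots> \<le> norm ((G - H) ** snd q) + norm (mat (fst p) ** snd q) + norm (mat (fst q) ** snd p)"
      by (intro order_trans[OF norm_triangle_ineq4 add_right_mono[OF norm_triangle_ineq4]])
    also have "\<dots> \<le> norm (G - H) * norm u + norm (v - w) * norm u + norm u * norm (v - w)"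
    proof (intro add_mono)
      show "norm ((G - H) ** snd q) \<le> norm (G - H) * norm u"
        using norm_matrix_mult_le[of "G - H" "snd q"] mult_left_mono[OF q(2), of "norm (G - H)"] by simp
      show "norm (mat (fst p) ** snd q) \<le> norm (v - w) * norm u"
        unfolding norm_mat_mult using p q by (intro mult_mono) auto
      show "norm (mat (fst q) ** snd p) \<le> norm u * norm (v - w)"
        unfolding norm_mat_mult using p q by (intro mult_mono) auto
    qed
    also have "\<dots> \<le> 2 * (norm (G - H) + norm (v - w)) * norm u"
      by (simp add: algebra_simps)
    finally show ?thesis .
  qed
  from norm_le_of_operator_bound[OF this] show ?thesis by (simp only: mult.assoc mult.left_commute)
qed

text \<open>The only nonlinear term is the product of eigenvalue and matrix, so the remainder is
  exactly minus the product of the two increments.\<close>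

lemma eig_f_taylor: "norm (eig_f S G w - eig_f S G v - eig_J S G v *v (w - v)) \<le> (norm (w - v))\<^sup>2"
proof -
  define p where "p = unflatten_pair (w - v)"
  have "eig_f S G w - eig_f S G v - eig_J S G v *v (w - v) = flatten (0 - mat (fst p) ** snd p)"
    unfolding eig_f_def eig_J_mult flatten_diff[symmetric] eig_jacobian_eq eig_map_def
    by (rule arg_cong[of _ _ flatten])
      (simp add: p_def unflatten_pair_diff matrix_diff_rdistrib matrix_diff_ldistrib mat_diff)
  then have "norm (eig_f S G w - eig_f S G v - eig_J S G v *v (w - v)) = norm (fst p) * norm (snd p)"
    by (simp add: norm_flatten norm_mat_mult)
  also have "\<dots> \<le> norm (w - v) * norm (w - v)"
    using norm_fst_snd_le[of p] by (intro mult_mono) (auto simp: p_def norm_unflatten_pair)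
  finally show ?thesis by (simp add: power2_eq_square)
qed

lemma eig_f_parameter: "norm (eig_f S G v - eig_f S H v) \<le> norm (G - H) * norm v"
proof -
  have "eig_f S G v - eig_f S H v = flatten ((G - H) ** snd (unflatten_pair v))"
    unfolding eig_f_def flatten_diff[symmetric] eig_map_def
    by (rule arg_cong[of _ _ flatten]) (simp add: matrix_diff_rdistrib)
  then have "norm (eig_f S G v - eig_f S H v) \<le> norm (G - H) * norm (snd (unflatten_pair v))"
    by (simp add: norm_flatten norm_matrix_mult_le)
  also have "\<dots> \<le> norm (G - H) * norm v"
    using norm_fst_snd_le(2)[of "unflatten_pair v"] by (intro mult_left_mono) (auto simp: norm_unflatten_pair)
  finally show ?thesis .
qed

lemma trunc_newton_eq_rank_newton:
  "trunc_newton r (eig_f S G) (eig_J S G) (flatten_pair p) j = flatten_pair (rank_newton r S G p j)"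
proof (induction j)
  case (Suc j)
  then show ?case
    by (simp add: flatten_pair_diff rank_pinv_def eig_f_def eig_J_def trunc_pinv_def
        unflatten_flatten_pair flatten_unflatten_pair)
qed simp

section \<open>The Jacobian on the solution set\<close>

text \<open>Embedded with eigenvalue component zero, so that it can be compared with the kernel of
  the Jacobian inside one space.\<close>

definition sylvester_kernel :: "complex^'n^'n \<Rightarrow> complex^'k^'k \<Rightarrow> (complex^(unit + 'n \<times> 'k)) set" where
  "sylvester_kernel N S = {v. fst (unflatten_pair v) = 0 \<and> N ** snd (unflatten_pair v) = snd (unflatten_pair v) ** S}"

lemma subspace_sylvester_kernel: "vec.subspace (sylvester_kernel N S)"
  unfolding vec.subspace_def sylvester_kernel_def
  by (auto simp: unflatten_pair_add unflatten_pair_scale matrix_add_ldistrib matrix_add_rdistrib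
      mat_mult_commute matrix_mul_assoc[symmetric])
    (simp_all add: unflatten_pair_def vec_eq_iff matrix_matrix_mult_def)

lemma dim_sylvester_kernel:
  fixes N :: "complex^'n^'n" and S :: "complex^'k^'k"
  assumes e: "mat_pow S k *v e \<noteq> 0" "mat_pow S (Suc k) *v e = 0" "Suc k = CARD('k)"
  shows "vec.dim (sylvester_kernel N S) = vec.dim {w. mat_pow N (Suc k) *v w = 0}"
proof -
  define \<psi> where "\<psi> v = snd (unflatten_pair v) *v e" for v :: "complex^(unit + 'n \<times> 'k)"
  have lin: "Vector_Spaces.linear (*s) (*s) \<psi>"
    by (intro Vector_Spaces.linear_iff[THEN iffD2] conjI vec.vector_space_axioms allI)
      (simp_all add: \<psi>_def unflatten_pair_add unflatten_pair_scale matrix_vector_mult_add_rdistrib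
        matrix_vector_mul_assoc[symmetric] mat_vec_mult)
  have inj: "inj_on \<psi> (sylvester_kernel N S)"
  proof (rule inj_onI)
    fix v w assume vw: "v \<in> sylvester_kernel N S" "w \<in> sylvester_kernel N S" "\<psi> v = \<psi> w"
    define X where "X = snd (unflatten_pair v) - snd (unflatten_pair w)"
    have "N ** X = X ** S" "X *v e = 0"
      using vw by (simp_all add: X_def sylvester_kernel_def \<psi>_def matrix_diff_ldistrib
          matrix_diff_rdistrib matrix_vector_mult_diff_rdistrib)
    then have "X = 0" by (rule intertwine_eq_0[OF _ _ e])
    then have "unflatten_pair v = unflatten_pair w"
      using vw by (simp add: X_def sylvester_kernel_def prod_eq_iff)
    then show "v = w" by (metis flatten_unflatten_pair)
  qed
  have "\<psi> ` sylvester_kernel N S = {w. mat_pow N (Suc k) *v w = 0}"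
  proof (intro equalityI subsetI)
    fix y assume "y \<in> \<psi> ` sylvester_kernel N S"
    then obtain v where v: "v \<in> sylvester_kernel N S" "y = \<psi> v" by blast
    then have "N ** snd (unflatten_pair v) = snd (unflatten_pair v) ** S" by (simp add: sylvester_kernel_def)
    from intertwine_pow[OF this, of "Suc k" e] e(2) v
    show "y \<in> {w. mat_pow N (Suc k) *v w = 0}" by (simp add: \<psi>_def del: mat_pow.simps)
  next
    fix w assume "w \<in> {w. mat_pow N (Suc k) *v w = 0}"
    then obtain X where "N ** X = X ** S" "X *v e = w" using intertwine_exists[OF _ e] by blast
    then show "w \<in> \<psi> ` sylvester_kernel N S"
      by (intro image_eqI[of _ _ "flatten_pair (0, X)"])
        (simp_all add: \<psi>_def sylvester_kernel_def unflatten_flatten_pair)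
  qed
  moreover have "vec.dim (\<psi> ` sylvester_kernel N S) = vec.dim (sylvester_kernel N S)"
    by (rule vec.dim_image_eq[OF lin])
      (unfold vec.span_eq_iff[THEN iffD2, OF subspace_sylvester_kernel], rule inj)
  ultimately show ?thesis by simp
qed

lemma sylvester_kernel_subset_ker:
  assumes "fst (unflatten_pair z) = lam"
  shows "sylvester_kernel (A - mat lam) S \<subseteq> {u. eig_J S A z *v u = 0}"
  using assms
  by (auto simp: sylvester_kernel_def eig_J_mult flatten_eq_0_iff eig_jacobian_eq matrix_diff_rdistrib)

text \<open>The domain has dimension \<open>1 + CARD('n) * CARD('k)\<close> and the kernel always
  contains the Sylvester kernel of dimension \<open>m * CARD('k)\<close>; the difference is
  \<open>r\<close>. The rank drops exactly when the kernel is larger.\<close>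

lemma rank_eig_J:
  fixes A :: "complex^'n^'n" and S :: "complex^'k^'k"
  assumes z: "fst (unflatten_pair z) = lam"
    and dim: "vec.dim (sylvester_kernel (A - mat lam) S) = m * CARD('k)" and m: "m \<le> CARD('n)"
    and r: "r = 1 + (CARD('n) - m) * CARD('k)"
  shows "rank (eig_J S A z) \<le> r"
    and "r \<le> rank (eig_J S A z) \<longleftrightarrow> {u. eig_J S A z *v u = 0} = sylvester_kernel (A - mat lam) S"
proof -
  let ?Ker = "{u. eig_J S A z *v u = 0}" and ?K = "sylvester_kernel (A - mat lam) S"
  have rn: "vec.dim ?Ker + rank (eig_J S A z) = 1 + CARD('n) * CARD('k)"
    using rank_nullity_field[of "eig_J S A z"] by simp
  have sub: "?K \<subseteq> ?Ker" by (rule sylvester_kernel_subset_ker[OF z])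
  have le: "m * CARD('k) \<le> vec.dim ?Ker" using vec.dim_subset[OF sub] dim by simp
  have mk: "m * CARD('k) \<le> CARD('n) * CARD('k)" using m by simp
  have r': "r + m * CARD('k) = 1 + CARD('n) * CARD('k)"
    using mk by (simp add: r diff_mult_distrib)
  show "rank (eig_J S A z) \<le> r" using rn le r' by linarith
  show "r \<le> rank (eig_J S A z) \<longleftrightarrow> ?Ker = ?K"
  proof
    assume "r \<le> rank (eig_J S A z)"
    then have "vec.dim ?Ker \<le> vec.dim ?K" using rn r' dim by linarith
    from vec.subspace_dim_equal[OF subspace_sylvester_kernel subspace_kernel_vec sub this]
    show "?Ker = ?K" by simp
  next
    assume "?Ker = ?K"
    then have "vec.dim ?Ker = m * CARD('k)" using dim by simp
    then show "r \<le> rank (eig_J S A z)" using rn r' by linarith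
  qed
qed

text \<open>The orthogonal decomposition behind the foot point is one for real subspaces.\<close>

lemma subspace_of_complex_subspace:
  fixes V :: "(complex^'n) set"
  assumes "vec.subspace V"
  shows "subspace V"
proof -
  have "c *\<^sub>R x = complex_of_real c *s x" for c and x :: "complex^'n"
    unfolding vec_eq_iff vector_scaleR_component vector_smult_component
    by (simp add: scaleR_conv_of_real)
  then show ?thesis using assms unfolding Real_Vector_Spaces.subspace_def vec.subspace_def by simp
qed

definition eig_solutions :: "complex^'n^'n \<Rightarrow> complex \<Rightarrow> complex^'k^'k \<Rightarrow> (complex^(unit + 'n \<times> 'k)) set" where
  "eig_solutions A lam S = {z. fst (unflatten_pair z) = lam \<and>
     (A - mat lam) ** snd (unflatten_pair z) = snd (unflatten_pair z) ** S}"

lemma eig_f_solution: "z \<in> eig_solutions A lam S \<Longrightarrow> eig_f S A z = 0"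
  by (auto simp: eig_solutions_def eig_f_def flatten_eq_0_iff eig_map_def matrix_diff_rdistrib)

text \<open>The solution set is affine with direction space the kernel of the Jacobian, so the foot of the
  perpendicular dropped on it differs from the given point by a vector orthogonal to that kernel.\<close>

lemma eig_foot:
  fixes A :: "complex^'n^'n" and S :: "complex^'k^'k"
  assumes xs: "xs \<in> eig_solutions A lam S" and rank: "rank (eig_J S A xs) = r"
    and dim: "vec.dim (sylvester_kernel (A - mat lam) S) = m * CARD('k)" and m: "m \<le> CARD('n)"
    and r: "r = 1 + (CARD('n) - m) * CARD('k)"
  shows "\<exists>\<rho>>0. \<forall>x. norm (x - xs) < \<rho> \<longrightarrow> (\<exists>z\<in>eig_solutions A lam S. eig_f S A z = 0 \<and>
    rank (eig_J S A z) = r \<and> (\<forall>u. eig_J S A z *v u = 0 \<longrightarrow> (x - z) \<bullet> u = 0) \<and>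
    norm (z - xs) \<le> 2 * norm (x - xs))"
proof -
  let ?K = "sylvester_kernel (A - mat lam) S"
  define L where "L = 2 * real CARD(unit + 'n \<times> 'k)"
  have L: "L > 0" unfolding L_def by (simp add: add_pos_nonneg)
  \<comment> \<open>Lower semicontinuity keeps the rank at \<open>r\<close> for solutions near
    \<open>xs\<close>, so that the kernel at the foot point is again the direction space.\<close>
  obtain \<epsilon> where e: "\<epsilon> > 0" "\<And>B. norm (B - eig_J S A xs) < \<epsilon> \<Longrightarrow> rank (eig_J S A xs) \<le> rank B"
    using rank_lower_semicontinuous[of "eig_J S A xs"] by blast
  have K: "subspace ?K" by (rule subspace_of_complex_subspace[OF subspace_sylvester_kernel])
  have "\<exists>z\<in>eig_solutions A lam S. eig_f S A z = 0 \<and>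
    rank (eig_J S A z) = r \<and> (\<forall>u. eig_J S A z *v u = 0 \<longrightarrow> (x - z) \<bullet> u = 0) \<and>
    norm (z - xs) \<le> 2 * norm (x - xs)" if x: "norm (x - xs) < \<epsilon> / L" for x
  proof -
    obtain y w where y: "y \<in> span ?K" and w: "\<And>u. u \<in> span ?K \<Longrightarrow> orthogonal w u" and yw: "x - xs = y + w"
      by (rule orthogonal_subspace_decomp_exists[of ?K "x - xs"]) blast
    have yK: "y \<in> ?K" using y K by (simp add: span_eq_iff[THEN iffD2])
    define z where "z = xs + y"
    have zT: "z \<in> eig_solutions A lam S"
      using xs yK by (auto simp: z_def eig_solutions_def sylvester_kernel_def unflatten_pair_add
          matrix_add_ldistrib matrix_add_rdistrib)
    have z_fst: "fst (unflatten_pair z) = lam" using zT by (simp add: eig_solutions_def)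
    have "w \<bullet> y = 0" using w[OF y] by (simp add: orthogonal_def)
    then have "(norm (x - xs))\<^sup>2 = (norm y)\<^sup>2 + (norm w)\<^sup>2"
      unfolding yw by (simp add: power2_norm_eq_inner algebra_simps inner_commute)
    then have "(norm y)\<^sup>2 \<le> (norm (x - xs))\<^sup>2" by simp
    then have y_le: "norm y \<le> norm (x - xs)" by (rule power2_le_imp_le) simp
    have "norm (eig_J S A z - eig_J S A xs) \<le> L * norm (z - xs)"
      using eig_J_lipschitz[of S A z A xs] by (simp add: L_def)
    also have "\<dots> \<le> L * norm (x - xs)" using y_le L by (simp add: z_def)
    also have "\<dots> < \<epsilon>" using x L by (simp add: field_simps)
    finally have ge: "r \<le> rank (eig_J S A z)" using e(2) rank by simp
    note J = rank_eig_J[OF z_fst dim m r]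
    have ker: "{u. eig_J S A z *v u = 0} = ?K" using J(2) ge by blast
    have "(x - z) \<bullet> u = 0" if "eig_J S A z *v u = 0" for u
    proof -
      have "u \<in> ?K" using ker that by blast
      then have "w \<bullet> u = 0" using w[OF span_base] by (simp add: orthogonal_def)
      moreover have "x - z = w" using yw by (simp add: z_def algebra_simps)
      ultimately show ?thesis by simp
    qed
    moreover have "norm (z - xs) \<le> 2 * norm (x - xs)"
    proof -
      have "norm (z - xs) = norm y" by (simp add: z_def)
      then show ?thesis using y_le norm_ge_zero[of "x - xs"] by linarith
    qed
    ultimately show ?thesis using zT eig_f_solution[OF zT] J(1) ge by (intro bexI[of _ z]) auto
  qed
  moreover have "\<epsilon> / L > 0" using e L by simp
  ultimately show ?thesis by blast
qed

text \<open>A kernel vector with eigenvalue component c and matrix component U satisfies N U - U S =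
  c X, where X is the matrix part of \<open>z\<close>. If X is outside the range of the Sylvester
  operator, then c = 0 and the vector lies in the Sylvester kernel.\<close>

lemma rank_eig_J_solution:
  fixes A :: "complex^'n^'n" and S :: "complex^'k^'k"
  assumes z: "z \<in> eig_solutions A lam S"
    and dim: "vec.dim (sylvester_kernel (A - mat lam) S) = m * CARD('k)" and m: "m \<le> CARD('n)"
    and r: "r = 1 + (CARD('n) - m) * CARD('k)"
    and notin: "\<nexists>Y. (A - mat lam) ** Y - Y ** S = snd (unflatten_pair z)"
  shows "rank (eig_J S A z) = r"
proof -
  let ?N = "A - mat lam" and ?X = "snd (unflatten_pair z)"
  have z_fst: "fst (unflatten_pair z) = lam" using z by (simp add: eig_solutions_def)
  have "{u. eig_J S A z *v u = 0} \<subseteq> sylvester_kernel ?N S"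
  proof
    fix u assume "u \<in> {u. eig_J S A z *v u = 0}"
    then have u: "?N ** snd (unflatten_pair u) - snd (unflatten_pair u) ** S = mat (fst (unflatten_pair u)) ** ?X"
      by (simp add: eig_J_mult flatten_eq_0_iff eig_jacobian_eq z_fst matrix_diff_rdistrib algebra_simps)
    let ?c = "fst (unflatten_pair u)" and ?U = "snd (unflatten_pair u)"
    have c: "?c = 0"
    proof (rule ccontr)
      assume c: "?c \<noteq> 0"
      have "?N ** (mat (1 / ?c) ** ?U) - (mat (1 / ?c) ** ?U) ** S = mat (1 / ?c) ** (?N ** ?U - ?U ** S)"
        by (simp add: mat_mult_commute[of ?N] matrix_diff_ldistrib matrix_mul_assoc[symmetric])
      also have "\<dots> = mat (1 / ?c * ?c) ** ?X" unfolding u mat_mult_mat ..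
      also have "\<dots> = ?X" using c by simp
      finally show False using notin by blast
    qed
    then show "u \<in> sylvester_kernel ?N S" using u by (simp add: sylvester_kernel_def)
  qed
  then have "{u. eig_J S A z *v u = 0} = sylvester_kernel ?N S"
    using sylvester_kernel_subset_ker[OF z_fst] by blast
  then show ?thesis using rank_eig_J[OF z_fst dim m r] by simp
qed

lemma dim_sylvester_kernel_multiplicity_support:
  fixes A :: "complex^'n^'n" and S :: "complex^('k::{finite,linorder})^('k::{finite,linorder})"
  assumes supp: "multiplicity_support A lam m CARD('k)"
    and S_upper: "\<And>i j. j \<le> i \<Longrightarrow> S $ i $ j = 0"
    and S_superdiag: "\<And>i j. i < j \<Longrightarrow> {i<..<j} = {} \<Longrightarrow> S $ i $ j \<noteq> 0"
  shows "vec.dim (sylvester_kernel (A - mat lam) S) = m * CARD('k)" "m \<le> CARD('n)"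
    and "\<exists>X. (A - mat lam) ** X = X ** S \<and> (\<nexists>Y. (A - mat lam) ** Y - Y ** S = X)"
proof -
  let ?N = "A - mat lam"
  define k where "k = CARD('k) - 1"
  have k: "Suc k = CARD('k)" using zero_less_card_finite[where 'a='k] by (simp add: k_def)
  obtain e where "mat_pow S k *v e \<noteq> 0" "mat_pow S (Suc k) *v e = 0"
    using nilpotent_cyclic_vector[OF S_upper S_superdiag] unfolding k[symmetric] diff_Suc_1 by blast
  note e = this k
  note dims = multiplicity_support_dims[OF supp, folded k]
  show "vec.dim (sylvester_kernel ?N S) = m * CARD('k)"
    unfolding dim_sylvester_kernel[OF e] k[symmetric] dims(3)[OF order_refl] by (rule mult.commute)
  have "vec.dim {v. mat_pow ?N 1 *v v = 0} = 1 * m" by (rule dims(3)) simp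
  moreover have "vec.dim {v. mat_pow ?N 1 *v v = 0} \<le> vec.dim (UNIV :: (complex^'n) set)"
    by (rule vec.dim_subset) simp
  ultimately show "m \<le> CARD('n)" by (simp add: card_cart_basis)
  obtain w where w: "mat_pow ?N (Suc k) *v w = 0" "mat_pow ?N k *v w \<notin> range ((*v) (mat_pow ?N (Suc k)))"
    using exists_maximal_chain[OF dims(3,4)] by blast
  obtain X where X: "?N ** X = X ** S" "X *v e = w" using intertwine_exists[OF w(1) e] by blast
  have "\<nexists>Y. ?N ** Y - Y ** S = X"
  proof
    assume "\<exists>Y. ?N ** Y - Y ** S = X"
    then obtain Y where Y: "?N ** Y - Y ** S = X" by blast
    \<comment> \<open>At \<open>e\<close> the term with the power of \<open>S\<close> vanishes.
      Division by the nonzero number \<open>Suc k\<close> would place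
      \<open>mat_pow ?N k *v w\<close> in the range of the next power, against the choice of
      \<open>w\<close>.\<close>
    have Ye: "mat_pow ?N (Suc k) *v (Y *v e) = of_nat (Suc k) *s (mat_pow ?N k *v w)"
      using sylvester_range_chain[OF X(1) Y, of k e] by (simp only: e(2) X(2) matrix_vector_mult_0_right add_0_left)
    have "mat_pow ?N (Suc k) *v ((1 / of_nat (Suc k)) *s (Y *v e)) =
        (1 / of_nat (Suc k) * of_nat (Suc k)) *s (mat_pow ?N k *v w)"
      by (simp only: vec.scale Ye vec.scale_scale)
    also have "1 / of_nat (Suc k) * of_nat (Suc k) = (1 :: complex)" by (simp del: of_nat_Suc)
    finally have "mat_pow ?N (Suc k) *v ((1 / of_nat (Suc k)) *s (Y *v e)) = mat_pow ?N k *v w"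
      by (simp only: vec.scale_one)
    then have "mat_pow ?N k *v w \<in> range ((*v) (mat_pow ?N (Suc k)))" by (rule range_eqI[OF sym])
    then show False using w(2) by simp
  qed
  then show "\<exists>X. ?N ** X = X ** S \<and> (\<nexists>Y. ?N ** Y - Y ** S = X)" using X by blast
qed

section \<open>Lower bounds near nondegenerate solutions and the final estimate\<close>

lemma complex_matrix_vector_scaleR: "M *v (c *\<^sub>R x) = c *\<^sub>R (M *v x)" for M :: "complex^'b^'a"
  by (simp add: vec_eq_iff matrix_vector_mult_def scaleR_sum_right)

lemma bounded_linear_rank_pinv:
  "bounded_linear (rank_pinv r L :: complex^'k^'n \<Rightarrow> complex \<times> (complex^'k^'n))"
proof -
  have "linear (rank_pinv r L :: complex^'k^'n \<Rightarrow> complex \<times> (complex^'k^'n))"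
    unfolding rank_pinv_def
  proof (rule linearI)
    fix x y :: "complex^'k^'n" and c :: real
    let ?P = "pinv (rank_projection r (map_to_matrix L))"
    show "unflatten_pair (?P *v flatten (x + y)) = unflatten_pair (?P *v flatten x) + unflatten_pair (?P *v flatten y)"
      by (simp add: flatten_add matrix_vector_right_distrib unflatten_pair_add)
    have "flatten (c *\<^sub>R x) = c *\<^sub>R flatten x" by (simp add: Defs.flatten_def vec_eq_iff)
    then show "unflatten_pair (?P *v flatten (c *\<^sub>R x)) = c *\<^sub>R unflatten_pair (?P *v flatten x)"
      by (simp add: complex_matrix_vector_scaleR) (simp add: unflatten_pair_def vec_eq_iff)
  qed
  then show ?thesis by (simp add: linear_conv_bounded_linear)
qed

text \<open>The Jacobian times its pseudoinverse fixes every vector in its range. The resulting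
  lower bound for the condition number permits inserting it as a factor into an error bound that
  lacks it.\<close>

lemma onorm_rank_pinv_ge:
  fixes S :: "complex^'k^'k" and A :: "complex^'n^'n"
  assumes rank: "rank (eig_J S A z) = r" and r: "r > 0"
  shows "1 \<le> norm (eig_J S A z) * onorm (rank_pinv r (eig_jacobian S (unflatten_pair z) A))"
proof -
  let ?J = "eig_J S A z" and ?R = "rank_pinv r (eig_jacobian S (unflatten_pair z) A)"
  have "?J \<noteq> 0"
  proof
    assume "?J = 0"
    then have "range ((*v) ?J) = {0}" by auto
    then have "rank ?J = 0" unfolding rank_eq_dim_range by simp
    then show False using rank r by simp
  qed
  then obtain u where u: "?J *v u \<noteq> 0 *v u" unfolding matrix_eq by blast
  define y where "y = ?J *v u"
  obtain Y where Y: "flatten Y = y" using flatten_surj by blast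
  have "y \<noteq> 0" using u by (simp add: y_def)
  have R: "?R Y = unflatten_pair (pinv ?J *v y)"
    unfolding rank_pinv_def eig_J_def[symmetric] rank_projection_eq_self(2)[OF rank] Y ..
  have "?J *v (pinv ?J *v y) = y"
    by (simp add: y_def matrix_vector_mul_assoc matrix_mul_assoc is_pinvD(1)[OF is_pinv_pinv])
  then have "norm y \<le> norm ?J * norm (pinv ?J *v y)"
    using norm_matrix_vector_mult_le[of ?J "pinv ?J *v y"] by simp
  also have "norm (pinv ?J *v y) = norm (?R Y)" by (simp add: R norm_unflatten_pair)
  also have "\<dots> \<le> onorm ?R * norm Y" by (rule onorm[OF bounded_linear_rank_pinv])
  also have "norm Y = norm y" by (simp add: Y[symmetric] norm_flatten)
  finally have "1 * norm y \<le> (norm ?J * onorm ?R) * norm y" by (simp add: mult_left_mono mult.assoc)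
  then show ?thesis using \<open>y \<noteq> 0\<close> by simp
qed

lemma norm_unflatten_pair_diff: "norm (unflatten_pair v - p) = norm (v - flatten_pair p)"
  by (metis unflatten_flatten_pair unflatten_pair_diff norm_unflatten_pair)

lemma mem_eig_solutions_iff:
  "p \<in> {(lam, X) | X. A ** X - mat lam ** X - X ** S = 0} \<longleftrightarrow> flatten_pair p \<in> eig_solutions A lam S"
  by (cases p) (auto simp: eig_solutions_def unflatten_flatten_pair matrix_diff_rdistrib)

lemma jacobian_projection_defined_iff:
  "jacobian_projection_defined r S p G \<longleftrightarrow> rank_projection_defined r (eig_J S G (flatten_pair p))"
  by (simp add: jacobian_projection_defined_def eig_J_def unflatten_flatten_pair)

text \<open>When the matrix part of \<open>z\<close> lies in the range of the Sylvester operator,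
  adding a small nonzero multiple of \<open>X\<close> leaves the range, while the equation persists
  because \<open>X\<close> is in the kernel.\<close>

lemma eig_solutions_closure:
  fixes A :: "complex^'n^'n" and S :: "complex^'k^'k"
  assumes z: "z \<in> eig_solutions A lam S"
    and X: "(A - mat lam) ** X = X ** S" "\<nexists>Y. (A - mat lam) ** Y - Y ** S = X"
    and e: "e > 0"
  shows "\<exists>w\<in>eig_solutions A lam S. norm (w - z) < e \<and>
    (\<nexists>Y. (A - mat lam) ** Y - Y ** S = snd (unflatten_pair w))"
proof (cases "\<exists>Y. (A - mat lam) ** Y - Y ** S = snd (unflatten_pair z)")
  case False
  then show ?thesis using z e by (intro bexI[of _ z]) auto
next
  case True
  then obtain Y1 where Y1: "(A - mat lam) ** Y1 - Y1 ** S = snd (unflatten_pair z)" by blast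
  define t where "t = e / (2 * (norm X + 1))"
  have nX: "norm X + 1 > 0" by (simp add: add_nonneg_pos)
  have t: "t > 0" using e nX by (simp add: t_def)
  define p where "p = (lam, snd (unflatten_pair z) + t *\<^sub>R X)"
  have lam: "fst (unflatten_pair z) = lam" using z by (simp add: eig_solutions_def)
  have "flatten_pair p \<in> eig_solutions A lam S"
    using z X(1) by (simp add: eig_solutions_def p_def unflatten_flatten_pair matrix_add_ldistrib
        matrix_add_rdistrib matrix_scaleR_right matrix_scaleR_left)
  moreover have "norm (flatten_pair p - z) < e"
  proof -
    have "norm (flatten_pair p - z) = norm (p - unflatten_pair z)"
      using norm_unflatten_pair_diff[of z p] by (simp only: norm_minus_commute)
    also have "p - unflatten_pair z = (0, t *\<^sub>R X)" using lam by (simp add: p_def prod_eq_iff)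
    also have "norm (0 :: complex, t *\<^sub>R X) = t * norm X" using t by (simp add: norm_Pair)
    also have "\<dots> \<le> t * (norm X + 1)" using t by (intro mult_left_mono) auto
    also have "\<dots> = e / 2"
    proof -
      have "e / (2 * g) * g = e / 2" if "g > 0" for g :: real using that by simp
      from this[OF nX] show ?thesis unfolding t_def .
    qed
    also have "\<dots> < e" using e by simp
    finally show ?thesis .
  qed
  moreover have "\<nexists>Y. (A - mat lam) ** Y - Y ** S = snd (unflatten_pair (flatten_pair p))"
  proof
    assume "\<exists>Y. (A - mat lam) ** Y - Y ** S = snd (unflatten_pair (flatten_pair p))"
    then obtain Y where "(A - mat lam) ** Y - Y ** S = snd (unflatten_pair z) + t *\<^sub>R X"
      by (auto simp: unflatten_flatten_pair p_def)
    then have "(A - mat lam) ** (Y - Y1) - (Y - Y1) ** S = t *\<^sub>R X"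
      unfolding matrix_diff_ldistrib matrix_diff_rdistrib[of Y Y1] using Y1 by (simp add: algebra_simps)
    then have "(1 / t) *\<^sub>R ((A - mat lam) ** (Y - Y1) - (Y - Y1) ** S) = X" using t by simp
    then have "(A - mat lam) ** ((1 / t) *\<^sub>R (Y - Y1)) - ((1 / t) *\<^sub>R (Y - Y1)) ** S = X"
      by (simp only: matrix_scaleR_right matrix_scaleR_left scaleR_right_diff_distrib[symmetric])
    then show False using X(2) by blast
  qed
  ultimately show ?thesis by blast
qed

text \<open>At a vanishing matrix part the Jacobian does not see a change of the eigenvalue alone,
  so its kernel is too large. Nonvanishing is what bounds the spectral norm from below.\<close>

lemma eig_solution_nonzero:
  fixes A :: "complex^'n^'n" and S :: "complex^'k^'k"
  assumes "{u. eig_J S A z *v u = 0} = sylvester_kernel (A - mat lam) S"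
  shows "snd (unflatten_pair z) \<noteq> 0"
proof
  assume "snd (unflatten_pair z) = 0"
  then have "flatten_pair (1, 0) \<in> {u. eig_J S A z *v u = 0}"
    by (simp add: eig_J_mult flatten_eq_0_iff eig_jacobian_eq unflatten_flatten_pair)
  then have "flatten_pair (1, 0 :: complex^'k^'n) \<in> sylvester_kernel (A - mat lam) S"
    unfolding assms .
  then show False by (simp add: sylvester_kernel_def unflatten_flatten_pair)
qed

theorem theorem4:
  fixes A :: "complex^'n^'n"
    and S :: "complex^('k::{finite,linorder})^('k::{finite,linorder})"
    and lam :: complex
    and X0 :: "complex^('k::{finite,linorder})^'m \<Rightarrow> complex^('k::{finite,linorder})^'n"
    and Y0 :: "complex^'m^'n"
    and r :: nat
    and Sol :: "(complex \<times> (complex^('k::{finite,linorder})^'n)) set"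
  assumes supp: "multiplicity_support A lam CARD('m) CARD('k)"
    and S_upper: "\<And>i j. j \<le> i \<Longrightarrow> S $ i $ j = 0"
    and S_superdiag: "\<And>i j. i < j \<Longrightarrow> {i<..<j} = {} \<Longrightarrow> S $ i $ j \<noteq> 0"
    and r: "r = 1 + (CARD('n) - CARD('m)) * CARD('k)"
    and Y0: "range ((*v) Y0) = {v. (A - mat lam) *v v = 0}"
    and Sol: "Sol = {(lam, X0 Z + Y0 ** Z) | Z. True}"
    and Sol_eq: "Sol = {(lam, X) | X. A ** X - mat lam ** X - X ** S = 0}"
  shows "Sol \<subseteq> closure {p \<in> Sol. jacobian_projection_defined r S p A} \<and>
    (\<forall>p\<in>Sol. jacobian_projection_defined r S p A \<longrightarrow>
      (\<exists>\<delta>>0. \<exists>\<epsilon>>0. \<exists>\<alpha> K. \<forall>At p0. norm (A - At) < \<delta> \<longrightarrow> norm (p0 - p) < \<epsilon> \<longrightarrow>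
        (\<forall>j. jacobian_projection_defined r S (rank_newton r S At p0 j) At) \<and>
        (\<exists>pt. rank_newton r S At p0 \<longlonglongrightarrow> pt \<and>
          (\<exists>X. (lam, X) \<in> Sol \<and> jacobian_projection_defined r S (lam, X) A \<and>
            norm (pt - (lam, X)) \<le>
              \<alpha> * onorm (rank_pinv r (eig_jacobian S (lam, X) A)) * onorm ((*v) X) * norm (A - At)
              + K * (norm (A - At))\<^sup>2) \<and>
          (At = A \<longrightarrow> quadratically_tendsto (rank_newton r S At p0) pt))))"
proof (intro conjI ballI impI)
  note dims = dim_sylvester_kernel_multiplicity_support[OF supp S_upper S_superdiag]
  have memSol: "p \<in> Sol \<longleftrightarrow> flatten_pair p \<in> eig_solutions A lam S" for p
    unfolding Sol_eq by (rule mem_eig_solutions_iff)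
  show "Sol \<subseteq> closure {p \<in> Sol. jacobian_projection_defined r S p A}"
  proof
    fix p assume "p \<in> Sol"
    then have z: "flatten_pair p \<in> eig_solutions A lam S" by (simp add: memSol)
    obtain X where X: "(A - mat lam) ** X = X ** S" "\<nexists>Y. (A - mat lam) ** Y - Y ** S = X"
      using dims(3) by blast
    show "p \<in> closure {p \<in> Sol. jacobian_projection_defined r S p A}"
      unfolding closure_approachable
    proof (intro allI impI)
      fix e :: real assume "e > 0"
      then obtain w where w: "w \<in> eig_solutions A lam S" "norm (w - flatten_pair p) < e"
        "\<nexists>Y. (A - mat lam) ** Y - Y ** S = snd (unflatten_pair w)"
        using eig_solutions_closure[OF z X] by blast
      have "rank_projection_defined r (eig_J S A w)"
        by (rule rank_projection_eq_self(1)[OF rank_eig_J_solution[OF w(1) dims(1,2) r w(3)]])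
      then show "\<exists>y\<in>{p \<in> Sol. jacobian_projection_defined r S p A}. dist y p < e"
        using w(1,2) by (intro bexI[of _ "unflatten_pair w"])
          (simp_all add: memSol jacobian_projection_defined_iff flatten_unflatten_pair dist_norm
            norm_unflatten_pair_diff)
    qed
  qed
  fix p assume p: "p \<in> Sol" and defd: "jacobian_projection_defined r S p A"
  define xs where "xs = flatten_pair p"
  have xs: "xs \<in> eig_solutions A lam S" using p by (simp add: xs_def memSol)
  then have xs_fst: "fst (unflatten_pair xs) = lam" by (simp add: eig_solutions_def)
  note rk = rank_eig_J[OF xs_fst dims(1,2) r]
  \<comment> \<open>A defined projection forces rank at least \<open>r\<close>, which is also the
    upper bound on the solution set; so \<open>defd\<close> selects exactly the nondegenerate
    solutions.\<close>
  have rank_ge: "r \<le> rank (eig_J S A xs)"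
    using rank_projection_rank_le[OF rank_projection_is] defd
    by (simp add: jacobian_projection_defined_iff xs_def)
  have ker: "{u. eig_J S A xs *v u = 0} = sylvester_kernel (A - mat lam) S"
    by (rule iffD1[OF rk(2) rank_ge])
  have rank: "rank (eig_J S A xs) = r" by (rule antisym[OF rk(1) rank_ge])
  define Xs where "Xs = snd (unflatten_pair xs)"
  have "Xs \<noteq> 0" unfolding Xs_def by (rule eig_solution_nonzero[OF ker])
  then obtain v0 where "Xs *v v0 \<noteq> 0 *v v0" unfolding matrix_eq by blast
  then have v0: "Xs *v v0 \<noteq> 0" "v0 \<noteq> 0" by auto
  \<comment> \<open>If \<open>X\<close> is within \<open>\<rho>\<close> of \<open>Xs\<close>, then
    \<open>X *v v0\<close> keeps at least half the norm of \<open>Xs *v v0\<close>, so the spectral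
    norm of \<open>X\<close> is at least \<open>\<rho>\<close>.\<close>
  define \<rho> where "\<rho> = norm (Xs *v v0) / (2 * norm v0)"
  have \<rho>: "\<rho> > 0" using v0 by (simp add: \<rho>_def)
  \<comment> \<open>The rank condition is recorded so that the projection is defined at every foot
    point and equals the Jacobian there.\<close>
  define T where "T = {z \<in> eig_solutions A lam S. rank (eig_J S A z) = r}"
  obtain \<rho>0 where \<rho>0: "\<rho>0 > 0" and foot0: "\<forall>x. norm (x - xs) < \<rho>0 \<longrightarrow> (\<exists>z\<in>eig_solutions A lam S. eig_f S A z = 0 \<and>
      rank (eig_J S A z) = r \<and> (\<forall>u. eig_J S A z *v u = 0 \<longrightarrow> (x - z) \<bullet> u = 0) \<and>
      norm (z - xs) \<le> 2 * norm (x - xs))"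
    using eig_foot[OF xs rank dims(1,2) r] by blast
  have foot: "\<forall>x. norm (x - xs) < \<rho>0 \<longrightarrow> (\<exists>z\<in>T. eig_f S A z = 0 \<and> rank (eig_J S A z) = r \<and>
      (\<forall>u. eig_J S A z *v u = 0 \<longrightarrow> (x - z) \<bullet> u = 0) \<and> norm (z - xs) \<le> 2 * norm (x - xs))"
    using foot0 unfolding T_def by blast
  define L where "L = 2 * real CARD(unit + 'n \<times> 'k)"
  have L: "L \<ge> 1" unfolding L_def by simp
  have tay: "norm (eig_f S G y - eig_f S G x - eig_J S G x *v (y - x)) \<le> L * (norm (y - x))\<^sup>2" for G x y
    using eig_f_taylor[of S G y x] mult_right_mono[OF L, of "(norm (y - x))\<^sup>2"] by simp
  have par: "norm (eig_f S G x - eig_f S H x) \<le> L * norm (G - H) * norm x" for G H x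
    using eig_f_parameter[of S G x H] mult_right_mono[OF L, of "norm (G - H) * norm x"] by (simp add: mult.assoc)
  have lip: "norm (eig_J S G x - eig_J S H y) \<le> L * (norm (G - H) + norm (x - y))"
    for G H :: "complex^'n^'n" and x y
    unfolding L_def by (rule eig_J_lipschitz)
  have "L > 0" using L by simp
  from rank_newton_nonisolated[where f = "eig_f S" and J = "eig_J S" and A = A and T = T, OF this lip tay par
      eig_f_solution[OF xs] rank \<rho>0 foot \<rho>]
  obtain \<delta> K where \<delta>: "\<delta> > 0" and newton: "\<forall>H x0. norm (A - H) < \<delta> \<longrightarrow> norm (x0 - xs) < \<delta> \<longrightarrow>
    (\<forall>j. rank_projection_defined r (eig_J S H (trunc_newton r (eig_f S H) (eig_J S H) x0 j))) \<and>
    (\<exists>xt. trunc_newton r (eig_f S H) (eig_J S H) x0 \<longlonglongrightarrow> xt \<and>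
      (\<exists>z\<in>T. norm (z - xs) < \<rho> \<and> norm (xt - z) \<le> K * norm (A - H)) \<and>
      (H = A \<longrightarrow> quadratically_tendsto (trunc_newton r (eig_f S H) (eig_J S H) x0) xt))"
    by (elim exE conjE)
  define b where "b = norm (eig_J S A xs) + L * \<rho>"
  have b: "b \<ge> 0" using L \<rho> by (simp add: b_def)
  \<comment> \<open>Near \<open>xs\<close> the product of \<open>b\<close> and the condition number
    is at least 1, and the spectral norm of the matrix part is at least \<open>\<rho>\<close>; the
    factor \<open>b / \<rho>\<close> pays for inserting both. All ingredients are fixed before the
    perturbed matrix and the initial iterate.\<close>
  define \<alpha> where "\<alpha> = max K 0 * b / \<rho>"
  have bound: "K * t \<le> \<alpha> * onorm (rank_pinv r (eig_jacobian S (unflatten_pair z) A)) *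
      onorm ((*v) (snd (unflatten_pair z))) * t"
    if z: "z \<in> T" "norm (z - xs) < \<rho>" and t: "t \<ge> 0" for z t
  proof -
    let ?o1 = "onorm (rank_pinv r (eig_jacobian S (unflatten_pair z) A))"
    let ?X = "snd (unflatten_pair z)"
    have o1: "?o1 \<ge> 0" by (rule onorm_pos_le[OF bounded_linear_rank_pinv])
    have "norm (eig_J S A z) \<le> norm (eig_J S A xs) + norm (eig_J S A z - eig_J S A xs)"
      using norm_triangle_ineq[of "eig_J S A xs" "eig_J S A z - eig_J S A xs"] by simp
    also have "norm (eig_J S A z - eig_J S A xs) \<le> L * norm (z - xs)"
      using lip[of A z A xs] by simp
    also have "L * norm (z - xs) \<le> L * \<rho>" using z L by (intro mult_left_mono) auto
    finally have "norm (eig_J S A z) * ?o1 \<le> b * ?o1"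
      unfolding b_def using o1 by (intro mult_right_mono) auto
    moreover have "1 \<le> norm (eig_J S A z) * ?o1"
      using z(1) r by (intro onorm_rank_pinv_ge) (auto simp: T_def)
    ultimately have bo1: "1 \<le> b * ?o1" by linarith
    have "norm (?X - Xs) \<le> norm (unflatten_pair z - unflatten_pair xs)"
      using norm_fst_snd_le(2)[of "unflatten_pair z - unflatten_pair xs"] by (simp add: Xs_def)
    also have "\<dots> = norm (z - xs)" by (simp add: unflatten_pair_diff[symmetric] norm_unflatten_pair)
    finally have "norm (?X - Xs) \<le> \<rho>" using z by simp
    then have "norm ((?X - Xs) *v v0) \<le> \<rho> * norm v0"
      using norm_matrix_vector_mult_le[of "?X - Xs" v0] mult_right_mono[of "norm (?X - Xs)" \<rho> "norm v0"] by simp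
    moreover have "norm (Xs *v v0) = 2 * (\<rho> * norm v0)" using v0 by (simp add: \<rho>_def)
    moreover have "norm (Xs *v v0) \<le> norm (?X *v v0) + norm ((?X - Xs) *v v0)"
      using norm_triangle_ineq4[of "?X *v v0" "(?X - Xs) *v v0"]
      by (simp add: matrix_vector_mult_diff_rdistrib)
    moreover have "norm (?X *v v0) \<le> onorm ((*v) ?X) * norm v0"
      by (rule onorm[OF matrix_vector_mul_bounded_linear])
    ultimately have "\<rho> * norm v0 \<le> onorm ((*v) ?X) * norm v0" by linarith
    then have o2: "\<rho> \<le> onorm ((*v) ?X)" using v0 by simp
    have "1 * \<rho> \<le> (b * ?o1) * onorm ((*v) ?X)"
      using bo1 o2 \<rho> by (intro mult_mono) auto
    then have "1 \<le> (b * ?o1) * onorm ((*v) ?X) / \<rho>" using \<rho> by simp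
    then have "(max K 0 * t) * 1 \<le> (max K 0 * t) * ((b * ?o1) * onorm ((*v) ?X) / \<rho>)"
      using t by (intro mult_left_mono) auto
    moreover have "K * t \<le> max K 0 * t" using t by (intro mult_right_mono) auto
    moreover have "(max K 0 * t) * ((b * ?o1) * onorm ((*v) ?X) / \<rho>) = \<alpha> * ?o1 * onorm ((*v) ?X) * t"
      by (simp add: \<alpha>_def)
    ultimately show ?thesis by linarith
  qed
  \<comment> \<open>The error bound is purely linear in the perturbation, hence the coefficient 0 of
    the second-order term.\<close>
  have main: "(\<forall>j. jacobian_projection_defined r S (rank_newton r S At p0 j) At) \<and>
      (\<exists>pt. rank_newton r S At p0 \<longlonglongrightarrow> pt \<and>
        (\<exists>X. (lam, X) \<in> Sol \<and> jacobian_projection_defined r S (lam, X) A \<and>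
          norm (pt - (lam, X)) \<le>
            \<alpha> * onorm (rank_pinv r (eig_jacobian S (lam, X) A)) * onorm ((*v) X) * norm (A - At)
            + 0 * (norm (A - At))\<^sup>2) \<and>
        (At = A \<longrightarrow> quadratically_tendsto (rank_newton r S At p0) pt))"
    if At: "norm (A - At) < \<delta>" and p0: "norm (p0 - p) < \<delta>" for At p0
  proof -
    let ?y = "rank_newton r S At p0"
    define y where "y = trunc_newton r (eig_f S At) (eig_J S At) (flatten_pair p0)"
    have seq: "y j = flatten_pair (?y j)" for j
      unfolding y_def by (rule trunc_newton_eq_rank_newton)
    have start: "norm (flatten_pair p0 - xs) < \<delta>"
      using p0 by (simp add: xs_def flatten_pair_diff[symmetric] norm_flatten_pair)
    note conv = newton[THEN spec, THEN spec, THEN mp, THEN mp, OF At start, folded y_def]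
    from conv[THEN conjunct2] obtain xt
      where xt: "y \<longlonglongrightarrow> xt"
        and xt_z: "\<exists>z\<in>T. norm (z - xs) < \<rho> \<and> norm (xt - z) \<le> K * norm (A - At)"
        and quad: "At = A \<longrightarrow> quadratically_tendsto y xt"
      by (elim exE conjE)
    from xt_z obtain z where z: "z \<in> T" "norm (z - xs) < \<rho>" "norm (xt - z) \<le> K * norm (A - At)"
      by blast
    define pt where "pt = unflatten_pair xt"
    have diff: "norm (?y j - pt) = norm (y j - xt)" for j
      using norm_unflatten_pair_diff[of xt "?y j"] by (simp add: pt_def norm_minus_commute seq)
    have lim: "?y \<longlonglongrightarrow> pt"
      using xt unfolding tendsto_iff dist_norm diff .
    define X where "X = snd (unflatten_pair z)"
    have z_eq: "unflatten_pair z = (lam, X)"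
      using z(1) by (simp add: T_def eig_solutions_def prod_eq_iff X_def)
    have 1: "(lam, X) \<in> Sol"
      using z(1) unfolding z_eq[symmetric] memSol flatten_unflatten_pair T_def by blast
    have 2: "jacobian_projection_defined r S (lam, X) A"
      unfolding z_eq[symmetric] jacobian_projection_defined_iff flatten_unflatten_pair
      by (rule rank_projection_eq_self(1)) (use z(1) in \<open>simp add: T_def\<close>)
    have "norm (pt - (lam, X)) = norm (xt - z)"
      unfolding pt_def z_eq[symmetric] unflatten_pair_diff[symmetric] by (rule norm_unflatten_pair)
    then have 3: "norm (pt - (lam, X)) \<le>
        \<alpha> * onorm (rank_pinv r (eig_jacobian S (lam, X) A)) * onorm ((*v) X) * norm (A - At)
        + 0 * (norm (A - At))\<^sup>2"
      using z(3) bound[OF z(1,2), of "norm (A - At)"] unfolding z_eq snd_conv by simp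
    have 4: "quadratically_tendsto ?y pt" if "At = A"
      using quad[THEN mp, OF that] lim unfolding quadratically_tendsto_def diff by blast
    have 5: "\<forall>j. jacobian_projection_defined r S (?y j) At"
      using conv[THEN conjunct1] by (simp only: jacobian_projection_defined_iff seq simp_thms)
    show ?thesis by (intro conjI exI[of _ pt] exI[of _ X] 1 2 3 5 lim impI 4)
  qed
  show "\<exists>\<delta>>0. \<exists>\<epsilon>>0. \<exists>\<alpha> K. \<forall>At p0. norm (A - At) < \<delta> \<longrightarrow> norm (p0 - p) < \<epsilon> \<longrightarrow>
        (\<forall>j. jacobian_projection_defined r S (rank_newton r S At p0 j) At) \<and>
        (\<exists>pt. rank_newton r S At p0 \<longlonglongrightarrow> pt \<and>
          (\<exists>X. (lam, X) \<in> Sol \<and> jacobian_projection_defined r S (lam, X) A \<and>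
            norm (pt - (lam, X)) \<le>
              \<alpha> * onorm (rank_pinv r (eig_jacobian S (lam, X) A)) * onorm ((*v) X) * norm (A - At)
              + K * (norm (A - At))\<^sup>2) \<and>
          (At = A \<longrightarrow> quadratically_tendsto (rank_newton r S At p0) pt))"
    by (rule exI[of _ \<delta>], rule conjI[OF \<delta>], rule exI[of _ \<delta>], rule conjI[OF \<delta>],
      rule exI[of _ \<alpha>], rule exI[of _ 0], intro allI impI, rule main; assumption)
qed

end
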